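(* Let $X=(V,E)$ be a $\Gamma$-nilpotent covering graph of a finite graph $X_0$ with a $\Gamma$-invariant transition probability $p$ whose induced walk on $X_0$ is irreducible, let $G$ be the associated nilpotent Lie group, and let $\Phi_0:V\to G$ be a modified harmonic realization. Assume (A1) ($G$ is stratified of step $r$) and (A2) (the random walk is centered). Let $t>0$. For every $f\in C_\infty^\infty(G)$ there is a constant $C=C(G,f,p,\Phi_0,t)>0$ such that $$\big\|\mathcal{L}^{[nt]}\mathcal{P}^H_{n^{-1/2}}f-\mathcal{P}^H_{n^{-1/2}}e^{t\mathcal{A}(\Phi_0)}f\big\|_\infty\le\frac{C}{n^{1/2}},\qquad n\in\mathbb N,$$ where $\|\cdot\|_\infty$ is the sup-norm over $V$.
   Context: **Graphs.** In a graph $(V,E)$, $E$ is the set of oriented edges; $o(e),t(e),\overline e$ are the origin, terminus and inverse of $e\in E$, and $E_x=\{e\in E: o(e)=x\}$. $\Gamma$ is a torsion-free finitely generated nilpotent group and $X=(V,E)$ is an infinite connected graph on which $\Gamma$ acts freely by graph automorphisms with finite quotient graph $X_0=\Gamma\backslash X=(V_0,E_0)$; $X$ is called a $\Gamma$-nilpotent covering graph. **Random walk.** $p:E\to[0,1]$ satisfies $\sum_{e\in E_x}p(e)=1$ ($x\in V$), $p(e)+p(\overline e)>0$ and $p(\gamma e)=p(e)$ ($e\in E,\gamma\in\Gamma$). It descends to a transition probability on $X_0$, also denoted $p$, whose random walk is assumed irreducible. $m:V_0\to(0,1]$ is the unique normalized invariant measure: $\sum_{x\in V_0}m(x)=1$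 and $\sum_{e\in (E_0)_x}p(\overline e)m(t(e))=m(x)$ for $x\in V_0$. Put $\widetilde m(e)=p(e)m(o(e))$, $e\in E_0$. $\{w_n\}_{n\ge0}$ is the random walk on $X$ with transition probability $p$. **Lie group.** $G=(G,\bullet)$ is the connected, simply connected nilpotent Lie group in which $\Gamma$ is a cocompact lattice, with Lie algebra $\mathfrak g$; $\log:G\to\mathfrak g$ is the inverse of $\exp$. (A1): $G$ is stratified of step $r$: $\mathfrak g=\mathfrak g^{(1)}\oplus\cdots\oplus\mathfrak g^{(r)}$ with $[\mathfrak g^{(k)},\mathfrak g^{(\ell)}]\subset\mathfrak g^{(k+\ell)}$ if $k+\ell\le r$, and $\mathfrak g^{(k)}=[\mathfrak g^{(1)},\mathfrak g^{(k-1)}]$ for $k=2,\dots,r$. Let $d_k=\dim\mathfrak g^{(k)}$, $D=d_1+\cdots+d_r$, and fix a basis $\mathfrak a_1,\dots,\mathfrak a_D$ of $\mathfrak g$ such that $\mathfrak a_{d_1+\cdots+d_{k-1}+1},\dots,\mathfrak a_{d_1+\cdots+d_k}$ is a basis of $\mathfrak g^{(k)}$; for such indices $i$ put $\sigma_i=k$. For $v\in\mathfrak g$, $v|_{\mathfrak a_i}$ is its $\mathfrak a_i$-coordinate and $v|_{\mathfrak g^{(1)}}$ its $\mathfrak g^{(1)}$-component. For $x=\exp(\sum_i x_i\mathfrak a_i)\in G$ put $|x|=\sum_{i=1}^D|x_i|^{1/\sigma_i}$. The dilation is $\tau_\varepsilon(\exp(\mathfrak a^{(1)}+\cdots+\mathfrak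 a^{(r)}))=\exp(\varepsilon\mathfrak a^{(1)}+\cdots+\varepsilon^r\mathfrak a^{(r)})$, $\mathfrak a^{(k)}\in\mathfrak g^{(k)}$. Each $\mathfrak a\in\mathfrak g$ acts as the left invariant vector field $\mathfrak a f(x)=\frac{d}{ds}\big|_{s=0}f(x\bullet\exp(s\mathfrak a))$. For a multi-index $I=(i_1,\dots,i_D)\in(\mathbb N\cup\{0\})^D$: $\mathfrak a^I=\mathfrak a_1^{i_1}\cdots\mathfrak a_D^{i_D}$, $d(I)=\sum_k\sigma_k i_k$. $C_\infty(G)$ is the space of continuous real functions on $G$ vanishing at infinity, and $$C_\infty^\infty(G)=\bigcap_{k=1}^\infty\Big\{f\in C_\infty(G):\ \lim_{|x|\to\infty}\mathfrak a^If(x)=0\ \text{ for all multi-indices } I \text{ with } d(I)=k\Big\}$$ (smooth functions all of whose derivatives $\mathfrak a^I f$ vanish at infinity). **Modified harmonic realization.** Let $\gamma_p=\sum_{e\in E_0}\widetilde m(e)e\in H_1(X_0,\mathbb R)$ and let $\rho_{\mathbb R}:H_1(X_0,\mathbb R)\to\Gamma/[\Gamma,\Gamma]\otimes\mathbb R\cong\mathfrak g^{(1)}$ be the surjective linear map induced by the canonical surjection $\pi_1(X_0)\to\Gamma$. A map $\Phi:V\to G$ is a $\Gamma$-equivariant realization if $\Phi(\gamma x)=\gamma\bullet\Phi(x)$; write $d\Phi(e)=\Phi(o(e))^{-1}\bullet\Phi(t(e))$. A $\Gamma$-equivariant realization $\Phi_0$ is modified harmonic if $\sum_{e\in E_x}p(e)\log(d\Phi_0(e))|_{\mathfrak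 g^{(1)}}=\rho_{\mathbb R}(\gamma_p)$ for all $x\in V$. (A2): the walk is centered: $\lim_{n\to\infty}\frac1n\log(\Phi_0(w_n))|_{\mathfrak g^{(1)}}=0$ a.s.; equivalently $\rho_{\mathbb R}(\gamma_p)=0$. **Generator and semigroup.** With $\widetilde e\in E$ any lift of $e\in E_0$, put $A_{ij}(\Phi_0)=\sum_{e\in E_0}\widetilde m(e)\,\log(d\Phi_0(\widetilde e))|_{\mathfrak a_i}\log(d\Phi_0(\widetilde e))|_{\mathfrak a_j}$ for $1\le i,j\le d_1$ and $\beta_i(\Phi_0)=\sum_{e\in E_0}\widetilde m(e)\log(d\Phi_0(\widetilde e))|_{\mathfrak a_i}$ for $d_1<i\le d_1+d_2$, and $$\mathcal A(\Phi_0)=\frac12\sum_{i,j=1}^{d_1}A_{ij}(\Phi_0)\mathfrak a_i\mathfrak a_j+\sum_{i=d_1+1}^{d_1+d_2}\beta_i(\Phi_0)\mathfrak a_i .$$ $(e^{t\mathcal A(\Phi_0)})_{t\ge0}$ is the $C_0$-semigroup on $C_\infty(G)$ with infinitesimal generator $\mathcal A(\Phi_0)$; explicitly $e^{t\mathcal A(\Phi_0)}f(x)=\int_Gf(x\bullet y)\,\nu^{\Phi_0}_t(dy)$ where $(\nu^{\Phi_0}_t)_{t\ge0}$ is the convolution semigroup of probability measures on $G$ with generator $\mathcal A(\Phi_0)$. **Operators.** $\mathcal Lf(x)=\sum_{e\in E_x}p(e)f(t(e))$ for $f\in C_\infty(X)$ (functions on $V$ vanishing at infinity); $\mathcal P^H_\varepsilon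 f(x)=f(\tau_\varepsilon(\Phi_0(x)))$, $x\in V$, for $f\in C_\infty(G)$. $[s]$ is the greatest integer $\le s$. *)

theory Defs
  imports
    "HOL-Probability.Probability"
    "HOL-Algebra.Group_Action"
    "HOL-Algebra.Generated_Groups"
    "Graph_Theory.Graph_Theory"
begin

section \<open>Smooth functions\<close>

text \<open>The class $C^k$ on a Euclidean space: all iterated directional derivatives up to order $k$
  exist and the last ones are continuous.\<close>

primrec smooth_upto ::
    "nat \<Rightarrow> ('a::euclidean_space \<Rightarrow> 'b::real_normed_vector) \<Rightarrow> bool" where
  "smooth_upto 0 f \<longleftrightarrow> continuous_on UNIV f"
| "smooth_upto (Suc k) f \<longleftrightarrow>
     (\<forall>x. f differentiable (at x)) \<and>
     (\<forall>v. smooth_upto k (\<lambda>x. frechet_derivative f (at x) v))"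

definition smooth :: "('a::euclidean_space \<Rightarrow> 'b::real_normed_vector) \<Rightarrow> bool" where
  "smooth f \<longleftrightarrow> (\<forall>k. smooth_upto k f)"


section \<open>Connected, simply connected nilpotent Lie groups\<close>

text \<open>A group \<open>G\<close> with its Lie algebra (the type \<open>'l\<close> with the bracket \<open>lie_br\<close>) and its
  exponential map \<open>lexp\<close>.  For a connected and simply connected nilpotent Lie group \<open>lexp\<close> is a
  diffeomorphism of the Lie algebra onto the group, so its inverse \<open>llog\<close> is one global chart, and
  the topology and the smooth structure of \<open>G\<close> are the ones transported by \<open>llog\<close>.\<close>

record ('g, 'l) lie_group = "'g monoid" +
  lexp :: "'l \<Rightarrow> 'g"
  lie_br :: "'l \<Rightarrow> 'l \<Rightarrow> 'l"

definition llog :: "('g, 'l, 'm) lie_group_scheme \<Rightarrow> 'g \<Rightarrow> 'l" where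
  "llog G = inv_into UNIV (lexp G)"

definition lie_topology ::
    "('g, 'l::euclidean_space, 'm) lie_group_scheme \<Rightarrow> 'g topology" where
  "lie_topology G = pullback_topology (carrier G) (llog G) euclidean"

definition lie_borel ::
    "('g, 'l::euclidean_space, 'm) lie_group_scheme \<Rightarrow> 'g measure" where
  "lie_borel G = sigma (carrier G) {U. openin (lie_topology G) U}"

definition smooth_fun ::
    "('g, 'l::euclidean_space, 'm) lie_group_scheme \<Rightarrow> ('g \<Rightarrow> real) \<Rightarrow> bool" where
  "smooth_fun G f \<longleftrightarrow> smooth (f \<circ> lexp G)"

text \<open>The left invariant vector field of \<open>u\<close>, acting on functions.\<close>

definition left_field ::
    "('g, 'l::euclidean_space, 'm) lie_group_scheme \<Rightarrow> 'l \<Rightarrow> ('g \<Rightarrow> real) \<Rightarrow> 'g \<Rightarrow> real" where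
  "left_field G u f x = deriv (\<lambda>s::real. f (x \<otimes>\<^bsub>G\<^esub> lexp G (s *\<^sub>R u))) 0"

primrec lie_lower_central ::
    "('g, 'l::euclidean_space, 'm) lie_group_scheme \<Rightarrow> nat \<Rightarrow> 'l set" where
  "lie_lower_central G 0 = UNIV"
| "lie_lower_central G (Suc k) = span {lie_br G u v | u v. v \<in> lie_lower_central G k}"

locale nilpotent_lie_group = group G
  for G :: "('g, 'l::euclidean_space, 'm) lie_group_scheme" (structure) +
  assumes lexp_bij: "bij_betw (lexp G) UNIV (carrier G)"
    and smooth_mult: "smooth (\<lambda>(u, v). llog G (lexp G u \<otimes> lexp G v))"
    and smooth_inv: "smooth (\<lambda>u. llog G (inv (lexp G u)))"
    and one_parameter:
      "lexp G ((s + t) *\<^sub>R u) = lexp G (s *\<^sub>R u) \<otimes> lexp G (t *\<^sub>R u)"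
    and lie_br_fields: "\<lbrakk>smooth_fun G f; x \<in> carrier G\<rbrakk> \<Longrightarrow>
      left_field G (lie_br G u v) f x =
        left_field G u (left_field G v f) x - left_field G v (left_field G u f) x"
    and lie_nilpotent: "\<exists>k. lie_lower_central G k = {0}"


section \<open>Stratified Lie groups\<close>

text \<open>The basis \<open>lie_basis\<close> of the Lie algebra is indexed by $1, \dots, D$.\<close>

record ('g, 'l) stratified_group = "('g, 'l) lie_group" +
  step :: nat
  layer :: "nat \<Rightarrow> 'l set"
  lie_basis :: "nat \<Rightarrow> 'l"

definition layer_dim ::
    "('g, 'l::euclidean_space, 'm) stratified_group_scheme \<Rightarrow> nat \<Rightarrow> nat" where
  "layer_dim G k = dim (layer G k)"

text \<open>The weight $\sigma_i$ of the basis index $i$: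
  $\sigma_i = k$ iff $d_1 + \dots + d_{k-1} < i \le d_1 + \dots + d_k$.\<close>

definition weight ::
    "('g, 'l::euclidean_space, 'm) stratified_group_scheme \<Rightarrow> nat \<Rightarrow> nat" where
  "weight G i = (LEAST k. i \<le> (\<Sum>j=1..k. layer_dim G j))"

definition layer_indices ::
    "('g, 'l::euclidean_space, 'm) stratified_group_scheme \<Rightarrow> nat \<Rightarrow> nat set" where
  "layer_indices G k = {i \<in> {1..DIM('l)}. weight G i = k}"

text \<open>The layers are $\mathfrak g^{(1)}, \dots, \mathfrak g^{(r)}$; with the convention
  $\mathfrak g^{(k)} = 0$ for all other \<open>k\<close>, \<open>layer_br\<close> also says that
  $[\mathfrak g^{(k)}, \mathfrak g^{(\ell)}] = 0$ for $k + \ell > r$.\<close>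

locale stratified_lie_group = nilpotent_lie_group G
  for G :: "('g, 'l::euclidean_space, 'm) stratified_group_scheme" (structure) +
  assumes step_pos: "1 \<le> step G"
    and layer_subspace: "subspace (layer G k)"
    and layer_outside: "k \<notin> {1..step G} \<Longrightarrow> layer G k = {0}"
    and layer_step: "layer G (step G) \<noteq> {0}"
    and layer_direct_sum:
      "\<exists>!w :: nat \<Rightarrow> 'l. (\<forall>k. w k \<in> layer G k) \<and> v = (\<Sum>k=1..step G. w k)"
    and layer_br: "\<lbrakk>u \<in> layer G k; v \<in> layer G l\<rbrakk> \<Longrightarrow> lie_br G u v \<in> layer G (k + l)"
    and layer_generated: "k \<in> {2..step G} \<Longrightarrow>
      layer G k = span {lie_br G u v | u v. u \<in> layer G 1 \<and> v \<in> layer G (k - 1)}"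
    and basis_inj: "inj_on (lie_basis G) {1..DIM('l)}"
    and basis_independent: "independent (lie_basis G ` {1..DIM('l)})"
    and basis_layer: "k \<in> {1..step G} \<Longrightarrow>
      span (lie_basis G ` layer_indices G k) = layer G k"

definition lie_coord ::
    "('g, 'l::euclidean_space, 'm) stratified_group_scheme \<Rightarrow> nat \<Rightarrow> 'l \<Rightarrow> real" where
  "lie_coord G i v = representation (lie_basis G ` {1..DIM('l)}) v (lie_basis G i)"

definition layer_part ::
    "('g, 'l::euclidean_space, 'm) stratified_group_scheme \<Rightarrow> nat \<Rightarrow> 'l \<Rightarrow> 'l" where
  "layer_part G k v = (\<Sum>i\<in>layer_indices G k. lie_coord G i v *\<^sub>R lie_basis G i)"

definition hom_norm ::
    "('g, 'l::euclidean_space, 'm) stratified_group_scheme \<Rightarrow> 'g \<Rightarrow> real" where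
  "hom_norm G x =
     (\<Sum>i=1..DIM('l). \<bar>lie_coord G i (llog G x)\<bar> powr (1 / real (weight G i)))"

definition dilation ::
    "('g, 'l::euclidean_space, 'm) stratified_group_scheme \<Rightarrow> real \<Rightarrow> 'g \<Rightarrow> 'g" where
  "dilation G \<epsilon> x = lexp G (\<Sum>k=1..step G. \<epsilon> ^ k *\<^sub>R layer_part G k (llog G x))"


section \<open>Function spaces and semigroups on the group\<close>

definition vanishes_at_infinity ::
    "('g, 'l::euclidean_space, 'm) stratified_group_scheme \<Rightarrow> ('g \<Rightarrow> real) \<Rightarrow> bool" where
  "vanishes_at_infinity G f \<longleftrightarrow>
     (\<forall>\<epsilon>>0. \<exists>R. \<forall>x\<in>carrier G. R \<le> hom_norm G x \<longrightarrow> \<bar>f x\<bar> < \<epsilon>)"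

definition C_inf ::
    "('g, 'l::euclidean_space, 'm) stratified_group_scheme \<Rightarrow> ('g \<Rightarrow> real) set" where
  "C_inf G = {f. continuous_map (lie_topology G) euclideanreal f \<and> vanishes_at_infinity G f}"

text \<open>$\mathfrak a^I = \mathfrak a_1^{i_1} \cdots \mathfrak a_D^{i_D}$
  (so $\mathfrak a_D$ is applied first), and $d(I)$.\<close>

definition field_power ::
    "('g, 'l::euclidean_space, 'm) stratified_group_scheme \<Rightarrow> (nat \<Rightarrow> nat) \<Rightarrow>
     ('g \<Rightarrow> real) \<Rightarrow> 'g \<Rightarrow> real" where
  "field_power G I f =
     foldr (\<lambda>i. left_field G (lie_basis G i) ^^ I i) [1..<Suc DIM('l)] f"

definition hom_degree ::
    "('g, 'l::euclidean_space, 'm) stratified_group_scheme \<Rightarrow> (nat \<Rightarrow> nat) \<Rightarrow> nat" where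
  "hom_degree G I = (\<Sum>i=1..DIM('l). weight G i * I i)"

definition C_inf_smooth ::
    "('g, 'l::euclidean_space, 'm) stratified_group_scheme \<Rightarrow> ('g \<Rightarrow> real) set" where
  "C_inf_smooth G = (\<Inter>k\<in>{1..}. {f \<in> C_inf G. smooth_fun G f \<and>
     (\<forall>I. hom_degree G I = k \<longrightarrow> vanishes_at_infinity G (field_power G I f))})"

definition C0_semigroup ::
    "('g, 'l::euclidean_space, 'm) stratified_group_scheme \<Rightarrow>
     (real \<Rightarrow> ('g \<Rightarrow> real) \<Rightarrow> 'g \<Rightarrow> real) \<Rightarrow> bool" where
  "C0_semigroup G T \<longleftrightarrow>
     (\<forall>t\<ge>0. \<forall>f\<in>C_inf G. T t f \<in> C_inf G) \<and>
     (\<forall>t\<ge>0. \<forall>f\<in>C_inf G. \<forall>g\<in>C_inf G. \<forall>a b. \<forall>x\<in>carrier G.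
        T t (\<lambda>y. a * f y + b * g y) x = a * T t f x + b * T t g x) \<and>
     (\<forall>t\<ge>0. \<exists>K. \<forall>f\<in>C_inf G.
        (SUP x\<in>carrier G. \<bar>T t f x\<bar>) \<le> K * (SUP x\<in>carrier G. \<bar>f x\<bar>)) \<and>
     (\<forall>f\<in>C_inf G. \<forall>x\<in>carrier G. T 0 f x = f x) \<and>
     (\<forall>s\<ge>0. \<forall>t\<ge>0. \<forall>f\<in>C_inf G. \<forall>x\<in>carrier G. T (s + t) f x = T s (T t f) x) \<and>
     (\<forall>f\<in>C_inf G. uniform_limit (carrier G) (\<lambda>h. T h f) f (at_right 0))"

text \<open>The graph of the infinitesimal generator, and the graph of the sup-norm closure of an
  operator \<open>A\<close> with domain \<^term>\<open>C_inf_smooth G\<close>.  A differential operator \<open>A\<close> is the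
  infinitesimal generator of a semigroup in the sense that these two graphs agree.  Values of
  functions outside \<^term>\<open>carrier G\<close> are irrelevant throughout.\<close>

definition generator_graph ::
    "('g, 'l::euclidean_space, 'm) stratified_group_scheme \<Rightarrow>
     (real \<Rightarrow> ('g \<Rightarrow> real) \<Rightarrow> 'g \<Rightarrow> real) \<Rightarrow> (('g \<Rightarrow> real) \<times> ('g \<Rightarrow> real)) set" where
  "generator_graph G T = {(f, g). f \<in> C_inf G \<and> g \<in> C_inf G \<and>
     uniform_limit (carrier G) (\<lambda>h x. (T h f x - f x) / h) g (at_right 0)}"

definition closure_graph ::
    "('g, 'l::euclidean_space, 'm) stratified_group_scheme \<Rightarrow>
     (('g \<Rightarrow> real) \<Rightarrow> 'g \<Rightarrow> real) \<Rightarrow> (('g \<Rightarrow> real) \<times> ('g \<Rightarrow> real)) set" where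
  "closure_graph G A = {(f, g). \<exists>F :: nat \<Rightarrow> 'g \<Rightarrow> real. (\<forall>n. F n \<in> C_inf_smooth G) \<and>
     uniform_limit (carrier G) F f sequentially \<and>
     uniform_limit (carrier G) (\<lambda>n. A (F n)) g sequentially}"

definition has_generator ::
    "('g, 'l::euclidean_space, 'm) stratified_group_scheme \<Rightarrow>
     (real \<Rightarrow> ('g \<Rightarrow> real) \<Rightarrow> 'g \<Rightarrow> real) \<Rightarrow> (('g \<Rightarrow> real) \<Rightarrow> 'g \<Rightarrow> real) \<Rightarrow> bool" where
  "has_generator G T A \<longleftrightarrow> C0_semigroup G T \<and> generator_graph G T = closure_graph G A"

definition convolution_semigroup ::
    "('g, 'l::euclidean_space, 'm) stratified_group_scheme \<Rightarrow> (real \<Rightarrow> 'g measure) \<Rightarrow> bool" where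
  "convolution_semigroup G \<nu> \<longleftrightarrow>
     (\<forall>t\<ge>0. prob_space (\<nu> t) \<and> sets (\<nu> t) = sets (lie_borel G)) \<and>
     \<nu> 0 = return (lie_borel G) \<one>\<^bsub>G\<^esub> \<and>
     (\<forall>s\<ge>0. \<forall>t\<ge>0.
        \<nu> (s + t) = distr (\<nu> s \<Otimes>\<^sub>M \<nu> t) (lie_borel G) (\<lambda>(x, y). x \<otimes>\<^bsub>G\<^esub> y)) \<and>
     (\<forall>f\<in>C_inf G. ((\<lambda>t. \<integral>y. f y \<partial>\<nu> t) \<longlongrightarrow> f \<one>\<^bsub>G\<^esub>) (at_right 0))"

definition convolution_operator ::
    "('g, 'l::euclidean_space, 'm) stratified_group_scheme \<Rightarrow> (real \<Rightarrow> 'g measure) \<Rightarrow>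
     real \<Rightarrow> ('g \<Rightarrow> real) \<Rightarrow> 'g \<Rightarrow> real" where
  "convolution_operator G \<nu> t f x = (\<integral>y. f (x \<otimes>\<^bsub>G\<^esub> y) \<partial>\<nu> t)"


section \<open>Nilpotent covering graphs\<close>

primrec lower_central :: "('c, 'm) monoid_scheme \<Rightarrow> nat \<Rightarrow> 'c set" where
  "lower_central \<Gamma> 0 = carrier \<Gamma>"
| "lower_central \<Gamma> (Suc k) = generate \<Gamma>
     {x \<otimes>\<^bsub>\<Gamma>\<^esub> y \<otimes>\<^bsub>\<Gamma>\<^esub> inv\<^bsub>\<Gamma>\<^esub> x \<otimes>\<^bsub>\<Gamma>\<^esub> inv\<^bsub>\<Gamma>\<^esub> y | x y.
        x \<in> carrier \<Gamma> \<and> y \<in> lower_central \<Gamma> k}"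

locale tf_fg_nilpotent_group = group \<Gamma> for \<Gamma> :: "('c, 'm) monoid_scheme" (structure) +
  assumes torsion_free:
      "\<lbrakk>\<gamma> \<in> carrier \<Gamma>; 0 < n; \<gamma> [^] (n::nat) = \<one>\<rbrakk> \<Longrightarrow> \<gamma> = \<one>"
    and finitely_generated:
      "\<exists>S. finite S \<and> S \<subseteq> carrier \<Gamma> \<and> generate \<Gamma> S = carrier \<Gamma>"
    and nilpotent: "\<exists>k. lower_central \<Gamma> k = {\<one>}"

text \<open>The quotient graph $\Gamma \backslash X$ for an action \<open>\<phi>\<close> on the vertices and \<open>\<psi>\<close> on the
  edges.  Its vertices and edges are orbits, and the image of an edge orbit under the
  equivariant map \<^term>\<open>tail X\<close> (or \<^term>\<open>head X\<close>, or the edge reversal) is again an orbit.\<close>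

definition quotient_graph ::
    "('c, 'm) monoid_scheme \<Rightarrow> ('v, 'e) pre_digraph \<Rightarrow> ('c \<Rightarrow> 'v \<Rightarrow> 'v) \<Rightarrow> ('c \<Rightarrow> 'e \<Rightarrow> 'e) \<Rightarrow>
     ('v set, 'e set) pre_digraph" where
  "quotient_graph \<Gamma> X \<phi> \<psi> =
     \<lparr>verts = orbits \<Gamma> (verts X) \<phi>, arcs = orbits \<Gamma> (arcs X) \<psi>,
      tail = (\<lambda>\<epsilon>. tail X ` \<epsilon>), head = (\<lambda>\<epsilon>. head X ` \<epsilon>)\<rparr>"

definition quotient_rev :: "('e \<Rightarrow> 'e) \<Rightarrow> 'e set \<Rightarrow> 'e set" where
  "quotient_rev arev \<epsilon> = arev ` \<epsilon>"

definition lift :: "'e set \<Rightarrow> 'e" where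
  "lift \<epsilon> = (SOME e. e \<in> \<epsilon>)"

locale nilpotent_covering_graph =
  tf_fg_nilpotent_group \<Gamma> + bidirected_digraph X arev +
  vertex_action: group_action \<Gamma> "verts X" \<phi> + edge_action: group_action \<Gamma> "arcs X" \<psi>
  for \<Gamma> :: "('c, 'm) monoid_scheme" (structure)
    and X :: "('v, 'e) pre_digraph" and arev :: "'e \<Rightarrow> 'e"
    and \<phi> :: "'c \<Rightarrow> 'v \<Rightarrow> 'v" and \<psi> :: "'c \<Rightarrow> 'e \<Rightarrow> 'e" +
  assumes infinite_graph: "infinite (verts X)"
    and connected_graph: "Digraph_Component.connected X"
    and tail_equivariant:
      "\<lbrakk>\<gamma> \<in> carrier \<Gamma>; e \<in> arcs X\<rbrakk> \<Longrightarrow> tail X (\<psi> \<gamma> e) = \<phi> \<gamma> (tail X e)"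
    and head_equivariant:
      "\<lbrakk>\<gamma> \<in> carrier \<Gamma>; e \<in> arcs X\<rbrakk> \<Longrightarrow> head X (\<psi> \<gamma> e) = \<phi> \<gamma> (head X e)"
    and rev_equivariant:
      "\<lbrakk>\<gamma> \<in> carrier \<Gamma>; e \<in> arcs X\<rbrakk> \<Longrightarrow> arev (\<psi> \<gamma> e) = \<psi> \<gamma> (arev e)"
    and free_action:
      "\<lbrakk>\<gamma> \<in> carrier \<Gamma>; x \<in> verts X; \<phi> \<gamma> x = x\<rbrakk> \<Longrightarrow> \<gamma> = \<one>"
    and finite_quotient_verts: "finite (verts (quotient_graph \<Gamma> X \<phi> \<psi>))"
    and finite_quotient_arcs: "finite (arcs (quotient_graph \<Gamma> X \<phi> \<psi>))"

text \<open>\<open>\<iota>\<close> embeds \<open>\<Gamma>\<close> in \<open>G\<close> as a discrete subgroup with compact quotient $\Gamma \backslash G$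
  (\<open>Q\<close> is the quotient topology on the set of cosets).\<close>

definition cocompact_lattice ::
    "('g, 'l::euclidean_space, 'm) lie_group_scheme \<Rightarrow> ('c, 'n) monoid_scheme \<Rightarrow>
     ('c \<Rightarrow> 'g) \<Rightarrow> bool" where
  "cocompact_lattice G \<Gamma> \<iota> \<longleftrightarrow>
     \<iota> \<in> hom \<Gamma> G \<and> inj_on \<iota> (carrier \<Gamma>) \<and>
     subtopology (lie_topology G) (\<iota> ` carrier \<Gamma>) = discrete_topology (\<iota> ` carrier \<Gamma>) \<and>
     (\<exists>Q. quotient_map (lie_topology G) Q (\<lambda>x. (\<iota> ` carrier \<Gamma>) #>\<^bsub>G\<^esub> x) \<and>
          compact_space Q)"


section \<open>Random walks\<close>

definition transition_probability ::
    "('v, 'e) pre_digraph \<Rightarrow> ('e \<Rightarrow> 'e) \<Rightarrow> ('e \<Rightarrow> real) \<Rightarrow> bool" where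
  "transition_probability X arev p \<longleftrightarrow>
     (\<forall>e\<in>arcs X. 0 \<le> p e \<and> p e \<le> 1) \<and>
     (\<forall>x\<in>verts X. (\<Sum>e\<in>out_arcs X x. p e) = 1) \<and>
     (\<forall>e\<in>arcs X. 0 < p e + p (arev e))"

definition quotient_prob :: "('e \<Rightarrow> real) \<Rightarrow> 'e set \<Rightarrow> real" where
  "quotient_prob p \<epsilon> = p (lift \<epsilon>)"

definition irreducible_walk :: "('v, 'e) pre_digraph \<Rightarrow> ('e \<Rightarrow> real) \<Rightarrow> bool" where
  "irreducible_walk Y q \<longleftrightarrow>
     (\<forall>x\<in>verts Y. \<forall>y\<in>verts Y. \<exists>c. pre_digraph.awalk Y x c y \<and> (\<forall>e\<in>set c. 0 < q e))"

definition invariant_measure ::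
    "('v, 'e) pre_digraph \<Rightarrow> ('e \<Rightarrow> 'e) \<Rightarrow> ('e \<Rightarrow> real) \<Rightarrow> ('v \<Rightarrow> real) \<Rightarrow> bool" where
  "invariant_measure Y rv q m \<longleftrightarrow>
     (\<forall>x\<in>verts Y. 0 < m x \<and> m x \<le> 1) \<and> (\<Sum>x\<in>verts Y. m x) = 1 \<and>
     (\<forall>x\<in>verts Y. (\<Sum>e\<in>out_arcs Y x. q (rv e) * m (head Y e)) = m x)"

definition edge_measure ::
    "('v, 'e) pre_digraph \<Rightarrow> ('e \<Rightarrow> real) \<Rightarrow> ('v \<Rightarrow> real) \<Rightarrow> 'e \<Rightarrow> real" where
  "edge_measure Y q m e = q e * m (tail Y e)"

text \<open>\<open>w\<close> is a time-homogeneous Markov chain on the vertices, started at \<open>x\<close>, on the probability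
  space \<open>M\<close>.\<close>

definition random_walk ::
    "('v, 'e) pre_digraph \<Rightarrow> ('e \<Rightarrow> real) \<Rightarrow> 'v \<Rightarrow> 'o measure \<Rightarrow> (nat \<Rightarrow> 'o \<Rightarrow> 'v) \<Rightarrow> bool" where
  "random_walk X p x M w \<longleftrightarrow>
     prob_space M \<and> (\<forall>n. w n \<in> measurable M (count_space (verts X))) \<and>
     x \<in> verts X \<and> (AE \<omega> in M. w 0 \<omega> = x) \<and>
     (\<forall>n. \<forall>s :: nat \<Rightarrow> 'v. range s \<subseteq> verts X \<longrightarrow>
        measure M {\<omega> \<in> space M. \<forall>k\<le>Suc n. w k \<omega> = s k} =
        measure M {\<omega> \<in> space M. \<forall>k\<le>n. w k \<omega> = s k} *
          (\<Sum>e\<in>{e \<in> out_arcs X (s n). head X e = s (Suc n)}. p e))"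

definition walk_operator ::
    "('v, 'e) pre_digraph \<Rightarrow> ('e \<Rightarrow> real) \<Rightarrow> ('v \<Rightarrow> real) \<Rightarrow> 'v \<Rightarrow> real" where
  "walk_operator X p f x = (\<Sum>e\<in>out_arcs X x. p e * f (head X e))"


section \<open>First homology of a graph\<close>

text \<open>Real 1-chains of a graph are generated by the oriented edges, modulo $\overline e = -e$.
  We represent a chain by its antisymmetric coefficient function; \<open>edge_chain\<close> is the chain
  of one edge.  As a graph has no 2-cells, $H_1$ is the kernel of
  the boundary map $\partial e = t(e) - o(e)$.\<close>

definition edge_chain :: "('e \<Rightarrow> 'e) \<Rightarrow> 'e \<Rightarrow> 'e \<Rightarrow> real" where
  "edge_chain rv e e' = (if e' = e then 1 else 0) - (if e' = rv e then 1 else 0)"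

definition real_H1 :: "('v, 'e) pre_digraph \<Rightarrow> ('e \<Rightarrow> 'e) \<Rightarrow> ('e \<Rightarrow> real) set" where
  "real_H1 Y rv = {c. (\<forall>e. e \<notin> arcs Y \<longrightarrow> c e = 0) \<and> (\<forall>e\<in>arcs Y. c (rv e) = - c e) \<and>
     (\<forall>x\<in>verts Y. (\<Sum>e\<in>out_arcs Y x. c e) = 0)}"

text \<open>The homological direction $\gamma_p = \sum_e \widetilde m(e)\, e$.\<close>

definition homological_direction ::
    "('v, 'e) pre_digraph \<Rightarrow> ('e \<Rightarrow> 'e) \<Rightarrow> ('e \<Rightarrow> real) \<Rightarrow> ('v \<Rightarrow> real) \<Rightarrow> 'e \<Rightarrow> real" where
  "homological_direction Y rv q m e' =
     (\<Sum>e\<in>arcs Y. edge_measure Y q m e * edge_chain rv e e')"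

text \<open>\<open>\<rho>\<close> is the linear map from $H_1(X_0, \mathbb R)$ induced by the canonical surjection
  $\pi_1(X_0) \to \Gamma$.  The latter sends a closed path of $X_0$, lifted to a path
  in \<open>X\<close> from some \<open>x\<close> to \<open>\<gamma>x\<close>, to \<open>\<gamma>\<close>; and $\Gamma/[\Gamma,\Gamma] \otimes \mathbb R$ is
  identified with $\mathfrak g^{(1)}$ by $\gamma \mapsto \log(\gamma)|_{\mathfrak g^{(1)}}$.  Closed
  paths span $H_1$, so these conditions determine \<open>\<rho>\<close> on $H_1$.\<close>

definition induced_homology_map ::
    "('g, 'l::euclidean_space, 'm) stratified_group_scheme \<Rightarrow> ('c, 'n) monoid_scheme \<Rightarrow>
     ('c \<Rightarrow> 'g) \<Rightarrow> ('v, 'e) pre_digraph \<Rightarrow> ('e \<Rightarrow> 'e) \<Rightarrow> ('c \<Rightarrow> 'v \<Rightarrow> 'v) \<Rightarrow> ('c \<Rightarrow> 'e \<Rightarrow> 'e) \<Rightarrow>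
     (('e set \<Rightarrow> real) \<Rightarrow> 'l) \<Rightarrow> bool" where
  "induced_homology_map G \<Gamma> \<iota> X arev \<phi> \<psi> \<rho> \<longleftrightarrow>
     (let H = real_H1 (quotient_graph \<Gamma> X \<phi> \<psi>) (quotient_rev arev) in
      (\<forall>c\<in>H. \<forall>c'\<in>H. \<forall>a b. \<rho> (\<lambda>e. a * c e + b * c' e) = a *\<^sub>R \<rho> c + b *\<^sub>R \<rho> c')) \<and>
     (\<forall>\<gamma>\<in>carrier \<Gamma>. \<forall>x\<in>verts X. \<forall>es. pre_digraph.awalk X x es (\<phi> \<gamma> x) \<longrightarrow>
        \<rho> (\<lambda>e'. \<Sum>e\<leftarrow>es. edge_chain (quotient_rev arev) (Group_Action.orbit \<Gamma> \<psi> e) e') =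
          layer_part G 1 (llog G (\<iota> \<gamma>)))"


section \<open>Modified harmonic realizations\<close>

definition equivariant_realization ::
    "('g, 'l::euclidean_space, 'm) lie_group_scheme \<Rightarrow> ('c, 'n) monoid_scheme \<Rightarrow>
     ('c \<Rightarrow> 'g) \<Rightarrow> ('v, 'e) pre_digraph \<Rightarrow> ('c \<Rightarrow> 'v \<Rightarrow> 'v) \<Rightarrow> ('v \<Rightarrow> 'g) \<Rightarrow> bool" where
  "equivariant_realization G \<Gamma> \<iota> X \<phi> \<Phi> \<longleftrightarrow>
     (\<forall>x\<in>verts X. \<Phi> x \<in> carrier G) \<and>
     (\<forall>\<gamma>\<in>carrier \<Gamma>. \<forall>x\<in>verts X. \<Phi> (\<phi> \<gamma> x) = \<iota> \<gamma> \<otimes>\<^bsub>G\<^esub> \<Phi> x)"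

definition log_d ::
    "('g, 'l::euclidean_space, 'm) lie_group_scheme \<Rightarrow> ('v, 'e) pre_digraph \<Rightarrow> ('v \<Rightarrow> 'g) \<Rightarrow>
     'e \<Rightarrow> 'l" where
  "log_d G X \<Phi> e = llog G (inv\<^bsub>G\<^esub> (\<Phi> (tail X e)) \<otimes>\<^bsub>G\<^esub> \<Phi> (head X e))"

text \<open>The argument \<open>v\<close> is $\rho_{\mathbb R}(\gamma_p)$.\<close>

definition modified_harmonic ::
    "('g, 'l::euclidean_space, 'm) stratified_group_scheme \<Rightarrow> ('v, 'e) pre_digraph \<Rightarrow>
     ('e \<Rightarrow> real) \<Rightarrow> 'l \<Rightarrow> ('v \<Rightarrow> 'g) \<Rightarrow> bool" where
  "modified_harmonic G X p v \<Phi> \<longleftrightarrow>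
     (\<forall>x\<in>verts X. (\<Sum>e\<in>out_arcs X x. p e *\<^sub>R layer_part G 1 (log_d G X \<Phi> e)) = v)"

text \<open>In the next three definitions \<open>Y\<close> is the quotient graph of \<open>X\<close> and \<open>mt\<close> is the
  measure $\widetilde m$ on its edges.\<close>

definition coeff_A ::
    "('g, 'l::euclidean_space, 'm) stratified_group_scheme \<Rightarrow> ('v, 'e) pre_digraph \<Rightarrow>
     ('v set, 'e set) pre_digraph \<Rightarrow> ('e set \<Rightarrow> real) \<Rightarrow> ('v \<Rightarrow> 'g) \<Rightarrow> nat \<Rightarrow> nat \<Rightarrow> real" where
  "coeff_A G X Y mt \<Phi> i j =
     (\<Sum>e\<in>arcs Y. mt e * lie_coord G i (log_d G X \<Phi> (lift e)) * lie_coord G j (log_d G X \<Phi> (lift e)))"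

definition coeff_\<beta> ::
    "('g, 'l::euclidean_space, 'm) stratified_group_scheme \<Rightarrow> ('v, 'e) pre_digraph \<Rightarrow>
     ('v set, 'e set) pre_digraph \<Rightarrow> ('e set \<Rightarrow> real) \<Rightarrow> ('v \<Rightarrow> 'g) \<Rightarrow> nat \<Rightarrow> real" where
  "coeff_\<beta> G X Y mt \<Phi> i = (\<Sum>e\<in>arcs Y. mt e * lie_coord G i (log_d G X \<Phi> (lift e)))"

definition generator_A ::
    "('g, 'l::euclidean_space, 'm) stratified_group_scheme \<Rightarrow> ('v, 'e) pre_digraph \<Rightarrow>
     ('v set, 'e set) pre_digraph \<Rightarrow> ('e set \<Rightarrow> real) \<Rightarrow> ('v \<Rightarrow> 'g) \<Rightarrow>
     ('g \<Rightarrow> real) \<Rightarrow> 'g \<Rightarrow> real" where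
  "generator_A G X Y mt \<Phi> f x =
     (let d1 = layer_dim G 1; d2 = layer_dim G 2 in
      1/2 * (\<Sum>i=1..d1. \<Sum>j=1..d1. coeff_A G X Y mt \<Phi> i j *
               left_field G (lie_basis G i) (left_field G (lie_basis G j) f) x) +
      (\<Sum>i=d1+1..d1+d2. coeff_\<beta> G X Y mt \<Phi> i * left_field G (lie_basis G i) f x))"

definition scaling_operator ::
    "('g, 'l::euclidean_space, 'm) stratified_group_scheme \<Rightarrow> ('v \<Rightarrow> 'g) \<Rightarrow> real \<Rightarrow>
     ('g \<Rightarrow> real) \<Rightarrow> 'v \<Rightarrow> real" where
  "scaling_operator G \<Phi> \<epsilon> f x = f (dilation G \<epsilon> (\<Phi> x))"

end

theory Submission
  imports Defs
begin

text \<open>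
  Write \<open>\<epsilon> = n\<^sup>-\<^sup>1\<^sup>/\<^sup>2\<close>. The walk is compared with the semigroup through a third object: the operator \<open>S\<close>
  averaging \<open>h(x \<bullet> \<tau>\<^sub>\<epsilon> d\<Phi>\<^sub>0(e))\<close> over the edges \<open>e\<close> of the finite quotient graph with weights
  \<open>m(o(e)) p(e)\<close>, i.e. a random walk on \<open>G\<close> with independent increments. A left invariant field applied to \<open>S\<^sup>k f\<close>
  produces products of coadjoint matrices along the path; since the increments are centered,
  their fourth moments stay bounded for \<open>k \<le> nt\<close>, and so do the derivatives of \<open>S\<^sup>k f\<close> up to order four.
  A Taylor expansion gives \<open>S h = h + \<epsilon>\<^sup>2 A h + O(\<epsilon>\<^sup>3)\<close>, and the semigroup has the same expansion because
  \<open>A h\<close> is again in the domain of the generator; as the semigroup is contractive, the errors add up to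
  \<open>O(n \<epsilon>\<^sup>3)\<close>. The walk on \<open>X\<close> differs from \<open>S\<close> in that the second order term depends
  on the current vertex; its fluctuation around the mean is removed by a corrector, which solves a Poisson
  equation on the quotient graph. That dilations are group automorphisms is deduced from the graded bracket by an ordinary
  differential equation for the Maurer-Cartan form along rays, and assumption (A2) forces \<open>\<rho>(\<gamma>\<^sub>p) = 0\<close> by dominated
  convergence.
\<close>

section \<open>Calculus of smooth maps\<close>

text \<open>Increments multiply on the right and the fields are left invariant, so averaging over
  translates does not commute with differentiation: each step conjugates the fields by
  \<open>coadj\<close>. Estimating the conjugations one at a time gives (1 + C \<epsilon>)^k with k
  of order \<epsilon>^(-2), which explodes. What stays bounded is the mean of a smooth function of
  the conjugated vectors, because its first-order term is linear in the horizontal increment and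
  centering removes it. Hence the sum of squared norms \<open>sum_sq\<close>, whose square dominates
  products of up to four norms. Order four is forced by the semigroup, whose one-step expansion
  needs the generator twice. No derivative of the semigroup applied to f is ever estimated: it
  enters through contractivity and through its generator on smooth functions, while all derivatives
  fall on iterates of the average, which are finite sums of translates of f. The group law is
  accessible through its smoothness, its one-parameter subgroups and the commutators of its fields,
  so its algebra is derived from uniqueness of flows and not from a Baker-Campbell-Hausdorff
  series.\<close>

lemma smooth_upto_mono_Suc: "smooth_upto (Suc k) f \<Longrightarrow> smooth_upto k f"
proof (induction k arbitrary: f)
  case 0
  then have "\<And>x. f differentiable (at x)" by simp
  then show ?case
    by (simp add: continuous_on_eq_continuous_within differentiable_imp_continuous_within)
next
  case (Suc k)
  show ?case
    unfolding smooth_upto.simps(2)[of k]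
  proof (intro conjI allI)
    show "f differentiable at x" for x using Suc.prems by simp
    show "smooth_upto k (\<lambda>x. frechet_derivative f (at x) v)" for v
      by (rule Suc.IH) (use Suc.prems in simp)
  qed
qed

lemma smooth_upto_const [intro]: "smooth_upto k (\<lambda>x. c)"
  by (induction k arbitrary: c) (auto simp: frechet_derivative_const)

lemma smooth_upto_bounded_linear:
  fixes f :: "'a::euclidean_space \<Rightarrow> 'b::real_normed_vector"
  assumes "bounded_linear f"
  shows "smooth_upto k f"
proof (cases k)
  case 0
  then show ?thesis using assms by (simp add: linear_continuous_on)
next
  case (Suc j)
  have "frechet_derivative f (at x) = f" for x
    using assms by (metis bounded_linear_imp_has_derivative frechet_derivative_at)
  then show ?thesis
    using Suc assms bounded_linear_imp_differentiable by auto
qed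

lemma smooth_upto_linear_image:
  assumes "bounded_linear h" "smooth_upto k f"
  shows "smooth_upto k (\<lambda>x. h (f x))"
  using assms(2)
proof (induction k arbitrary: f)
  case 0
  then show ?case by (simp add: bounded_linear.continuous_on [OF assms(1)])
next
  case (Suc k)
  have d: "((\<lambda>x. h (f x)) has_derivative (\<lambda>v. h (frechet_derivative f (at x) v))) (at x)" for x
    by (rule bounded_linear.has_derivative [OF assms(1)])
      (use Suc.prems in \<open>simp add: frechet_derivative_works\<close>)
  then have "(\<lambda>x. h (f x)) differentiable (at x)" for x
    using differentiable_def by blast
  moreover have "frechet_derivative (\<lambda>x. h (f x)) (at x) = (\<lambda>v. h (frechet_derivative f (at x) v))" for x
    by (rule frechet_derivative_at [OF d, symmetric])
  ultimately show ?case using Suc by simp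
qed

lemma smooth_upto_add:
  assumes "smooth_upto k f" "smooth_upto k g"
  shows "smooth_upto k (\<lambda>x. f x + g x)"
  using assms
proof (induction k arbitrary: f g)
  case 0
  then show ?case by (simp add: continuous_on_add)
next
  case (Suc k)
  have "frechet_derivative (\<lambda>x. f x + g x) (at x) =
      (\<lambda>v. frechet_derivative f (at x) v + frechet_derivative g (at x) v)" for x
    by (rule frechet_derivative_at [symmetric], rule has_derivative_add)
      (use Suc.prems in \<open>simp_all add: frechet_derivative_works\<close>)
  with Suc show ?case by simp
qed

lemma smooth_upto_sum:
  assumes "\<And>i. i \<in> A \<Longrightarrow> smooth_upto k (f i)"
  shows "smooth_upto k (\<lambda>x. \<Sum>i\<in>A. f i x)"
  using assms by (induction A rule: infinite_finite_induct) (auto intro!: smooth_upto_add)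

lemma smooth_upto_scaleR:
  fixes a :: "'a::euclidean_space \<Rightarrow> real"
  assumes "smooth_upto k a" "smooth_upto k g"
  shows "smooth_upto k (\<lambda>x. a x *\<^sub>R g x)"
  using assms
proof (induction k arbitrary: a g)
  case 0
  then show ?case by (simp add: continuous_on_scaleR)
next
  case (Suc k)
  have "frechet_derivative (\<lambda>x. a x *\<^sub>R g x) (at x) =
      (\<lambda>v. a x *\<^sub>R frechet_derivative g (at x) v + frechet_derivative a (at x) v *\<^sub>R g x)" for x
    by (rule frechet_derivative_at [symmetric], rule has_derivative_scaleR)
      (use Suc.prems in \<open>simp_all add: frechet_derivative_works\<close>)
  moreover have "smooth_upto k a" "smooth_upto k g"
    using Suc.prems[THEN smooth_upto_mono_Suc] .
  ultimately show ?case
    using Suc by (auto intro!: smooth_upto_add)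
qed

text \<open>The chain rule is written as a sum over \<open>Basis\<close> of a scalar function times
  a composite of lower smoothness. The derivative then has the shape to which the product rule and
  the induction hypothesis apply.\<close>

lemma smooth_upto_compose:
  fixes f :: "'b::euclidean_space \<Rightarrow> 'c::real_normed_vector" and g :: "'a::euclidean_space \<Rightarrow> 'b"
  assumes "smooth_upto k f" "smooth_upto k g"
  shows "smooth_upto k (\<lambda>x. f (g x))"
  using assms
proof (induction k arbitrary: f g)
  case 0
  then show ?case by (auto intro: continuous_on_compose2)
next
  case (Suc k)
  have df: "(f has_derivative frechet_derivative f (at x)) (at x)" for x
    using Suc.prems by (simp add: frechet_derivative_works)
  have dg: "(g has_derivative frechet_derivative g (at x)) (at x)" for x
    using Suc.prems by (simp add: frechet_derivative_works)
  have d: "((\<lambda>x. f (g x)) has_derivative (\<lambda>v. frechet_derivative f (at (g x)) (frechet_derivative g (at x) v))) (at x)" for x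
    using diff_chain_at [OF dg df] by (simp add: o_def)
  have eq: "frechet_derivative (\<lambda>x. f (g x)) (at x) v =
      (\<Sum>b\<in>Basis. (frechet_derivative g (at x) v \<bullet> b) *\<^sub>R frechet_derivative f (at (g x)) b)" for x v
  proof -
    have "linear (frechet_derivative f (at (g x)))"
      using df has_derivative_linear by blast
    then have "frechet_derivative f (at (g x)) (\<Sum>b\<in>Basis. (frechet_derivative g (at x) v \<bullet> b) *\<^sub>R b) =
      (\<Sum>b\<in>Basis. (frechet_derivative g (at x) v \<bullet> b) *\<^sub>R frechet_derivative f (at (g x)) b)"
      by (simp add: linear_sum linear_cmul)
    then show ?thesis
      using fun_cong [OF frechet_derivative_at [OF d, of x], of v] by (simp add: euclidean_representation)
  qed
  have "smooth_upto k (\<lambda>x. frechet_derivative (\<lambda>x. f (g x)) (at x) v)" for v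
    unfolding eq
  proof (intro smooth_upto_sum smooth_upto_scaleR)
    fix b :: 'b assume "b \<in> Basis"
    show "smooth_upto k (\<lambda>x. frechet_derivative f (at (g x)) b)"
      using Suc.prems smooth_upto_mono_Suc [OF Suc.prems(2)] by (intro Suc.IH) simp_all
    show "smooth_upto k (\<lambda>x. frechet_derivative g (at x) v \<bullet> b)"
      using Suc.prems by (intro smooth_upto_linear_image [OF bounded_linear_inner_left]) simp
  qed
  moreover have "(\<lambda>x. f (g x)) differentiable (at x)" for x
    using d differentiable_def by blast
  ultimately show ?case by simp
qed

lemma smooth_differentiable: "smooth f \<Longrightarrow> f differentiable (at x)"
  unfolding smooth_def by (elim allE [of _ 1]) simp

lemma smooth_has_derivative:
  "smooth f \<Longrightarrow> (f has_derivative frechet_derivative f (at x)) (at x)"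
  using frechet_derivative_works smooth_differentiable by blast

lemma smooth_continuous: "smooth f \<Longrightarrow> continuous_on A f"
  by (simp add: continuous_at_imp_continuous_on differentiable_imp_continuous_within smooth_differentiable)

lemma smooth_frechet_derivative: "smooth f \<Longrightarrow> smooth (\<lambda>x. frechet_derivative f (at x) v)"
  unfolding smooth_def
proof
  fix k assume "\<forall>k. smooth_upto k f"
  then have "smooth_upto (Suc k) f" by blast
  then show "smooth_upto k (\<lambda>x. frechet_derivative f (at x) v)" by simp
qed

lemma smooth_const [intro, simp]: "smooth (\<lambda>x. c)"
  by (auto simp: smooth_def)

lemma smooth_bounded_linear: "bounded_linear f \<Longrightarrow> smooth f"
  by (simp add: smooth_def smooth_upto_bounded_linear)

lemma smooth_add: "smooth f \<Longrightarrow> smooth g \<Longrightarrow> smooth (\<lambda>x. f x + g x)"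
  by (simp add: smooth_def smooth_upto_add)

lemma smooth_sum: "(\<And>i. i \<in> A \<Longrightarrow> smooth (f i)) \<Longrightarrow> smooth (\<lambda>x. \<Sum>i\<in>A. f i x)"
  by (simp add: smooth_def smooth_upto_sum)

lemma smooth_scaleR: "smooth a \<Longrightarrow> smooth g \<Longrightarrow> smooth (\<lambda>x. a x *\<^sub>R g x)"
  for a :: "'a::euclidean_space \<Rightarrow> real"
  by (simp add: smooth_def smooth_upto_scaleR)

lemma smooth_compose: "smooth f \<Longrightarrow> smooth g \<Longrightarrow> smooth (\<lambda>x. f (g x))"
  for f :: "'b::euclidean_space \<Rightarrow> 'c::real_normed_vector" and g :: "'a::euclidean_space \<Rightarrow> 'b"
  by (simp add: smooth_def smooth_upto_compose)

lemma smooth_linear_image: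
  fixes h :: "'b::euclidean_space \<Rightarrow> 'c::real_normed_vector" and f :: "'a::euclidean_space \<Rightarrow> 'b"
  shows "bounded_linear h \<Longrightarrow> smooth f \<Longrightarrow> smooth (\<lambda>x. h (f x))"
  by (rule smooth_compose [OF smooth_bounded_linear])

lemma smooth_Pair:
  fixes f :: "'a::euclidean_space \<Rightarrow> 'b::euclidean_space" and g :: "'a \<Rightarrow> 'c::euclidean_space"
  assumes "smooth f" "smooth g"
  shows "smooth (\<lambda>x. (f x, g x))"
proof -
  have "bounded_linear (\<lambda>u::'b. (u, 0::'c))" "bounded_linear (\<lambda>u::'c. (0::'b, u))"
    by (intro bounded_linear_intros)+
  then have "smooth (\<lambda>x. (f x, 0::'c))" "smooth (\<lambda>x. (0::'b, g x))"
    using smooth_linear_image assms by blast+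
  from smooth_add [OF this] show ?thesis by simp
qed

lemma smooth_id: "smooth (\<lambda>x. x)"
  by (simp add: smooth_bounded_linear bounded_linear_ident)

lemma frechet_derivative_eq_sum_Basis:
  fixes f :: "'a::euclidean_space \<Rightarrow> 'b::real_normed_vector"
  assumes "f differentiable (at x)"
  shows "frechet_derivative f (at x) v = (\<Sum>b\<in>Basis. (v \<bullet> b) *\<^sub>R frechet_derivative f (at x) b)"
proof -
  have "linear (frechet_derivative f (at x))"
    using assms linear_frechet_derivative by blast
  then have "frechet_derivative f (at x) (\<Sum>b\<in>Basis. (v \<bullet> b) *\<^sub>R b) =
      (\<Sum>b\<in>Basis. (v \<bullet> b) *\<^sub>R frechet_derivative f (at x) b)"
    by (simp add: linear_sum linear_cmul)
  then show ?thesis by (simp add: euclidean_representation)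
qed

text \<open>\<open>smooth\<close> speaks of derivatives in a fixed direction; expanding the
  direction in \<open>Basis\<close> lets base point and direction vary together.\<close>

lemma smooth_frechet_derivative_apply:
  fixes f :: "'a::euclidean_space \<Rightarrow> 'b::real_normed_vector" and v g :: "'c::euclidean_space \<Rightarrow> 'a"
  assumes f: "smooth f" and g: "smooth g" and v: "smooth v"
  shows "smooth (\<lambda>x. frechet_derivative f (at (g x)) (v x))"
proof -
  have "smooth (\<lambda>x. \<Sum>b\<in>Basis. (v x \<bullet> b) *\<^sub>R frechet_derivative f (at (g x)) b)"
    using f g v
    by (intro smooth_sum smooth_scaleR smooth_linear_image [OF bounded_linear_inner_left]
        smooth_compose [OF smooth_frechet_derivative]) auto
  moreover have "(\<lambda>x. frechet_derivative f (at (g x)) (v x)) =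
      (\<lambda>x. \<Sum>b\<in>Basis. (v x \<bullet> b) *\<^sub>R frechet_derivative f (at (g x)) b)"
    by (rule ext, rule frechet_derivative_eq_sum_Basis, rule smooth_differentiable, rule f)
  ultimately show ?thesis by simp
qed

section \<open>The group law in the exponential chart\<close>

text \<open>Gronwall: with K a bound for B, the weighted square |z|^2 exp(-2Ks) is nonincreasing,
  nonnegative and zero at s = 0.\<close>

lemma linear_ode_zero:
  fixes z :: "real \<Rightarrow> 'a::euclidean_space"
  assumes B: "linear B" and z: "\<And>s. (z has_vector_derivative B (z s)) (at s)" and z0: "z 0 = 0"
  shows "z 1 = 0"
proof -
  obtain K where K: "\<And>x. norm (B x) \<le> norm x * K"
    using linear_conv_bounded_linear B bounded_linear.bounded by blast
  define \<phi> where "\<phi> s = (z s \<bullet> z s) * exp (- 2 * K * s)" for s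
  have "(\<phi> has_real_derivative (2 * (z s \<bullet> B (z s)) - 2 * K * (z s \<bullet> z s)) * exp (- 2 * K * s)) (at s)" for s
  proof -
    have "((\<lambda>s. z s \<bullet> z s) has_vector_derivative (z s \<bullet> B (z s) + B (z s) \<bullet> z s)) (at s)"
      by (rule bounded_bilinear.has_vector_derivative [OF bounded_bilinear_inner z z])
    then have "((\<lambda>s. z s \<bullet> z s) has_real_derivative (2 * (z s \<bullet> B (z s)))) (at s)"
      by (simp add: has_real_derivative_iff_has_vector_derivative inner_commute)
    then show ?thesis
      unfolding \<phi>_def by (auto intro!: derivative_eq_intros simp: algebra_simps)
  qed
  moreover have "(2 * (z s \<bullet> B (z s)) - 2 * K * (z s \<bullet> z s)) * exp (- 2 * K * s) \<le> 0" for s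
  proof -
    have "z s \<bullet> B (z s) \<le> norm (z s) * (norm (z s) * K)"
      using norm_cauchy_schwarz [of "z s" "B (z s)"] K [of "z s"]
      by (meson mult_left_mono norm_ge_zero order_trans)
    also have "\<dots> = K * (z s \<bullet> z s)"
      by (simp add: dot_square_norm power2_eq_square)
    finally have "2 * (z s \<bullet> B (z s)) - 2 * K * (z s \<bullet> z s) \<le> 0"
      by linarith
    then show ?thesis
      by (rule mult_nonpos_nonneg) (rule exp_ge_zero)
  qed
  ultimately have "\<phi> 1 \<le> \<phi> 0"
    using DERIV_nonpos_imp_nonincreasing [of 0 1 \<phi>] zero_le_one by metis
  then have "z 1 \<bullet> z 1 \<le> 0"
    using z0 by (simp add: \<phi>_def mult_le_0_iff)
  then show ?thesis
    by (metis inner_gt_zero_iff not_less)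
qed

context nilpotent_lie_group
begin

section \<open>The product in exponential coordinates and the flows of left invariant fields\<close>

lemma llog_lexp [simp]: "llog G (lexp G u) = u"
  using lexp_bij by (simp add: llog_def bij_betw_def)

lemma lexp_closed [simp]: "lexp G u \<in> carrier G"
  using lexp_bij by (auto simp: bij_betw_def)

lemma lexp_llog [simp]: "x \<in> carrier G \<Longrightarrow> lexp G (llog G x) = x"
  using lexp_bij by (simp add: llog_def bij_betw_def f_inv_into_f)

lemma lexp_zero [simp]: "lexp G 0 = \<one>"
proof -
  have "lexp G 0 = lexp G 0 \<otimes> lexp G 0"
    using one_parameter [of 0 0 0] by simp
  then show ?thesis
    by (metis l_cancel_one lexp_closed)
qed

lemma lexp_add: "lexp G ((s + t) *\<^sub>R u) = lexp G (s *\<^sub>R u) \<otimes> lexp G (t *\<^sub>R u)"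
  by (rule one_parameter)

text \<open>The Baker-Campbell-Hausdorff product, obtained here by transport from the group instead
  of from a series.\<close>

definition chart_mult :: "'l \<Rightarrow> 'l \<Rightarrow> 'l" where
  "chart_mult x y = llog G (lexp G x \<otimes> lexp G y)"

lemma lexp_chart_mult: "lexp G (chart_mult x y) = lexp G x \<otimes> lexp G y"
  by (simp add: chart_mult_def)

lemma llog_mult: "x \<in> carrier G \<Longrightarrow> y \<in> carrier G \<Longrightarrow> llog G (x \<otimes> y) = chart_mult (llog G x) (llog G y)"
  by (simp add: chart_mult_def)

lemma lexp_inject: "lexp G x = lexp G y \<longleftrightarrow> x = y"
  by (metis llog_lexp)

lemma chart_mult_0 [simp]: "chart_mult 0 y = y" "chart_mult x 0 = x"
  by (simp_all add: chart_mult_def)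

lemma chart_mult_assoc: "chart_mult (chart_mult x y) z = chart_mult x (chart_mult y z)"
  by (simp add: m_assoc lexp_chart_mult flip: lexp_inject)

lemma chart_mult_scaleR: "chart_mult (s *\<^sub>R u) (t *\<^sub>R u) = (s + t) *\<^sub>R u"
  by (simp add: lexp_chart_mult lexp_add flip: lexp_inject)

lemma chart_mult_minus [simp]: "chart_mult (- x) x = 0" "chart_mult x (- x) = 0"
  using chart_mult_scaleR [of "- 1" x 1] chart_mult_scaleR [of 1 x "- 1"] by simp_all

lemma chart_mult_minus_cancel [simp]:
  "chart_mult (- x) (chart_mult x y) = y" "chart_mult x (chart_mult (- x) y) = y"
  by (simp_all flip: chart_mult_assoc)

lemma smooth_chart_mult: "smooth (\<lambda>(x, y). chart_mult x y)"
  unfolding chart_mult_def by (rule smooth_mult)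

lemma smooth_chart_mult_compose:
  fixes f g :: "'b::euclidean_space \<Rightarrow> 'l"
  assumes "smooth f" "smooth g"
  shows "smooth (\<lambda>x. chart_mult (f x) (g x))"
  using smooth_compose [OF smooth_chart_mult smooth_Pair [OF assms]] by simp

definition mult_deriv :: "'l \<Rightarrow> 'l \<Rightarrow> 'l \<times> 'l \<Rightarrow> 'l" where
  "mult_deriv x y = frechet_derivative (\<lambda>(x, y). chart_mult x y) (at (x, y))"

lemma linear_mult_deriv: "linear (mult_deriv x y)"
  unfolding mult_deriv_def
  by (rule linear_frechet_derivative, rule smooth_differentiable, rule smooth_chart_mult)

lemma chart_mult_has_vector_derivative:
  assumes "(f has_vector_derivative f') (at s)" "(g has_vector_derivative g') (at s)"
  shows "((\<lambda>s. chart_mult (f s) (g s)) has_vector_derivative mult_deriv (f s) (g s) (f', g')) (at s)"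
proof -
  have 1: "((\<lambda>(x, y). chart_mult x y) has_derivative mult_deriv (f s) (g s)) (at (f s, g s))"
    unfolding mult_deriv_def by (rule smooth_has_derivative, rule smooth_chart_mult)
  have 2: "((\<lambda>s. (f s, g s)) has_vector_derivative (f', g')) (at s)"
    using assms by (rule has_vector_derivative_Pair)
  show ?thesis
    using has_derivative_compose [OF 2 [unfolded has_vector_derivative_def] 1]
    by (simp add: has_vector_derivative_def linear_cmul [OF linear_mult_deriv, symmetric])
qed

text \<open>The left invariant field of \<open>u\<close> read in the chart: the differential at the
  identity of left multiplication by x, applied to \<open>u\<close>.\<close>

definition chart_field :: "'l \<Rightarrow> 'l \<Rightarrow> 'l" where
  "chart_field u x = mult_deriv x 0 (0, u)"

lemma has_vector_derivative_scaleR_const: "((\<lambda>s. s *\<^sub>R u) has_vector_derivative u) (at s)"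
  by (auto intro!: derivative_eq_intros simp: has_vector_derivative_def)

text \<open>Splitting exp(ru) as exp(su) exp((r-s)u) reduces the derivative at time s to the
  derivative at time 0 from a moved starting point.\<close>

lemma chart_field_flow:
  "((\<lambda>s. chart_mult x (s *\<^sub>R u)) has_vector_derivative chart_field u (chart_mult x (s *\<^sub>R u))) (at s)"
proof -
  have "((\<lambda>r. (r - s) *\<^sub>R u) has_vector_derivative u) (at s)"
    by (auto intro!: derivative_eq_intros simp: has_vector_derivative_def)
  then have "((\<lambda>r. chart_mult (chart_mult x (s *\<^sub>R u)) ((r - s) *\<^sub>R u))
      has_vector_derivative mult_deriv (chart_mult x (s *\<^sub>R u)) ((s - s) *\<^sub>R u) (0, u)) (at s)"
    by (intro chart_mult_has_vector_derivative has_vector_derivative_const)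
  then show ?thesis
    by (simp add: chart_mult_assoc chart_mult_scaleR chart_field_def)
qed

lemma linear_chart_field: "linear (\<lambda>u. chart_field u x)"
proof -
  have "linear (\<lambda>u::'l. (0::'l, u))"
    by (intro bounded_linear.linear bounded_linear_intros)
  from linear_compose [OF this linear_mult_deriv] show ?thesis
    by (simp add: chart_field_def [abs_def] o_def)
qed

lemma smooth_chart_field: "smooth (chart_field u)"
proof -
  have "smooth (\<lambda>x. (x::'l, 0::'l))"
    by (intro smooth_Pair smooth_id smooth_const)
  then have "smooth (\<lambda>x. frechet_derivative (\<lambda>(x, y). chart_mult x y) (at (x, 0)) (0, u))"
    by (intro smooth_frechet_derivative_apply smooth_chart_mult smooth_const)
  then show ?thesis
    by (simp add: chart_field_def [abs_def] mult_deriv_def)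
qed

lemma chart_field_radial: "chart_field x (s *\<^sub>R x) = x"
proof -
  have "((\<lambda>r. chart_mult 0 (r *\<^sub>R x)) has_vector_derivative chart_field x (chart_mult 0 (s *\<^sub>R x))) (at s)"
    by (rule chart_field_flow)
  then have "((\<lambda>r. r *\<^sub>R x) has_vector_derivative chart_field x (s *\<^sub>R x)) (at s)"
    by simp
  then show ?thesis
    by (rule vector_derivative_unique_at [OF _ has_vector_derivative_scaleR_const])
qed

lemma chart_field_0 [simp]: "chart_field u 0 = u"
  using chart_field_radial [of u 0] by simp

text \<open>No general uniqueness theorem for differential equations enters: multiplying an integral
  curve on the right by exp(-su) gives a curve with derivative 0.\<close>

lemma chart_field_flow_unique:
  assumes z: "\<And>s. (z has_vector_derivative chart_field u (z s)) (at s)"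
  shows "z s = chart_mult (z 0) (s *\<^sub>R u)"
proof -
  \<comment> \<open>The needed algebraic identity for \<open>mult_deriv\<close> is read off from the
    explicit flow through y, for which the product with exp(-(s+r)u) does not depend on r.\<close>
  have key: "mult_deriv y (- (s *\<^sub>R u)) (chart_field u y, - u) = 0" for y s
  proof -
    have "((\<lambda>r. chart_mult (chart_mult y (r *\<^sub>R u)) (- ((s + r) *\<^sub>R u))) has_vector_derivative
       mult_deriv (chart_mult y (0 *\<^sub>R u)) (- ((s + 0) *\<^sub>R u)) (chart_field u (chart_mult y (0 *\<^sub>R u)), - u)) (at 0)"
      by (intro chart_mult_has_vector_derivative chart_field_flow)
        (auto intro!: derivative_eq_intros simp: has_vector_derivative_def)
    moreover have "chart_mult (chart_mult y (r *\<^sub>R u)) (- ((s + r) *\<^sub>R u)) = chart_mult y (- (s *\<^sub>R u))" for r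
      unfolding chart_mult_assoc scaleR_minus_left [symmetric] chart_mult_scaleR by simp
    ultimately show ?thesis
      using vector_derivative_unique_at [OF _ has_vector_derivative_const] by simp
  qed
  have "((\<lambda>s. chart_mult (z s) (- (s *\<^sub>R u))) has_vector_derivative
      mult_deriv (z s) (- (s *\<^sub>R u)) (chart_field u (z s), - u)) (at s)" for s
    by (intro chart_mult_has_vector_derivative z)
      (auto intro!: derivative_eq_intros simp: has_vector_derivative_def)
  then have "((\<lambda>s. chart_mult (z s) (- (s *\<^sub>R u))) has_vector_derivative 0) (at s)" for s
    by (simp add: key)
  then have "(\<lambda>s. chart_mult (z s) (- (s *\<^sub>R u))) constant_on UNIV"
    by (intro has_derivative_zero_connected_constant_on [of UNIV "{}"])
      (auto simp: has_vector_derivative_def intro!: continuous_at_imp_continuous_on has_derivative_continuous)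
  then have "chart_mult (z s) (- (s *\<^sub>R u)) = z 0"
    by (auto simp: constant_on_def) (metis chart_mult_0(2) minus_zero scaleR_zero_left)
  then have "chart_mult (chart_mult (z s) (- (s *\<^sub>R u))) (s *\<^sub>R u) = chart_mult (z 0) (s *\<^sub>R u)"
    by simp
  then show ?thesis by (simp add: chart_mult_assoc)
qed

subsection \<open>Left invariant vector fields\<close>

lemma smooth_fun_lexp_has_derivative:
  "smooth_fun G f \<Longrightarrow> ((\<lambda>x. f (lexp G x)) has_derivative frechet_derivative (\<lambda>x. f (lexp G x)) (at x)) (at x)"
  by (rule smooth_has_derivative) (simp add: smooth_fun_def o_def)

lemma left_field_chart_DERIV:
  assumes "smooth_fun G f"
  shows "((\<lambda>s. f (lexp G x \<otimes> lexp G (s *\<^sub>R u))) has_real_derivative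
      frechet_derivative (\<lambda>x. f (lexp G x)) (at (chart_mult x (s *\<^sub>R u))) (chart_field u (chart_mult x (s *\<^sub>R u)))) (at s)"
proof -
  let ?D = "frechet_derivative (\<lambda>x. f (lexp G x)) (at (chart_mult x (s *\<^sub>R u)))"
  have 1: "((\<lambda>x. f (lexp G x)) has_derivative ?D) (at (chart_mult x (s *\<^sub>R u)))"
    by (rule smooth_fun_lexp_has_derivative [OF assms])
  have "((\<lambda>s. f (lexp G (chart_mult x (s *\<^sub>R u)))) has_derivative
      (\<lambda>r. ?D (r *\<^sub>R chart_field u (chart_mult x (s *\<^sub>R u))))) (at s)"
    using has_derivative_compose [OF chart_field_flow [unfolded has_vector_derivative_def] 1] .
  then show ?thesis
    using linear_cmul [OF has_derivative_linear [OF 1]]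
    by (simp add: has_field_derivative_def lexp_chart_mult mult_commute_abs)
qed

lemma left_field_lexp:
  assumes "smooth_fun G f"
  shows "left_field G u f (lexp G x) = frechet_derivative (\<lambda>x. f (lexp G x)) (at x) (chart_field u x)"
  unfolding left_field_def
  using left_field_chart_DERIV [OF assms, of x u 0] by (simp add: DERIV_imp_deriv)

lemma left_field_DERIV:
  assumes "smooth_fun G f" "x \<in> carrier G"
  shows "((\<lambda>s. f (x \<otimes> lexp G (s *\<^sub>R u))) has_real_derivative left_field G u f (x \<otimes> lexp G (s *\<^sub>R u))) (at s)"
  using left_field_chart_DERIV [OF assms(1), of "llog G x" u s] assms(2)
  by (simp add: left_field_lexp [OF assms(1), symmetric] lexp_chart_mult)

lemma smooth_fun_left_field:
  assumes "smooth_fun G f"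
  shows "smooth_fun G (left_field G u f)"
proof -
  have "smooth (\<lambda>x. frechet_derivative (\<lambda>x. f (lexp G x)) (at x) (chart_field u x))"
    using assms
    by (intro smooth_frechet_derivative_apply smooth_chart_field smooth_id) (simp add: smooth_fun_def o_def)
  then show ?thesis
    by (simp add: smooth_fun_def o_def left_field_lexp [OF assms])
qed

lemma left_field_cong:
  assumes "\<And>y. y \<in> carrier G \<Longrightarrow> f y = g y" "x \<in> carrier G"
  shows "left_field G u f x = left_field G u g x"
  unfolding left_field_def using assms by simp

lemma left_field_sum_vector:
  assumes f: "smooth_fun G f" and x: "x \<in> carrier G"
  shows "left_field G (\<Sum>i\<in>A. c i *\<^sub>R u i) f x = (\<Sum>i\<in>A. c i * left_field G (u i) f x)"
proof -
  let ?D = "frechet_derivative (\<lambda>x. f (lexp G x)) (at (llog G x))"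
  have eq: "left_field G w f x = ?D (chart_field w (llog G x))" for w
    using left_field_lexp [OF f, of w "llog G x"] x by simp
  have "linear ?D"
    by (rule has_derivative_linear, rule smooth_fun_lexp_has_derivative, rule f)
  then have lin: "linear (\<lambda>w. ?D (chart_field w (llog G x)))"
    using linear_compose [OF linear_chart_field] by (simp add: o_def)
  show ?thesis
    unfolding eq by (simp add: linear_sum [OF lin] linear_cmul [OF lin])
qed

lemma left_field_scaleR:
  assumes "smooth_fun G f" "x \<in> carrier G"
  shows "left_field G (c *\<^sub>R u) f x = c * left_field G u f x"
  using left_field_sum_vector [OF assms, of "\<lambda>_. c" "\<lambda>_. u" "{()}"] by simp

lemma left_field_add:
  assumes f: "smooth_fun G f" and x: "x \<in> carrier G"
  shows "left_field G (u + v) f x = left_field G u f x + left_field G v f x"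
  using left_field_sum_vector [OF assms, of "\<lambda>_. 1" "\<lambda>b. if b then u else v" UNIV]
  by (simp add: UNIV_bool add.commute)

lemma smooth_fun_sum:
  assumes "\<And>i. i \<in> A \<Longrightarrow> smooth_fun G (f i)"
  shows "smooth_fun G (\<lambda>x. \<Sum>i\<in>A. c i * f i x)"
proof -
  have "smooth (\<lambda>x. \<Sum>i\<in>A. c i *\<^sub>R f i (lexp G x))"
    using assms by (intro smooth_sum smooth_scaleR smooth_const) (simp add: smooth_fun_def o_def)
  then show ?thesis by (simp add: smooth_fun_def o_def)
qed

lemma left_field_sum_fun:
  assumes f: "\<And>i. i \<in> A \<Longrightarrow> smooth_fun G (f i)" and x: "x \<in> carrier G"
  shows "left_field G u (\<lambda>x. \<Sum>i\<in>A. c i * f i x) x = (\<Sum>i\<in>A. c i * left_field G u (f i) x)"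
proof -
  have "((\<lambda>s. \<Sum>i\<in>A. c i * f i (x \<otimes> lexp G (s *\<^sub>R u))) has_real_derivative
      (\<Sum>i\<in>A. c i * left_field G u (f i) (x \<otimes> lexp G (0 *\<^sub>R u)))) (at 0)"
    by (intro DERIV_sum DERIV_cmult left_field_DERIV f x)
  then show ?thesis
    using x by (simp add: left_field_def DERIV_imp_deriv)
qed

lemma smooth_fun_coordinate: "smooth_fun G (\<lambda>g. llog G g \<bullet> c)"
  by (simp add: smooth_fun_def o_def smooth_bounded_linear bounded_linear_inner_left)

lemma left_field_coordinate: "left_field G u (\<lambda>g. llog G g \<bullet> c) (lexp G x) = chart_field u x \<bullet> c"
proof -
  have "((\<lambda>x. llog G (lexp G x) \<bullet> c) has_derivative (\<lambda>v. v \<bullet> c)) (at x)"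
    by (simp add: bounded_linear_imp_has_derivative bounded_linear_inner_left)
  from frechet_derivative_at [OF this, symmetric] show ?thesis
    by (simp only: left_field_lexp [OF smooth_fun_coordinate])
qed

text \<open>Coordinate functions of \<open>llog\<close> are smooth, and at the identity the field of
  u is u itself, so the fields determine their vectors. Identities for the bracket can therefore be
  checked on operators.\<close>

lemma left_field_eqI:
  assumes "\<And>f. smooth_fun G f \<Longrightarrow> left_field G u f \<one> = left_field G v f \<one>"
  shows "u = v"
proof (rule vector_eq_rdot [THEN iffD1], rule allI)
  fix c
  show "u \<bullet> c = v \<bullet> c"
    using assms [OF smooth_fun_coordinate, of c] left_field_coordinate [of _ c 0] by simp
qed

text \<open>Linearity is inherited from the commutator of fields, since u ->
  \<open>left_field G u\<close> is linear and each field acts linearly on smooth functions.\<close>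

lemma linear_lie_br_right: "linear (lie_br G u)"
proof (rule linearI)
  have 1: "left_field G u (left_field G (v + w) f) x = left_field G u (left_field G v f) x + left_field G u (left_field G w f) x"
    if f: "smooth_fun G f" and x: "x \<in> carrier G" for v w f x
  proof -
    have "left_field G u (left_field G (v + w) f) x =
        left_field G u (\<lambda>x. \<Sum>b\<in>UNIV. 1 * left_field G (if b then v else w) f x) x"
      by (rule left_field_cong) (simp_all add: left_field_add f x UNIV_bool)
    also have "\<dots> = (\<Sum>b\<in>UNIV. 1 * left_field G u (left_field G (if b then v else w) f) x)"
      by (rule left_field_sum_fun) (auto intro: smooth_fun_left_field f x)
    finally show ?thesis by (simp add: UNIV_bool)
  qed
  have 2: "left_field G u (left_field G (r *\<^sub>R v) f) x = r * left_field G u (left_field G v f) x"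
    if f: "smooth_fun G f" and x: "x \<in> carrier G" for r v f x
  proof -
    have "left_field G u (left_field G (r *\<^sub>R v) f) x =
        left_field G u (\<lambda>x. \<Sum>b\<in>{()}. r * left_field G v f x) x"
      by (rule left_field_cong) (simp_all add: left_field_scaleR f x)
    also have "\<dots> = (\<Sum>b\<in>{()}. r * left_field G u (left_field G v f) x)"
      by (rule left_field_sum_fun) (auto intro: smooth_fun_left_field f x)
    finally show ?thesis by simp
  qed
  show "lie_br G u (v + w) = lie_br G u v + lie_br G u w" for v w
    by (rule left_field_eqI)
      (simp add: left_field_add lie_br_fields smooth_fun_left_field 1)
  show "lie_br G u (r *\<^sub>R v) = r *\<^sub>R lie_br G u v" for r v
    by (rule left_field_eqI)
      (simp add: left_field_scaleR lie_br_fields smooth_fun_left_field 2 algebra_simps)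
qed

lemma lie_br_antisym: "lie_br G u v = - lie_br G v u"
proof (rule left_field_eqI)
  fix f assume f: "smooth_fun G f"
  have "left_field G (- lie_br G v u) f \<one> = - left_field G (lie_br G v u) f \<one>"
    using left_field_scaleR [OF f, of \<one> "- 1"] by simp
  then show "left_field G (lie_br G u v) f \<one> = left_field G (- lie_br G v u) f \<one>"
    using f by (simp add: lie_br_fields)
qed

lemma linear_lie_br_left: "linear (\<lambda>u. lie_br G u v)"
  using linear_compose_neg [OF linear_lie_br_right, of v] by (simp flip: lie_br_antisym)

text \<open>The commutator formula tested on coordinate functions. Their differentials are constant
  in the chart, so only derivatives of the fields remain.\<close>

lemma chart_field_bracket:
  "frechet_derivative (chart_field v) (at y) (chart_field u y) -
   frechet_derivative (chart_field u) (at y) (chart_field v y) = chart_field (lie_br G u v) y"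
proof (rule vector_eq_rdot [THEN iffD1], rule allI)
  fix c
  let ?f = "\<lambda>g. llog G g \<bullet> c"
  have *: "left_field G u (left_field G v ?f) (lexp G y) = frechet_derivative (chart_field v) (at y) (chart_field u y) \<bullet> c" for u v
  proof -
    have "((\<lambda>y. chart_field v y \<bullet> c) has_derivative (\<lambda>w. frechet_derivative (chart_field v) (at y) w \<bullet> c)) (at y)"
      by (intro bounded_linear.has_derivative [OF bounded_linear_inner_left]
          smooth_has_derivative smooth_chart_field)
    from frechet_derivative_at [OF this] show ?thesis
      by (simp add: left_field_lexp smooth_fun_left_field smooth_fun_coordinate left_field_coordinate fun_eq_iff)
  qed
  show "(frechet_derivative (chart_field v) (at y) (chart_field u y) -
   frechet_derivative (chart_field u) (at y) (chart_field v y)) \<bullet> c = chart_field (lie_br G u v) y \<bullet> c"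
    using lie_br_fields [OF smooth_fun_coordinate, of "lexp G y" u v c]
    by (simp add: * left_field_coordinate inner_diff_left)
qed

subsection \<open>Bracket homomorphisms are group homomorphisms\<close>

text \<open>The left Maurer-Cartan form at x in the direction w. The two lemmas below show that it
  inverts u -> \<open>chart_field u x\<close>.\<close>

definition maurer_cartan :: "'l \<Rightarrow> 'l \<Rightarrow> 'l" where
  "maurer_cartan x w = mult_deriv (- x) x (0, w)"

lemma chart_field_maurer_cartan: "chart_field (maurer_cartan x w) x = w"
proof -
  have 1: "((\<lambda>s. chart_mult (- x) (x + s *\<^sub>R w)) has_vector_derivative mult_deriv (- x) (x + 0 *\<^sub>R w) (0, w)) (at 0)"
    by (intro chart_mult_has_vector_derivative has_vector_derivative_const)
      (auto intro!: derivative_eq_intros simp: has_vector_derivative_def)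
  have "((\<lambda>s. chart_mult x (chart_mult (- x) (x + s *\<^sub>R w))) has_vector_derivative
      mult_deriv x (chart_mult (- x) (x + 0 *\<^sub>R w)) (0, mult_deriv (- x) (x + 0 *\<^sub>R w) (0, w))) (at 0)"
    by (intro chart_mult_has_vector_derivative has_vector_derivative_const 1)
  then have "((\<lambda>s. x + s *\<^sub>R w) has_vector_derivative chart_field (maurer_cartan x w) x) (at 0)"
    by (simp add: chart_field_def maurer_cartan_def)
  moreover have "((\<lambda>s. x + s *\<^sub>R w) has_vector_derivative w) (at 0)"
    by (auto intro!: derivative_eq_intros simp: has_vector_derivative_def)
  ultimately show ?thesis
    using vector_derivative_unique_at by blast
qed

lemma maurer_cartan_chart_field: "maurer_cartan x (chart_field u x) = u"
proof -
  have "((\<lambda>s. chart_mult (- x) (chart_mult x (s *\<^sub>R u))) has_vector_derivative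
      mult_deriv (- x) (chart_mult x (0 *\<^sub>R u)) (0, chart_field u (chart_mult x (0 *\<^sub>R u)))) (at 0)"
    by (intro chart_mult_has_vector_derivative has_vector_derivative_const chart_field_flow)
  then show ?thesis
    using vector_derivative_unique_at [OF has_vector_derivative_scaleR_const [of u 0]]
    by (simp add: maurer_cartan_def) metis
qed

lemma chart_field_eq_0: "chart_field u x = 0 \<Longrightarrow> u = 0"
  by (metis linear_0 linear_chart_field maurer_cartan_chart_field)

lemma chart_field_expand: "chart_field b y = (\<Sum>i\<in>Basis. (b \<bullet> i) *\<^sub>R chart_field i y)"
proof -
  have "chart_field (\<Sum>i\<in>Basis. (b \<bullet> i) *\<^sub>R i) y = (\<Sum>i\<in>Basis. (b \<bullet> i) *\<^sub>R chart_field i y)"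
    by (simp add: linear_sum [OF linear_chart_field] linear_cmul [OF linear_chart_field])
  then show ?thesis by (simp add: euclidean_representation)
qed

lemma frechet_derivative_chart_field_expand:
  "frechet_derivative (chart_field b) (at y) v =
    (\<Sum>i\<in>Basis. (b \<bullet> i) *\<^sub>R frechet_derivative (chart_field i) (at y) v)"
proof -
  have "((\<lambda>y. \<Sum>i\<in>Basis. (b \<bullet> i) *\<^sub>R chart_field i y) has_derivative
    (\<lambda>v. \<Sum>i\<in>Basis. (b \<bullet> i) *\<^sub>R frechet_derivative (chart_field i) (at y) v)) (at y)"
    by (intro has_derivative_sum has_derivative_scaleR_right smooth_has_derivative smooth_chart_field)
  from frechet_derivative_at [OF this] show ?thesis
    by (simp add: fun_eq_iff flip: chart_field_expand)
qed

lemma chart_field_has_vector_derivative: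
  assumes b: "(b has_vector_derivative b') (at s)" and y: "(y has_vector_derivative y') (at s)"
  shows "((\<lambda>s. chart_field (b s) (y s)) has_vector_derivative
    chart_field b' (y s) + frechet_derivative (chart_field (b s)) (at (y s)) y') (at s)"
proof -
  have 1: "((\<lambda>s. b s \<bullet> i) has_vector_derivative b' \<bullet> i) (at s)" for i
    by (rule bounded_linear.has_vector_derivative [OF bounded_linear_inner_left b])
  have 2: "((\<lambda>s. chart_field i (y s)) has_vector_derivative frechet_derivative (chart_field i) (at (y s)) y') (at s)" for i
  proof -
    have d: "(chart_field i has_derivative frechet_derivative (chart_field i) (at (y s))) (at (y s))"
      by (intro smooth_has_derivative smooth_chart_field)
    show ?thesis
      using has_derivative_compose [OF y [unfolded has_vector_derivative_def] d]
      by (simp add: has_vector_derivative_def linear_cmul [OF has_derivative_linear [OF d], symmetric])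
  qed
  have "((\<lambda>s. \<Sum>i\<in>Basis. (b s \<bullet> i) *\<^sub>R chart_field i (y s)) has_vector_derivative
     (\<Sum>i\<in>Basis. (b s \<bullet> i) *\<^sub>R frechet_derivative (chart_field i) (at (y s)) y' + (b' \<bullet> i) *\<^sub>R chart_field i (y s))) (at s)"
    by (intro has_vector_derivative_sum bounded_bilinear.has_vector_derivative [OF bounded_bilinear_scaleR 1 2])
  then show ?thesis
    by (subst (1 2) chart_field_expand, subst frechet_derivative_chart_field_expand)
      (simp add: sum.distrib add.commute)
qed

text \<open>\<open>s \<omega>(sx)u\<close> is the left logarithmic derivative of \<open>exp(s(x + \<tau>u))\<close> with respect to \<open>\<tau>\<close> at \<open>0\<close>.\<close>

lemma maurer_cartan_ray:
  "((\<lambda>s. s *\<^sub>R maurer_cartan (s *\<^sub>R x) u) has_vector_derivative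
     u - lie_br G x (s *\<^sub>R maurer_cartan (s *\<^sub>R x) u)) (at s)"
proof -
  define Y where "Y s = s *\<^sub>R maurer_cartan (s *\<^sub>R x) u" for s
  have lin: "bounded_linear (\<lambda>s::real. s *\<^sub>R x)" "bounded_linear (\<lambda>s::real. - (s *\<^sub>R x))"
    by (intro bounded_linear_minus bounded_linear_intros)+
  have "smooth Y"
    unfolding Y_def [abs_def] maurer_cartan_def mult_deriv_def
    by (intro smooth_scaleR smooth_id smooth_frechet_derivative_apply smooth_chart_mult smooth_Pair
        smooth_const smooth_bounded_linear lin)
  then obtain Y' where Y': "(Y has_vector_derivative Y') (at s)"
    using smooth_differentiable vector_derivative_works by blast
  have cfY: "chart_field (Y r) (r *\<^sub>R x) = r *\<^sub>R u" for r
    by (simp add: Y_def linear_cmul [OF linear_chart_field] chart_field_maurer_cartan)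
  have "((\<lambda>r. chart_field (Y r) (r *\<^sub>R x)) has_vector_derivative
      chart_field Y' (s *\<^sub>R x) + frechet_derivative (chart_field (Y s)) (at (s *\<^sub>R x)) x) (at s)"
    by (intro chart_field_has_vector_derivative Y' has_vector_derivative_scaleR_const)
  \<comment> \<open>Differentiating \<open>chart_field (Y r) (r x) = r u\<close> in r brings in the
    unknown Y' together with a derivative of the field of Y along the ray; e2 exchanges that
    derivative for a bracket.\<close>
  then have e1: "u = chart_field Y' (s *\<^sub>R x) + frechet_derivative (chart_field (Y s)) (at (s *\<^sub>R x)) x"
    unfolding cfY using vector_derivative_unique_at [OF has_vector_derivative_scaleR_const] by blast
  have e2: "frechet_derivative (chart_field (Y s)) (at (s *\<^sub>R x)) x -
      frechet_derivative (chart_field x) (at (s *\<^sub>R x)) (s *\<^sub>R u) = chart_field (lie_br G x (Y s)) (s *\<^sub>R x)"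
    using chart_field_bracket [of "Y s" "s *\<^sub>R x" x] by (simp add: chart_field_radial cfY)
  \<comment> \<open>The derivative of the field of x transversal to the ray, left over in e2, comes
    from the identity \<open>chart_field z z = z\<close>, differentiated at z = sx in the direction
    u.\<close>
  have d: "((\<lambda>r. s *\<^sub>R x + r *\<^sub>R u) has_vector_derivative u) (at 0)"
    by (auto intro!: derivative_eq_intros simp: has_vector_derivative_def)
  have "((\<lambda>r. chart_field (s *\<^sub>R x + r *\<^sub>R u) (s *\<^sub>R x + r *\<^sub>R u)) has_vector_derivative
      chart_field u (s *\<^sub>R x + 0 *\<^sub>R u) + frechet_derivative (chart_field (s *\<^sub>R x + 0 *\<^sub>R u)) (at (s *\<^sub>R x + 0 *\<^sub>R u)) u) (at 0)"
    by (rule chart_field_has_vector_derivative [OF d d])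
  moreover have "chart_field z z = z" for z
    using chart_field_radial [of z 1] by simp
  ultimately have e3: "u = chart_field u (s *\<^sub>R x) + frechet_derivative (chart_field (s *\<^sub>R x)) (at (s *\<^sub>R x)) u"
    using vector_derivative_unique_at [OF d] by simp
  have e4: "frechet_derivative (chart_field (s *\<^sub>R x)) (at (s *\<^sub>R x)) u = frechet_derivative (chart_field x) (at (s *\<^sub>R x)) (s *\<^sub>R u)"
  proof -
    have "linear (frechet_derivative (chart_field x) (at (s *\<^sub>R x)))"
      by (rule linear_frechet_derivative, rule smooth_differentiable, rule smooth_chart_field)
    then have "frechet_derivative (chart_field x) (at (s *\<^sub>R x)) (s *\<^sub>R u) =
        s *\<^sub>R frechet_derivative (chart_field x) (at (s *\<^sub>R x)) u"
      by (rule linear_cmul)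
    then show ?thesis
      by (simp add: frechet_derivative_chart_field_expand [of "s *\<^sub>R x"]
          frechet_derivative_chart_field_expand [of x _ u] scaleR_sum_right)
  qed
  have "chart_field (Y' + lie_br G x (Y s) - u) (s *\<^sub>R x) =
      chart_field Y' (s *\<^sub>R x) + chart_field (lie_br G x (Y s)) (s *\<^sub>R x) - chart_field u (s *\<^sub>R x)"
    by (simp add: linear_add [OF linear_chart_field] linear_diff [OF linear_chart_field])
  also have "\<dots> = 0"
  proof -
    have "a + d - e = 0" if "u = a + b" "b - c = d" "u = e + f" "f = c" for a b c d e f :: 'l
    proof -
      have "a + d - e = (a + b) - (e + c)" using that(2) by (auto simp: algebra_simps)
      then show ?thesis using that(1,3,4) by (metis diff_self)
    qed
    from this [OF e1 e2 e3 e4] show ?thesis .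
  qed
  finally have "Y' = u - lie_br G x (Y s)"
    using chart_field_eq_0 by (metis add_diff_cancel_left' add_diff_eq diff_eq_diff_eq eq_iff_diff_eq_0 add.commute)
  then show ?thesis
    using Y' by (simp add: Y_def [abs_def])
qed

text \<open>Along a ray, the image under \<delta> of the Maurer-Cartan form and the form at the
  image point satisfy the same linear equation with initial value 0, so they agree. Thus \<delta>
  carries the field of w to the field of \<delta> w and integral curves to integral curves, and
  uniqueness of the flow gives the homomorphism property.\<close>

lemma chart_mult_hom:
  assumes \<delta>: "linear \<delta>" and br: "\<And>u v. \<delta> (lie_br G u v) = lie_br G (\<delta> u) (\<delta> v)"
  shows "\<delta> (chart_mult x y) = chart_mult (\<delta> x) (\<delta> y)"
proof -
  have bl: "bounded_linear \<delta>" using \<delta> by (simp add: linear_conv_bounded_linear)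
  have mc: "\<delta> (maurer_cartan x u) = maurer_cartan (\<delta> x) (\<delta> u)" for x u
  proof -
    define z where "z s = \<delta> (s *\<^sub>R maurer_cartan (s *\<^sub>R x) u) - s *\<^sub>R maurer_cartan (s *\<^sub>R \<delta> x) (\<delta> u)" for s
    have "(z has_vector_derivative (\<delta> (u - lie_br G x (s *\<^sub>R maurer_cartan (s *\<^sub>R x) u)) -
        (\<delta> u - lie_br G (\<delta> x) (s *\<^sub>R maurer_cartan (s *\<^sub>R \<delta> x) (\<delta> u))))) (at s)" for s
      unfolding z_def
      by (intro has_vector_derivative_diff bounded_linear.has_vector_derivative [OF bl] maurer_cartan_ray)
    moreover have "(\<delta> (u - lie_br G x (s *\<^sub>R maurer_cartan (s *\<^sub>R x) u)) -
        (\<delta> u - lie_br G (\<delta> x) (s *\<^sub>R maurer_cartan (s *\<^sub>R \<delta> x) (\<delta> u)))) = - lie_br G (\<delta> x) (z s)" for s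
      using linear_lie_br_right [of "\<delta> x"] \<delta> by (simp add: z_def linear_diff br)
    ultimately have "(z has_vector_derivative - lie_br G (\<delta> x) (z s)) (at s)" for s
      by simp
    moreover have "linear (\<lambda>v. - lie_br G (\<delta> x) v)"
      by (intro linear_compose_neg linear_lie_br_right)
    ultimately have "z 1 = 0"
      by (intro linear_ode_zero [of "\<lambda>v. - lie_br G (\<delta> x) v" z]) (auto simp: z_def linear_0 [OF \<delta>])
    then show ?thesis by (simp add: z_def)
  qed
  have cf: "\<delta> (chart_field w x) = chart_field (\<delta> w) (\<delta> x)" for w x
    using mc [of x "chart_field w x"]
    by (metis chart_field_maurer_cartan maurer_cartan_chart_field)
  have "((\<lambda>s. \<delta> (chart_mult x (s *\<^sub>R y))) has_vector_derivative chart_field (\<delta> y) (\<delta> (chart_mult x (s *\<^sub>R y)))) (at s)" for s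
    using bounded_linear.has_vector_derivative [OF bl chart_field_flow] by (simp add: cf)
  from chart_field_flow_unique [OF this, of 1] show ?thesis
    by simp
qed

subsection \<open>Conjugation and iterated vector fields\<close>

text \<open>\<open>coadj x\<close> is \<open>Ad(exp(-x))\<close>.\<close>

definition coadj :: "'l \<Rightarrow> 'l \<Rightarrow> 'l" where
  "coadj x u = mult_deriv (- x) x (chart_field u (- x), 0)"

text \<open>The conjugated curve is again a one-parameter group, so its derivative at 0 determines
  it as the flow of one left invariant field.\<close>

lemma chart_mult_coadj: "chart_mult (chart_mult (- x) (s *\<^sub>R u)) x = s *\<^sub>R coadj x u"
proof -
  define c where "c s = chart_mult (chart_mult (- x) (s *\<^sub>R u)) x" for s
  have c_add: "c (r + s) = chart_mult (c r) (c s)" for r s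
    by (simp add: c_def chart_mult_assoc flip: chart_mult_scaleR)
  have c0: "c 0 = 0" by (simp add: c_def)
  have "(c has_vector_derivative mult_deriv (chart_mult (- x) (0 *\<^sub>R u)) x (chart_field u (chart_mult (- x) (0 *\<^sub>R u)), 0)) (at 0)"
    unfolding c_def by (intro chart_mult_has_vector_derivative chart_field_flow has_vector_derivative_const)
  then have d0: "(c has_vector_derivative coadj x u) (at 0)"
    by (simp add: coadj_def)
  have "(c has_vector_derivative chart_field (coadj x u) (c s)) (at s)" for s
  proof -
    have "((\<lambda>r. r - s) has_vector_derivative 1) (at s)"
      by (auto intro!: derivative_eq_intros simp: has_vector_derivative_def)
    then have "((\<lambda>r. c (r - s)) has_vector_derivative coadj x u) (at s)"
      using vector_diff_chain_at [of "\<lambda>r. r - s" 1 s c "coadj x u"] d0 by (simp add: o_def)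
    then have "((\<lambda>r. chart_mult (c s) (c (r - s))) has_vector_derivative mult_deriv (c s) (c (s - s)) (0, coadj x u)) (at s)"
      by (intro chart_mult_has_vector_derivative has_vector_derivative_const)
    then show ?thesis
      by (simp add: c0 chart_field_def flip: c_add)
  qed
  from chart_field_flow_unique [OF this, of s] show ?thesis
    by (simp add: c0) (simp add: c_def)
qed

lemma lexp_coadj: "lexp G (s *\<^sub>R u) \<otimes> lexp G x = lexp G x \<otimes> lexp G (s *\<^sub>R coadj x u)"
proof -
  have "chart_mult x (s *\<^sub>R coadj x u) = chart_mult (s *\<^sub>R u) x"
    by (simp add: chart_mult_assoc flip: chart_mult_coadj)
  then show ?thesis by (metis lexp_chart_mult)
qed

lemma linear_coadj: "linear (coadj x)"
proof -
  have "linear (\<lambda>u. (chart_field u (- x), 0::'l))"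
    using linear_chart_field [of "- x"] by (auto simp: linear_iff)
  from linear_compose [OF this linear_mult_deriv] show ?thesis
    by (simp add: coadj_def [abs_def] o_def)
qed

lemma smooth_coadj: "smooth (\<lambda>x. coadj x u)"
proof -
  have m: "smooth (\<lambda>x::'l. - x)"
    by (intro smooth_bounded_linear bounded_linear_minus bounded_linear_ident)
  show ?thesis
    unfolding coadj_def mult_deriv_def
    by (intro smooth_frechet_derivative_apply smooth_chart_mult smooth_Pair m smooth_id smooth_const
        smooth_compose [OF smooth_chart_field m])
qed

lemma coadj_0 [simp]: "coadj 0 u = u"
  using chart_mult_coadj [of 0 1 u] by simp

section \<open>Words of left invariant fields and right translation\<close>

definition iter_field :: "'l list \<Rightarrow> ('g \<Rightarrow> real) \<Rightarrow> 'g \<Rightarrow> real" where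
  "iter_field us f = foldr (left_field G) us f"

lemma iter_field_Nil [simp]: "iter_field [] f = f"
  and iter_field_Cons [simp]: "iter_field (u # us) f = left_field G u (iter_field us f)"
  by (simp_all add: iter_field_def)

lemma iter_field_append: "iter_field (us @ vs) f = iter_field us (iter_field vs f)"
  by (simp add: iter_field_def)

lemma smooth_fun_iter_field: "smooth_fun G f \<Longrightarrow> smooth_fun G (iter_field us f)"
  by (induction us) (auto intro: smooth_fun_left_field)

lemma iter_field_cong:
  assumes "\<And>y. y \<in> carrier G \<Longrightarrow> f y = g y" "x \<in> carrier G"
  shows "iter_field us f x = iter_field us g x"
  using assms(2) by (induction us arbitrary: x) (auto intro!: assms left_field_cong)

lemma iter_field_sum_fun:
  assumes f: "\<And>i. i \<in> A \<Longrightarrow> smooth_fun G (f i)" and x: "x \<in> carrier G"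
  shows "iter_field us (\<lambda>x. \<Sum>i\<in>A. c i * f i x) x = (\<Sum>i\<in>A. c i * iter_field us (f i) x)"
  using x
proof (induction us arbitrary: x)
  case (Cons u us)
  have "iter_field (u # us) (\<lambda>x. \<Sum>i\<in>A. c i * f i x) x = left_field G u (\<lambda>x. \<Sum>i\<in>A. c i * iter_field us (f i) x) x"
    using Cons by (auto intro!: left_field_cong)
  then show ?case
    using Cons.prems f by (simp add: left_field_sum_fun smooth_fun_iter_field)
qed simp

lemma iter_field_sum_vector:
  assumes f: "smooth_fun G f" and x: "x \<in> carrier G"
  shows "iter_field (us @ (\<Sum>i\<in>A. c i *\<^sub>R v i) # ws) f x = (\<Sum>i\<in>A. c i * iter_field (us @ v i # ws) f x)"
proof -
  have "iter_field (us @ (\<Sum>i\<in>A. c i *\<^sub>R v i) # ws) f x =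
      iter_field us (\<lambda>x. \<Sum>i\<in>A. c i * left_field G (v i) (iter_field ws f) x) x"
    unfolding iter_field_append using f x
    by (intro iter_field_cong) (simp_all add: left_field_sum_vector smooth_fun_iter_field)
  also have "\<dots> = (\<Sum>i\<in>A. c i * iter_field us (left_field G (v i) (iter_field ws f)) x)"
    using f x by (intro iter_field_sum_fun smooth_fun_left_field smooth_fun_iter_field)
  finally show ?thesis by (simp add: iter_field_append)
qed

lemma iter_field_bracket:
  assumes f: "smooth_fun G f" and x: "x \<in> carrier G"
  shows "iter_field (us @ lie_br G u v # ws) f x = iter_field (us @ u # v # ws) f x - iter_field (us @ v # u # ws) f x"
proof -
  let ?h = "\<lambda>b. if b then left_field G u (left_field G v (iter_field ws f)) else left_field G v (left_field G u (iter_field ws f))"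
  have "iter_field (us @ lie_br G u v # ws) f x =
      iter_field us (\<lambda>x. \<Sum>b\<in>UNIV. (if b then 1 else - 1) * ?h b x) x"
    unfolding iter_field_append using f x
    by (intro iter_field_cong) (simp_all add: lie_br_fields smooth_fun_iter_field UNIV_bool)
  also have "\<dots> = (\<Sum>b\<in>UNIV. (if b then 1 else - 1) * iter_field us (?h b) x)"
    using f x by (intro iter_field_sum_fun) (auto intro: smooth_fun_left_field smooth_fun_iter_field)
  finally show ?thesis by (simp add: iter_field_append UNIV_bool)
qed

lemma smooth_fun_translate:
  assumes "smooth_fun G f" "y \<in> carrier G"
  shows "smooth_fun G (\<lambda>g. f (g \<otimes> y))"
proof -
  have "smooth (\<lambda>x. f (lexp G x))"
    using assms(1) by (simp add: smooth_fun_def o_def)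
  from smooth_compose [OF this smooth_chart_mult_compose [OF smooth_id smooth_const]]
  have "smooth (\<lambda>x. f (lexp G (chart_mult x (llog G y))))" .
  then show ?thesis
    using assms(2) by (simp add: smooth_fun_def o_def lexp_chart_mult)
qed

text \<open>Moving exp(su) past y on the right replaces u by Ad of the inverse of y applied to u.
  Iterating this along a path is what produces products of \<open>coadj\<close> matrices in the
  derivatives of averages.\<close>

lemma iter_field_translate:
  assumes f: "smooth_fun G f" and y: "y \<in> carrier G" and x: "x \<in> carrier G"
  shows "iter_field us (\<lambda>g. f (g \<otimes> y)) x = iter_field (map (coadj (llog G y)) us) f (x \<otimes> y)"
  using x
proof (induction us arbitrary: x)
  case (Cons u us)
  let ?h = "iter_field (map (coadj (llog G y)) us) f"
  have "iter_field (u # us) (\<lambda>g. f (g \<otimes> y)) x = left_field G u (\<lambda>g. ?h (g \<otimes> y)) x"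
    using Cons by (auto intro!: left_field_cong)
  also have "\<dots> = left_field G (coadj (llog G y) u) ?h (x \<otimes> y)"
  proof -
    have "x \<otimes> lexp G (s *\<^sub>R u) \<otimes> y = x \<otimes> y \<otimes> lexp G (s *\<^sub>R coadj (llog G y) u)" for s
      using lexp_coadj [of s u "llog G y"] Cons.prems y by (simp add: m_assoc)
    then show ?thesis by (simp add: left_field_def)
  qed
  finally show ?case by simp
qed simp

end

section \<open>Coordinates, dilations and decaying functions\<close>

declare One_nat_def [simp del]

context stratified_lie_group
begin

lemma span_lie_basis: "span (lie_basis G ` {1..DIM('l)}) = UNIV"
proof -
  have "card (lie_basis G ` {1..DIM('l)}) = DIM('l)"
    by (simp add: card_image basis_inj)
  then show ?thesis
    using card_ge_dim_independent [of "lie_basis G ` {1..DIM('l)}" UNIV] basis_independent by auto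
qed

lemma linear_lie_coord: "linear (lie_coord G i)"
  unfolding lie_coord_def
  by (intro linearI)
    (simp_all add: representation_add representation_scale basis_independent span_lie_basis)

lemma lie_coord_expand: "(\<Sum>i=1..DIM('l). lie_coord G i v *\<^sub>R lie_basis G i) = v"
proof -
  have "(\<Sum>i=1..DIM('l). lie_coord G i v *\<^sub>R lie_basis G i) =
      (\<Sum>b\<in>lie_basis G ` {1..DIM('l)}. representation (lie_basis G ` {1..DIM('l)}) v b *\<^sub>R b)"
    by (simp add: sum.reindex [OF basis_inj] lie_coord_def)
  also have "\<dots> = v"
    by (rule sum_representation_eq) (auto simp: basis_independent span_lie_basis)
  finally show ?thesis .
qed

lemma lie_coord_basis:
  assumes "i \<in> {1..DIM('l)}" "j \<in> {1..DIM('l)}"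
  shows "lie_coord G i (lie_basis G j) = (if i = j then 1 else 0)"
proof -
  have "lie_basis G i = lie_basis G j \<longleftrightarrow> i = j"
    using basis_inj assms by (auto dest: inj_onD)
  moreover have "lie_coord G i (lie_basis G j) = (if lie_basis G i = lie_basis G j then 1 else 0)"
    using representation_basis [OF basis_independent, of "lie_basis G j"] assms(2)
    unfolding lie_coord_def by auto
  ultimately show ?thesis by simp
qed

lemma lie_coord_sum:
  assumes "A \<subseteq> {1..DIM('l)}" "i \<in> {1..DIM('l)}"
  shows "lie_coord G i (\<Sum>j\<in>A. c j *\<^sub>R lie_basis G j) = (if i \<in> A then c i else 0)"
proof -
  have "lie_coord G i (\<Sum>j\<in>A. c j *\<^sub>R lie_basis G j) = (\<Sum>j\<in>A. c j * (if i = j then 1 else 0))"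
    unfolding linear_sum [OF linear_lie_coord] linear_cmul [OF linear_lie_coord] real_scaleR_def
  proof (rule sum.cong [OF refl])
    fix j assume "j \<in> A"
    then have "j \<in> {1..DIM('l)}" using assms(1) by blast
    then show "c j * lie_coord G i (lie_basis G j) = c j * (if i = j then 1 else 0)"
      by (simp only: lie_coord_basis [OF assms(2)])
  qed
  also have "\<dots> = (if i \<in> A then c i else 0)"
    using finite_subset [OF assms(1)] by (simp add: if_distrib cong: if_cong)
  finally show ?thesis .
qed

lemma lie_coord_eqI:
  assumes "\<And>i. i \<in> {1..DIM('l)} \<Longrightarrow> lie_coord G i u = lie_coord G i v"
  shows "u = v"
proof -
  have "(\<Sum>i=1..DIM('l). lie_coord G i u *\<^sub>R lie_basis G i) = (\<Sum>i=1..DIM('l). lie_coord G i v *\<^sub>R lie_basis G i)"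
    using assms by (intro sum.cong) auto
  then show ?thesis by (simp add: lie_coord_expand)
qed

text \<open>A basis vector of another weight would be a sum of layer components, each spanned by
  basis vectors with weights in \<open>1..step G\<close>; this contradicts independence.\<close>

lemma weight_in_steps:
  assumes i: "i \<in> {1..DIM('l)}"
  shows "weight G i \<in> {1..step G}"
proof (rule ccontr)
  assume not: "weight G i \<notin> {1..step G}"
  let ?J = "{j \<in> {1..DIM('l)}. weight G j \<in> {1..step G}}"
  obtain w where w: "\<And>k. w k \<in> layer G k" "lie_basis G i = (\<Sum>k=1..step G. w k)"
    using layer_direct_sum [of "lie_basis G i"] by blast
  have "w k \<in> span (lie_basis G ` ?J)" if "k \<in> {1..step G}" for k
  proof -
    have "layer_indices G k \<subseteq> ?J"
      using that by (auto simp: layer_indices_def)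
    then have "span (lie_basis G ` layer_indices G k) \<subseteq> span (lie_basis G ` ?J)"
      by (intro span_mono image_mono)
    then show ?thesis
      using w(1) basis_layer [OF that] by blast
  qed
  then have "lie_basis G i \<in> span (lie_basis G ` ?J)"
    unfolding w(2) by (intro span_sum)
  moreover have "lie_basis G ` ?J \<subseteq> lie_basis G ` {1..DIM('l)} - {lie_basis G i}"
    using basis_inj i not by (auto dest: inj_onD)
  ultimately have "lie_basis G i \<in> span (lie_basis G ` {1..DIM('l)} - {lie_basis G i})"
    using span_mono by blast
  then show False
    using basis_independent i unfolding dependent_def by blast
qed

text \<open>Holds for every k: outside \<open>1..step G\<close> the layer is zero and no index has
  weight k, so the condition makes all coordinates vanish.\<close>

lemma layer_iff: "v \<in> layer G k \<longleftrightarrow> (\<forall>i\<in>{1..DIM('l)}. weight G i \<noteq> k \<longrightarrow> lie_coord G i v = 0)"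
proof (cases "k \<in> {1..step G}")
  case True
  show ?thesis
  proof
    assume "v \<in> layer G k"
    then have v: "v \<in> span (lie_basis G ` layer_indices G k)"
      using basis_layer [OF True] by simp
    show "\<forall>i\<in>{1..DIM('l)}. weight G i \<noteq> k \<longrightarrow> lie_coord G i v = 0"
    proof (intro ballI impI)
      fix i assume i: "i \<in> {1..DIM('l)}" "weight G i \<noteq> k"
      show "lie_coord G i v = 0"
      proof (rule linear_eq_0_on_span [OF linear_lie_coord _ v])
        fix b assume "b \<in> lie_basis G ` layer_indices G k"
        then show "lie_coord G i b = 0"
          using i by (auto simp: layer_indices_def lie_coord_basis)
      qed
    qed
  next
    assume *: "\<forall>i\<in>{1..DIM('l)}. weight G i \<noteq> k \<longrightarrow> lie_coord G i v = 0"
    have "v = (\<Sum>i\<in>layer_indices G k. lie_coord G i v *\<^sub>R lie_basis G i)"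
      unfolding layer_indices_def using *
      by (subst (1) lie_coord_expand [of v, symmetric]) (intro sum.mono_neutral_right, auto)
    also have "\<dots> \<in> span (lie_basis G ` layer_indices G k)"
      by (intro span_sum span_scale span_base) auto
    finally show "v \<in> layer G k"
      using basis_layer [OF True] by simp
  qed
next
  case False
  have "v = 0 \<longleftrightarrow> (\<forall>i\<in>{1..DIM('l)}. lie_coord G i v = 0)"
    using lie_coord_eqI [of v 0] linear_0 [OF linear_lie_coord] by auto
  then show ?thesis
    using layer_outside [OF False] False weight_in_steps by auto
qed

lemma lie_coord_layer_part:
  assumes "i \<in> {1..DIM('l)}"
  shows "lie_coord G i (layer_part G k v) = (if weight G i = k then lie_coord G i v else 0)"
  unfolding layer_part_def using assms
  by (subst lie_coord_sum) (auto simp: layer_indices_def)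

lemma linear_layer_part: "linear (layer_part G k)"
proof (rule linearI)
  show "layer_part G k (u + v) = layer_part G k u + layer_part G k v" for u v
    by (rule lie_coord_eqI) (simp add: lie_coord_layer_part linear_add [OF linear_lie_coord])
  show "layer_part G k (c *\<^sub>R v) = c *\<^sub>R layer_part G k v" for c v
    by (rule lie_coord_eqI) (simp add: lie_coord_layer_part linear_cmul [OF linear_lie_coord])
qed

lemma layer_part_in_layer: "layer_part G k v \<in> layer G k"
  by (simp add: layer_iff lie_coord_layer_part)

lemma sum_layer_part: "(\<Sum>k=1..step G. layer_part G k v) = v"
proof (rule lie_coord_eqI)
  fix i assume i: "i \<in> {1..DIM('l)}"
  then show "lie_coord G i (\<Sum>k=1..step G. layer_part G k v) = lie_coord G i v"
    using weight_in_steps [OF i]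
    by (simp add: linear_sum [OF linear_lie_coord] lie_coord_layer_part sum.delta' del: atLeastAtMost_iff)
qed

section \<open>Dilations as automorphisms of the Lie algebra and of the group\<close>

definition lie_dilation :: "real \<Rightarrow> 'l \<Rightarrow> 'l" where
  "lie_dilation \<epsilon> v = (\<Sum>k=1..step G. \<epsilon> ^ k *\<^sub>R layer_part G k v)"

lemma dilation_eq: "dilation G \<epsilon> x = lexp G (lie_dilation \<epsilon> (llog G x))"
  by (simp add: dilation_def lie_dilation_def)

lemma linear_lie_dilation: "linear (lie_dilation \<epsilon>)"
  by (intro linearI)
    (simp_all add: lie_dilation_def linear_add [OF linear_layer_part] linear_cmul [OF linear_layer_part]
      scaleR_add_right sum.distrib scaleR_sum_right mult.commute)

lemma lie_coord_lie_dilation: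
  assumes i: "i \<in> {1..DIM('l)}"
  shows "lie_coord G i (lie_dilation \<epsilon> v) = \<epsilon> ^ weight G i * lie_coord G i v"
  using weight_in_steps [OF i] i
  by (simp add: lie_dilation_def linear_sum [OF linear_lie_coord] linear_cmul [OF linear_lie_coord]
      lie_coord_layer_part if_distrib sum.delta' cong: if_cong del: atLeastAtMost_iff)

lemma lie_dilation_layer:
  assumes "v \<in> layer G k"
  shows "lie_dilation \<epsilon> v = \<epsilon> ^ k *\<^sub>R v"
  by (rule lie_coord_eqI)
    (use assms in \<open>auto simp: lie_coord_lie_dilation layer_iff linear_cmul [OF linear_lie_coord]\<close>)

text \<open>On layers k and l both sides carry the factor \<epsilon>^(k+l); beyond the step the
  layers are zero, so the grading covers every pair.\<close>

lemma lie_dilation_bracket: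
  "lie_dilation \<epsilon> (lie_br G u v) = lie_br G (lie_dilation \<epsilon> u) (lie_dilation \<epsilon> v)"
proof -
  have expand: "lie_br G (\<Sum>k=1..step G. x k) (\<Sum>l=1..step G. y l) = (\<Sum>k=1..step G. \<Sum>l=1..step G. lie_br G (x k) (y l))" for x y
    by (subst linear_sum [OF linear_lie_br_left]) (simp add: linear_sum [OF linear_lie_br_right])
  have "lie_dilation \<epsilon> (lie_br G u v) =
      lie_dilation \<epsilon> (\<Sum>k=1..step G. \<Sum>l=1..step G. lie_br G (layer_part G k u) (layer_part G l v))"
    by (simp only: expand [symmetric] sum_layer_part)
  also have "\<dots> = (\<Sum>k=1..step G. \<Sum>l=1..step G. \<epsilon> ^ (k + l) *\<^sub>R lie_br G (layer_part G k u) (layer_part G l v))"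
    by (simp add: linear_sum [OF linear_lie_dilation] lie_dilation_layer [OF layer_br [OF layer_part_in_layer layer_part_in_layer]])
  also have "\<dots> = (\<Sum>k=1..step G. \<Sum>l=1..step G. lie_br G (\<epsilon> ^ k *\<^sub>R layer_part G k u) (\<epsilon> ^ l *\<^sub>R layer_part G l v))"
    by (simp add: linear_cmul [OF linear_lie_br_left] linear_cmul [OF linear_lie_br_right] power_add mult_ac)
  also have "\<dots> = lie_br G (lie_dilation \<epsilon> u) (lie_dilation \<epsilon> v)"
    by (simp add: expand lie_dilation_def)
  finally show ?thesis .
qed

lemma lie_dilation_chart_mult:
  "lie_dilation \<epsilon> (chart_mult x y) = chart_mult (lie_dilation \<epsilon> x) (lie_dilation \<epsilon> y)"
  by (rule chart_mult_hom [OF linear_lie_dilation lie_dilation_bracket])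

lemma dilation_mult:
  "x \<in> carrier G \<Longrightarrow> y \<in> carrier G \<Longrightarrow> dilation G \<epsilon> (x \<otimes> y) = dilation G \<epsilon> x \<otimes> dilation G \<epsilon> y"
  by (simp add: dilation_eq llog_mult lie_dilation_chart_mult lexp_chart_mult)

lemma dilation_closed [simp]: "dilation G \<epsilon> x \<in> carrier G"
  by (simp add: dilation_eq)

lemma lie_dilation_has_vector_derivative_0:
  "((\<lambda>\<epsilon>. lie_dilation \<epsilon> v) has_vector_derivative layer_part G 1 v) (at 0)"
proof -
  have "((\<lambda>\<epsilon>::real. \<epsilon> ^ k) has_real_derivative (if k = 1 then 1 else 0)) (at 0)" if "k \<in> {1..step G}" for k
    using that by (cases k) (auto intro!: derivative_eq_intros simp: power_0_left)
  then have "((\<lambda>\<epsilon>. lie_dilation \<epsilon> v) has_vector_derivative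
      (\<Sum>k=1..step G. 0 ^ k *\<^sub>R 0 + (if k = 1 then 1 else 0) *\<^sub>R layer_part G k v)) (at 0)"
    unfolding lie_dilation_def
    by (intro has_vector_derivative_sum bounded_bilinear.has_vector_derivative [OF bounded_bilinear_scaleR]
        has_vector_derivative_const) (auto simp: has_real_derivative_iff_has_vector_derivative)
  moreover have "(\<Sum>k=1..step G. 0 ^ k *\<^sub>R 0 + (if k = 1 then 1 else 0) *\<^sub>R layer_part G k v) = layer_part G 1 v"
    using step_pos by (simp add: if_distrib [of "\<lambda>c. c *\<^sub>R _"] cong: if_cong)
  ultimately show ?thesis by simp
qed

text \<open>Differentiating the homomorphism property of the dilations at scale \<open>0\<close>
  linearizes the group law.\<close>

lemma layer_part_1_chart_mult:
  "layer_part G 1 (chart_mult x y) = layer_part G 1 x + layer_part G 1 y"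
proof -
  note d = lie_dilation_has_vector_derivative_0
  have z: "lie_dilation 0 v = 0" for v
    by (auto simp: lie_dilation_def power_0_left intro!: sum.neutral)
  have m1: "mult_deriv 0 0 (a, 0) = a" for a
  proof -
    have "((\<lambda>s. chart_mult (s *\<^sub>R a) 0) has_vector_derivative mult_deriv (0 *\<^sub>R a) 0 (a, 0)) (at 0)"
      by (intro chart_mult_has_vector_derivative has_vector_derivative_const has_vector_derivative_scaleR_const)
    then have "((\<lambda>s. s *\<^sub>R a) has_vector_derivative mult_deriv 0 0 (a, 0)) (at 0)"
      by simp
    then show ?thesis
      by (rule vector_derivative_unique_at [OF _ has_vector_derivative_scaleR_const])
  qed
  have m2: "mult_deriv 0 0 (0, b) = b" for b
    using chart_field_0 [of b] by (simp add: chart_field_def)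
  have "((\<lambda>\<epsilon>. chart_mult (lie_dilation \<epsilon> x) (lie_dilation \<epsilon> y)) has_vector_derivative
      mult_deriv (lie_dilation 0 x) (lie_dilation 0 y) (layer_part G 1 x, layer_part G 1 y)) (at 0)"
    by (intro chart_mult_has_vector_derivative d)
  then have "((\<lambda>\<epsilon>. lie_dilation \<epsilon> (chart_mult x y)) has_vector_derivative
      mult_deriv 0 0 ((layer_part G 1 x, 0) + (0, layer_part G 1 y))) (at 0)"
    by (simp add: lie_dilation_chart_mult z)
  then have "((\<lambda>\<epsilon>. lie_dilation \<epsilon> (chart_mult x y)) has_vector_derivative
      layer_part G 1 x + layer_part G 1 y) (at 0)"
    by (simp only: linear_add [OF linear_mult_deriv] m1 m2)
  then show ?thesis
    by (rule vector_derivative_unique_at [OF d])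
qed

lemma abs_lie_coord_le: "\<exists>K\<ge>0. \<forall>i v. i \<in> {1..DIM('l)} \<longrightarrow> \<bar>lie_coord G i v\<bar> \<le> K * norm v"
proof -
  have "\<exists>K\<ge>0. \<forall>v. \<bar>lie_coord G i v\<bar> \<le> K * norm v" for i
  proof -
    have "bounded_linear (lie_coord G i)"
      using linear_lie_coord linear_conv_bounded_linear by blast
    then show ?thesis
      using bounded_linear.nonneg_bounded by (force simp: mult.commute)
  qed
  then obtain K where K: "\<And>i. K i \<ge> 0" "\<And>i v. \<bar>lie_coord G i v\<bar> \<le> K i * norm v"
    by metis
  have "\<bar>lie_coord G i v\<bar> \<le> (\<Sum>j=1..DIM('l). K j) * norm v" if "i \<in> {1..DIM('l)}" for i v
  proof -
    have "K i \<le> (\<Sum>j=1..DIM('l). K j)"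
      by (rule member_le_sum) (use that K in auto)
    then show ?thesis
      using K(2) [of i v] by (meson mult_right_mono norm_ge_zero order_trans)
  qed
  moreover have "(\<Sum>j=1..DIM('l). K j) \<ge> 0" using K by (simp add: sum_nonneg)
  ultimately show ?thesis by blast
qed

subsection \<open>Vanishing at infinity\<close>

lemma hom_norm_le_norm: "\<exists>K\<ge>0. \<forall>v. hom_norm G (lexp G v) \<le> K * (1 + norm v)"
proof -
  obtain K where K: "K \<ge> 0" "\<And>i v. i \<in> {1..DIM('l)} \<Longrightarrow> \<bar>lie_coord G i v\<bar> \<le> K * norm v"
    using abs_lie_coord_le by blast
  have "hom_norm G (lexp G v) \<le> (real DIM('l) * (1 + K)) * (1 + norm v)" for v
  proof -
    have "\<bar>lie_coord G i v\<bar> powr (1 / real (weight G i)) \<le> (1 + K) * (1 + norm v)" if i: "i \<in> {1..DIM('l)}" for i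
    proof -
      have w: "1 / real (weight G i) \<le> 1" "0 \<le> 1 / real (weight G i)"
        using weight_in_steps [OF i] by auto
      have "\<bar>lie_coord G i v\<bar> powr (1 / real (weight G i)) \<le> 1 + \<bar>lie_coord G i v\<bar>"
      proof (cases "\<bar>lie_coord G i v\<bar> \<le> 1")
        case True
        then have "\<bar>lie_coord G i v\<bar> powr (1 / real (weight G i)) \<le> 1"
          using w by (intro powr_le1) auto
        then show ?thesis by linarith
      next
        case False
        then have "\<bar>lie_coord G i v\<bar> powr (1 / real (weight G i)) \<le> \<bar>lie_coord G i v\<bar> powr 1"
          using w by (intro powr_mono) auto
        then show ?thesis using False by simp
      qed
      also have "\<dots> \<le> 1 + K * norm v"
        using K(2) [OF i] by simp
      also have "\<dots> \<le> (1 + K) * (1 + norm v)"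
        using K(1) by (simp add: algebra_simps)
      finally show ?thesis .
    qed
    then have "hom_norm G (lexp G v) \<le> (\<Sum>i=1..DIM('l). (1 + K) * (1 + norm v))"
      unfolding hom_norm_def by (intro sum_mono) simp
    then show ?thesis by (simp add: mult.assoc)
  qed
  then show ?thesis
    using K(1) by (intro exI [of _ "real DIM('l) * (1 + K)"]) auto
qed

lemma norm_le_hom_norm: "\<exists>R'. \<forall>v. hom_norm G (lexp G v) \<le> R \<longrightarrow> norm v \<le> R'"
proof (intro exI allI impI)
  fix v assume h: "hom_norm G (lexp G v) \<le> R"
  have "norm v \<le> (\<Sum>i=1..DIM('l). \<bar>lie_coord G i v\<bar> * norm (lie_basis G i))"
    using norm_sum [of "\<lambda>i. lie_coord G i v *\<^sub>R lie_basis G i" "{1..DIM('l)}"]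
    by (simp add: lie_coord_expand del: One_nat_def)
  also have "\<dots> \<le> (\<Sum>i=1..DIM('l). \<bar>R\<bar> powr real (weight G i) * norm (lie_basis G i))"
  proof (intro sum_mono mult_right_mono norm_ge_zero)
    fix i assume i: "i \<in> {1..DIM('l)}"
    then have w: "weight G i > 0" using weight_in_steps [OF i] by auto
    have "\<bar>lie_coord G i v\<bar> powr (1 / real (weight G i)) \<le> hom_norm G (lexp G v)"
      unfolding hom_norm_def llog_lexp by (rule member_le_sum) (use i in auto)
    then have "(\<bar>lie_coord G i v\<bar> powr (1 / real (weight G i))) powr real (weight G i) \<le> \<bar>R\<bar> powr real (weight G i)"
      using h by (intro powr_mono2) auto
    then show "\<bar>lie_coord G i v\<bar> \<le> \<bar>R\<bar> powr real (weight G i)"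
      using w by (simp add: powr_powr)
  qed
  finally show "norm v \<le> (\<Sum>i=1..DIM('l). \<bar>R\<bar> powr real (weight G i) * norm (lie_basis G i))" .
qed

text \<open>The homogeneous norm and the Euclidean norm of the logarithm are not equivalent, but
  they have the same bounded sets, and decay at infinity depends on nothing else.\<close>

lemma vanishes_at_infinity_iff:
  "vanishes_at_infinity G f \<longleftrightarrow> ((\<lambda>v. f (lexp G v)) \<longlongrightarrow> 0) at_infinity"
proof
  assume f: "vanishes_at_infinity G f"
  show "((\<lambda>v. f (lexp G v)) \<longlongrightarrow> 0) at_infinity"
  proof (rule tendstoI)
    fix \<epsilon> :: real assume "\<epsilon> > 0"
    then obtain R where R: "\<And>x. x \<in> carrier G \<Longrightarrow> R \<le> hom_norm G x \<Longrightarrow> \<bar>f x\<bar> < \<epsilon>"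
      using f unfolding vanishes_at_infinity_def by meson
    obtain R' where R': "\<And>v. hom_norm G (lexp G v) \<le> R \<Longrightarrow> norm v \<le> R'"
      using norm_le_hom_norm by blast
    have "dist (f (lexp G v)) 0 < \<epsilon>" if "R' + 1 \<le> norm v" for v
      using R [of "lexp G v"] R' [of v] that by fastforce
    then show "eventually (\<lambda>v. dist (f (lexp G v)) 0 < \<epsilon>) at_infinity"
      by (auto simp: eventually_at_infinity)
  qed
next
  assume f: "((\<lambda>v. f (lexp G v)) \<longlongrightarrow> 0) at_infinity"
  show "vanishes_at_infinity G f"
    unfolding vanishes_at_infinity_def
  proof (intro allI impI)
    fix \<epsilon> :: real assume "\<epsilon> > 0"
    then obtain R where R: "\<And>v. R \<le> norm v \<Longrightarrow> \<bar>f (lexp G v)\<bar> < \<epsilon>"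
      using tendstoD [OF f] by (auto simp: eventually_at_infinity)
    obtain K where K: "K \<ge> 0" "\<And>v. hom_norm G (lexp G v) \<le> K * (1 + norm v)"
      using hom_norm_le_norm by blast
    have "\<bar>f x\<bar> < \<epsilon>" if x: "x \<in> carrier G" "K * (1 + \<bar>R\<bar>) + 1 \<le> hom_norm G x" for x
    proof -
      have "R \<le> norm (llog G x)"
      proof (rule ccontr)
        assume "\<not> R \<le> norm (llog G x)"
        then have "K * (1 + norm (llog G x)) \<le> K * (1 + \<bar>R\<bar>)"
          using K by (intro mult_left_mono) auto
        then show False using K(2) [of "llog G x"] x by simp
      qed
      then show ?thesis using R [of "llog G x"] x by simp
    qed
    then show "\<exists>R. \<forall>x\<in>carrier G. R \<le> hom_norm G x \<longrightarrow> \<bar>f x\<bar> < \<epsilon>" by blast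
  qed
qed

lemma vanishes_at_infinity_cong:
  assumes "\<And>x. x \<in> carrier G \<Longrightarrow> f x = g x"
  shows "vanishes_at_infinity G f \<longleftrightarrow> vanishes_at_infinity G g"
  using assms by (simp add: vanishes_at_infinity_iff)

lemma vanishes_at_infinity_sum:
  assumes "\<And>i. i \<in> A \<Longrightarrow> vanishes_at_infinity G (f i)"
  shows "vanishes_at_infinity G (\<lambda>x. \<Sum>i\<in>A. c i * f i x)"
  using assms unfolding vanishes_at_infinity_iff by (intro tendsto_null_sum tendsto_mult_right_zero)

lemma vanishes_at_infinity_add:
  assumes "vanishes_at_infinity G f" "vanishes_at_infinity G g"
  shows "vanishes_at_infinity G (\<lambda>x. f x + g x)"
  using assms unfolding vanishes_at_infinity_iff by (rule tendsto_add_zero)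

text \<open>Right translation is proper: its inverse is the translation by -w, which is continuous
  and so maps balls to bounded sets.\<close>

lemma filterlim_chart_mult: "filterlim (\<lambda>v. chart_mult v w) at_infinity at_infinity"
  unfolding filterlim_at_infinity [of 0 "\<lambda>v. chart_mult v w", OF order_refl]
proof (intro allI impI)
  fix R :: real assume "R > 0"
  have "smooth (\<lambda>z. chart_mult z (- w))"
    by (intro smooth_chart_mult_compose smooth_id smooth_const)
  then have "compact ((\<lambda>z. chart_mult z (- w)) ` cball 0 R)"
    by (intro compact_continuous_image smooth_continuous) auto
  then have "bounded ((\<lambda>z. chart_mult z (- w)) ` cball 0 R)"
    by (rule compact_imp_bounded)
  then obtain b where b: "\<And>z. norm z \<le> R \<Longrightarrow> norm (chart_mult z (- w)) \<le> b"
    unfolding bounded_iff by (metis imageI mem_cball_0)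
  have "R \<le> norm (chart_mult v w)" if "b + 1 \<le> norm v" for v
  proof (rule ccontr)
    assume "\<not> R \<le> norm (chart_mult v w)"
    then have "norm (chart_mult (chart_mult v w) (- w)) \<le> b" by (intro b) auto
    then show False using that by (simp add: chart_mult_assoc)
  qed
  then show "eventually (\<lambda>v. R \<le> norm (chart_mult v w)) at_infinity"
    by (auto simp: eventually_at_infinity)
qed

lemma vanishes_at_infinity_translate:
  assumes "vanishes_at_infinity G f" "y \<in> carrier G"
  shows "vanishes_at_infinity G (\<lambda>x. f (x \<otimes> y))"
proof -
  have "((\<lambda>v. f (lexp G (chart_mult v (llog G y)))) \<longlongrightarrow> 0) at_infinity"
    using filterlim_compose [OF assms(1) [unfolded vanishes_at_infinity_iff] filterlim_chart_mult] .
  then show ?thesis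
    using assms(2) by (simp add: vanishes_at_infinity_iff lexp_chart_mult)
qed

lemma smooth_fun_bounded:
  assumes "smooth_fun G f" "vanishes_at_infinity G f"
  shows "\<exists>B\<ge>0. \<forall>x\<in>carrier G. \<bar>f x\<bar> \<le> B"
proof -
  obtain R where R: "\<And>v. R \<le> norm v \<Longrightarrow> \<bar>f (lexp G v)\<bar> < 1"
    using tendstoD [OF assms(2) [unfolded vanishes_at_infinity_iff], of 1] by (auto simp: eventually_at_infinity)
  have "compact ((\<lambda>v. f (lexp G v)) ` cball 0 R)"
    using assms(1) by (intro compact_continuous_image smooth_continuous) (auto simp: smooth_fun_def o_def)
  then have "bounded ((\<lambda>v. f (lexp G v)) ` cball 0 R)"
    by (rule compact_imp_bounded)
  then obtain b where b: "\<And>v. norm v \<le> R \<Longrightarrow> \<bar>f (lexp G v)\<bar> \<le> b"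
    unfolding bounded_iff by (metis imageI mem_cball_0 real_norm_def)
  have "\<bar>f x\<bar> \<le> \<bar>b\<bar> + 1" if "x \<in> carrier G" for x
    using R [of "llog G x"] b [of "llog G x"] that by (cases "norm (llog G x) \<le> R") auto
  then show ?thesis
    by (intro exI [of _ "\<bar>b\<bar> + 1"]) auto
qed

lemma continuous_map_smooth_fun:
  assumes "smooth_fun G f"
  shows "continuous_map (lie_topology G) euclideanreal f"
proof -
  have "continuous_map euclidean euclideanreal (\<lambda>v. f (lexp G v))"
    using assms smooth_continuous by (auto simp: smooth_fun_def o_def)
  then have "continuous_map (lie_topology G) euclideanreal ((\<lambda>v. f (lexp G v)) \<circ> llog G)"
    unfolding lie_topology_def by (rule continuous_map_pullback)
  then show ?thesis
    by (rule continuous_map_eq) (auto simp: lie_topology_def topspace_pullback_topology)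
qed

subsection \<open>Functions with vanishing derivatives\<close>

lemma field_power_eq:
  "field_power G I f = iter_field (map (lie_basis G) (concat (map (\<lambda>i. replicate (I i) i) [1..<Suc DIM('l)]))) f"
proof -
  have "foldr (\<lambda>i. left_field G (lie_basis G i) ^^ I i) js f =
      iter_field (map (lie_basis G) (concat (map (\<lambda>i. replicate (I i) i) js))) f" for js
  proof (induction js)
    case (Cons j js)
    have "iter_field (map (lie_basis G) (replicate k j)) h = (left_field G (lie_basis G j) ^^ k) h" for k h
      by (induction k) auto
    then show ?case
      using Cons by (simp add: iter_field_append del: map_replicate)
  qed simp
  then show ?thesis by (simp add: field_power_def)
qed

text \<open>A sorted word is determined by the multiplicities of its letters; these are the
  exponents I with which it appears as a \<open>field_power\<close>.\<close>

lemma sort_eq_concat_replicate: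
  assumes "set js \<subseteq> {1..<n::nat}"
  shows "sort js = concat (map (\<lambda>i. replicate (count (mset js) i) i) [1..<n])"
proof (rule properties_for_sort)
  have "count (mset (concat (map (\<lambda>i. replicate (I i) i) [1..<n]))) x = (if 1 \<le> x \<and> x < n then I x else 0)" for I and x :: nat
    by (induction n) (auto simp: not_less_eq not_le)
  then show "mset (concat (map (\<lambda>i. replicate (count (mset js) i) i) [1..<n])) = mset js"
    using assms by (intro multiset_eqI) (auto simp: count_eq_zero_iff subset_iff not_less)
  show "sorted (concat (map (\<lambda>i. replicate (count (mset js) i) i) [1..<n]))"
    by (induction n) (auto simp: sorted_append)
qed

text \<open>Arbitrary vectors in arbitrary order are allowed, and the empty word gives decay of f
  itself. In this form the class is visibly stable under fields and right translations.\<close>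

definition decaying :: "('g \<Rightarrow> real) \<Rightarrow> bool" where
  "decaying f \<longleftrightarrow> smooth_fun G f \<and> (\<forall>us. vanishes_at_infinity G (iter_field us f))"

text \<open>Reordering a word of basis fields costs a bracket, which is a combination of shorter words;
  so it suffices to control the ordered words occurring in \<^const>\<open>field_power\<close>.\<close>

lemma C_inf_smooth_basis_words:
  assumes f: "f \<in> C_inf_smooth G" and js: "set js \<subseteq> {1..DIM('l)}"
  shows "vanishes_at_infinity G (iter_field (map (lie_basis G) js) f)"
  using js
proof (induction "length js" arbitrary: js rule: less_induct)
  case less
  let ?W = "\<lambda>js. iter_field (map (lie_basis G) js) f"
  let ?V = "\<lambda>js. vanishes_at_infinity G (?W js)"
  let ?ok = "\<lambda>ks. set ks \<subseteq> {1..DIM('l)} \<and> length ks = length js"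
  have sm: "smooth_fun G f"
    using f by (auto simp: C_inf_smooth_def)
  \<comment> \<open>Exchanging two neighbours costs a word with one letter less, whose decay is
    known by induction on the length.\<close>
  have swap: "?V (xs @ i # j # ys)" if V: "?V (xs @ j # i # ys)" and ok: "?ok (xs @ i # j # ys)" for xs ys i j
  proof -
    have "vanishes_at_infinity G (\<lambda>x. \<Sum>k=1..DIM('l). lie_coord G k (lie_br G (lie_basis G i) (lie_basis G j)) * ?W (xs @ k # ys) x)"
    proof (rule vanishes_at_infinity_sum)
      fix k assume "k \<in> {1..DIM('l)}"
      then show "?V (xs @ k # ys)"
        using ok by (intro less.hyps) auto
    qed
    from vanishes_at_infinity_add [OF V this]
    show ?thesis
    proof (rule vanishes_at_infinity_cong [THEN iffD1, rotated])
      fix x assume x: "x \<in> carrier G"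
      have "iter_field (map (lie_basis G) xs @ lie_br G (lie_basis G i) (lie_basis G j) # map (lie_basis G) ys) f x =
         (\<Sum>k=1..DIM('l). lie_coord G k (lie_br G (lie_basis G i) (lie_basis G j)) *
           iter_field (map (lie_basis G) xs @ lie_basis G k # map (lie_basis G) ys) f x)"
        by (subst lie_coord_expand [symmetric, of "lie_br G (lie_basis G i) (lie_basis G j)"])
          (rule iter_field_sum_vector [OF sm x])
      then show "?W (xs @ j # i # ys) x + (\<Sum>k=1..DIM('l). lie_coord G k (lie_br G (lie_basis G i) (lie_basis G j)) * ?W (xs @ k # ys) x)
          = ?W (xs @ i # j # ys) x"
        by (simp add: iter_field_bracket [OF sm x])
    qed
  qed
  have move: "?V (pre @ i # ks)" if "?V (pre @ insort i ks)" "?ok (pre @ i # ks)" for pre i ks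
    using that
  proof (induction ks arbitrary: pre)
    case (Cons j ks)
    show ?case
    proof (cases "i \<le> j")
      case False
      then have "?V ((pre @ [j]) @ insort i ks)" using Cons.prems by simp
      then have "?V ((pre @ [j]) @ i # ks)" by (rule Cons.IH) (use Cons.prems in auto)
      then show ?thesis using swap Cons.prems by simp
    qed (use Cons.prems in simp)
  qed simp
  have sort: "?V (pre @ ks)" if "?V (pre @ sort ks)" "?ok (pre @ ks)" for pre ks
    using that
  proof (induction ks arbitrary: pre)
    case (Cons i ks)
    then have "?V (pre @ i # sort ks)"
      by (intro move) auto
    then show ?case using Cons.IH [of "pre @ [i]"] Cons.prems by simp
  qed simp
  \<comment> \<open>Only degrees k \<ge> 1 are prescribed, so the empty word is taken from
    \<open>C_inf\<close>; a nonempty word has degree at least 1 because all weights are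
    positive.\<close>
  have "?V (sort js)"
  proof (cases "js = []")
    case True
    then show ?thesis
      using f by (auto simp: C_inf_smooth_def C_inf_def)
  next
    case False
    let ?I = "count (mset js)"
    have js: "set js \<subseteq> {1..<Suc DIM('l)}" using less.prems by auto
    obtain j where j: "j \<in> set js" using False by (cases js) auto
    then have "1 \<le> weight G j" "1 \<le> ?I j"
      using weight_in_steps [of j] less.prems by (auto simp: subset_iff)
    then have "1 \<le> weight G j * ?I j"
      using mult_le_mono by fastforce
    also have "\<dots> \<le> hom_degree G ?I"
      unfolding hom_degree_def by (rule member_le_sum) (use j less.prems in auto)
    finally have "vanishes_at_infinity G (field_power G ?I f)"
      using f by (auto simp: C_inf_smooth_def)
    then show ?thesis
      by (simp only: field_power_eq sort_eq_concat_replicate [OF js])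
  qed
  then show ?case using sort [of "[]" js] less.prems by simp
qed

text \<open>By multilinearity the vectors of a word can be expanded in the basis one after another,
  starting with the last, until only words in basis fields are left. Conversely each
  \<open>field_power\<close> is a word.\<close>

lemma C_inf_smooth_iff: "f \<in> C_inf_smooth G \<longleftrightarrow> decaying f"
proof
  assume f: "f \<in> C_inf_smooth G"
  then have sm: "smooth_fun G f"
    by (auto simp: C_inf_smooth_def)
  have "set js \<subseteq> {1..DIM('l)} \<Longrightarrow> vanishes_at_infinity G (iter_field (us @ map (lie_basis G) js) f)" for us js
  proof (induction us arbitrary: js rule: rev_induct)
    case Nil
    then show ?case using C_inf_smooth_basis_words [OF f] by simp
  next
    case (snoc u us)
    have "vanishes_at_infinity G (\<lambda>x. \<Sum>k=1..DIM('l). lie_coord G k u * iter_field (us @ map (lie_basis G) (k # js)) f x)"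
      by (intro vanishes_at_infinity_sum snoc.IH) (use snoc.prems in auto)
    then show ?case
    proof (rule vanishes_at_infinity_cong [THEN iffD1, rotated])
      fix x assume x: "x \<in> carrier G"
      show "(\<Sum>k=1..DIM('l). lie_coord G k u * iter_field (us @ map (lie_basis G) (k # js)) f x) =
          iter_field ((us @ [u]) @ map (lie_basis G) js) f x"
        by (subst (2) lie_coord_expand [symmetric, of u])
          (simp add: iter_field_sum_vector [OF sm x] del: One_nat_def)
    qed
  qed
  from this [of "[]"] show "decaying f"
    using sm by (simp add: decaying_def)
next
  assume f: "decaying f"
  then have "vanishes_at_infinity G (iter_field [] f)"
    unfolding decaying_def by blast
  then show "f \<in> C_inf_smooth G"
    using f by (simp add: C_inf_smooth_def C_inf_def decaying_def field_power_eq continuous_map_smooth_fun)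
qed

lemma decaying_smooth_fun: "decaying f \<Longrightarrow> smooth_fun G f"
  by (simp add: decaying_def)

lemma decaying_C_inf: "decaying f \<Longrightarrow> f \<in> C_inf G"
  using C_inf_smooth_iff [of f] by (auto simp: C_inf_smooth_def)

lemma decaying_left_field: "decaying f \<Longrightarrow> decaying (left_field G u f)"
proof -
  have "iter_field us (left_field G u f) = iter_field (us @ [u]) f" for us
    by (simp add: iter_field_append)
  then show "decaying f \<Longrightarrow> decaying (left_field G u f)"
    by (simp add: decaying_def smooth_fun_left_field)
qed

lemma decaying_sum:
  assumes "\<And>i. i \<in> A \<Longrightarrow> decaying (f i)"
  shows "decaying (\<lambda>x. \<Sum>i\<in>A. c i * f i x)"
  unfolding decaying_def
proof (intro conjI allI)
  show "smooth_fun G (\<lambda>x. \<Sum>i\<in>A. c i * f i x)"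
    using assms by (intro smooth_fun_sum) (simp add: decaying_def)
  fix us
  have "vanishes_at_infinity G (\<lambda>x. \<Sum>i\<in>A. c i * iter_field us (f i) x)"
    using assms by (intro vanishes_at_infinity_sum) (simp add: decaying_def)
  then show "vanishes_at_infinity G (iter_field us (\<lambda>x. \<Sum>i\<in>A. c i * f i x))"
    using vanishes_at_infinity_cong [of "iter_field us (\<lambda>x. \<Sum>i\<in>A. c i * f i x)"] assms
    by (simp add: iter_field_sum_fun decaying_def)
qed

lemma decaying_translate:
  assumes "decaying f" "y \<in> carrier G"
  shows "decaying (\<lambda>g. f (g \<otimes> y))"
  unfolding decaying_def
proof (intro conjI allI)
  show "smooth_fun G (\<lambda>g. f (g \<otimes> y))"
    using assms by (intro smooth_fun_translate) (simp_all add: decaying_def)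
  fix us
  have "vanishes_at_infinity G (\<lambda>x. iter_field (map (coadj (llog G y)) us) f (x \<otimes> y))"
    using assms by (intro vanishes_at_infinity_translate) (simp_all add: decaying_def)
  then show "vanishes_at_infinity G (iter_field us (\<lambda>g. f (g \<otimes> y)))"
    using vanishes_at_infinity_cong [of "iter_field us (\<lambda>g. f (g \<otimes> y))"] assms
    by (simp add: iter_field_translate decaying_def)
qed

lemma decaying_bounded: "decaying f \<Longrightarrow> \<exists>B\<ge>0. \<forall>x\<in>carrier G. \<bar>f x\<bar> \<le> B"
  by (metis decaying_def iter_field_Nil smooth_fun_bounded)

text \<open>The vector applied to f at once is expanded in the basis; each basis derivative of f is
  decaying again and takes words shorter by one. The finite basis makes the bound uniform over all
  vectors.\<close>

lemma decaying_iter_field_bounded_length: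
  assumes "decaying f"
  shows "\<exists>B\<ge>0. \<forall>us. length us = n \<longrightarrow> (\<forall>x\<in>carrier G. \<bar>iter_field us f x\<bar> \<le> B * prod_list (map norm us))"
  using assms
proof (induction n arbitrary: f)
  case 0
  then show ?case using decaying_bounded by auto
next
  case (Suc n)
  obtain K where K: "K \<ge> 0" "\<And>i v. i \<in> {1..DIM('l)} \<Longrightarrow> \<bar>lie_coord G i v\<bar> \<le> K * norm v"
    using abs_lie_coord_le by blast
  have "\<exists>B\<ge>0. \<forall>us. length us = n \<longrightarrow>
      (\<forall>x\<in>carrier G. \<bar>iter_field us (left_field G (lie_basis G i) f) x\<bar> \<le> B * prod_list (map norm us))" for i
    by (rule Suc.IH) (rule decaying_left_field, rule Suc.prems)
  then obtain B where B0: "\<And>i. B i \<ge> 0" and B: "\<And>i us x. length us = n \<Longrightarrow> x \<in> carrier G \<Longrightarrow>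
      \<bar>iter_field us (left_field G (lie_basis G i) f) x\<bar> \<le> B i * prod_list (map norm us)"
    by metis
  have "\<bar>iter_field us f x\<bar> \<le> (\<Sum>i=1..DIM('l). K * B i) * prod_list (map norm us)"
    if us: "length us = Suc n" and x: "x \<in> carrier G" for us x
  proof -
    obtain vs u where vs: "us = vs @ [u]" "length vs = n"
      using us by (metis length_append_singleton nat.inject rev_exhaust length_0_conv nat.distinct(1))
    have pos: "0 \<le> prod_list (map norm vs)"
      by (intro prod_list_nonneg) auto
    have "iter_field us f x = (\<Sum>i=1..DIM('l). lie_coord G i u * iter_field vs (left_field G (lie_basis G i) f) x)"
      unfolding vs
      by (subst lie_coord_expand [symmetric, of u], subst iter_field_sum_vector)
        (use x Suc.prems in \<open>auto simp: decaying_def iter_field_append\<close>)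
    also have "\<bar>\<dots>\<bar> \<le> (\<Sum>i=1..DIM('l). \<bar>lie_coord G i u\<bar> * \<bar>iter_field vs (left_field G (lie_basis G i) f) x\<bar>)"
      using sum_abs [of "\<lambda>i. lie_coord G i u * iter_field vs (left_field G (lie_basis G i) f) x" "{1..DIM('l)}"]
      by (simp add: abs_mult)
    also have "\<dots> \<le> (\<Sum>i=1..DIM('l). (K * norm u) * (B i * prod_list (map norm vs)))"
      using K B [OF vs(2) x] by (intro sum_mono mult_mono) auto
    also have "\<dots> = (\<Sum>i=1..DIM('l). K * B i) * prod_list (map norm us)"
      by (simp add: vs sum_distrib_left sum_distrib_right mult_ac)
    finally show ?thesis .
  qed
  moreover have "(\<Sum>i=1..DIM('l). K * B i) \<ge> 0"
    using K B0 by (simp add: sum_nonneg)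
  ultimately show ?case by blast
qed

text \<open>The norm in which all errors are measured. Weighting by the norms of the vectors makes
  the bound usable for vectors that depend on \<epsilon>, such as dilated or conjugated
  ones.\<close>

definition deriv_bound :: "nat \<Rightarrow> real \<Rightarrow> ('g \<Rightarrow> real) \<Rightarrow> bool" where
  "deriv_bound n B f \<longleftrightarrow> (\<forall>us. length us \<le> n \<longrightarrow>
     (\<forall>x\<in>carrier G. \<bar>iter_field us f x\<bar> \<le> B * prod_list (map norm us)))"

lemma deriv_boundD:
  "deriv_bound n B f \<Longrightarrow> length us \<le> n \<Longrightarrow> x \<in> carrier G \<Longrightarrow>
    \<bar>iter_field us f x\<bar> \<le> B * prod_list (map norm us)"
  by (simp add: deriv_bound_def)

lemma deriv_bound_mono: "deriv_bound n B f \<Longrightarrow> k \<le> n \<Longrightarrow> deriv_bound k B f"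
  by (simp add: deriv_bound_def)

lemma deriv_bound_nonneg: "deriv_bound n B f \<Longrightarrow> 0 \<le> B"
  using deriv_boundD [of n B f "[]" \<one>] by fastforce

lemma decaying_deriv_bound:
  assumes "decaying f"
  shows "\<exists>B. deriv_bound n B f"
proof -
  have "\<forall>n. \<exists>B\<ge>0. \<forall>us. length us = n \<longrightarrow> (\<forall>x\<in>carrier G. \<bar>iter_field us f x\<bar> \<le> B * prod_list (map norm us))"
    using decaying_iter_field_bounded_length [OF assms] by blast
  then obtain B where B0: "\<And>n. B n \<ge> 0" and
    B: "\<And>us x. x \<in> carrier G \<Longrightarrow> \<bar>iter_field us f x\<bar> \<le> B (length us) * prod_list (map norm us)"
    by metis
  have "\<bar>iter_field us f x\<bar> \<le> (\<Sum>k\<le>n. B k) * prod_list (map norm us)"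
    if "length us \<le> n" "x \<in> carrier G" for us x
  proof -
    have "B (length us) \<le> (\<Sum>k\<le>n. B k)"
      by (rule member_le_sum) (use that B0 in auto)
    moreover have "0 \<le> prod_list (map norm us)"
      by (intro prod_list_nonneg) auto
    ultimately show ?thesis
      using B [OF that(2), of us] by (meson mult_right_mono order_trans)
  qed
  then show ?thesis
    by (intro exI [of _ "\<Sum>k\<le>n. B k"]) (auto simp: deriv_bound_def)
qed

end

section \<open>Local expansions along dilated increments\<close>

text \<open>The mean value inequality is used twice, for f' and then for f(x) - x f'(0); C bounds
  f'' on the unit interval.\<close>

lemma smooth_real_second_order:
  fixes f :: "real \<Rightarrow> 'b::real_inner"
  assumes f: "smooth f"
  shows "\<exists>C\<ge>0. \<forall>\<epsilon>. 0 \<le> \<epsilon> \<and> \<epsilon> \<le> 1 \<longrightarrow>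
    norm (f \<epsilon> - f 0 - \<epsilon> *\<^sub>R frechet_derivative f (at 0) 1) \<le> C * \<epsilon>\<^sup>2"
proof -
  define f1 where "f1 x = frechet_derivative f (at x) 1" for x
  define f2 where "f2 x = frechet_derivative f1 (at x) 1" for x
  have s1: "smooth f1" unfolding f1_def [abs_def] by (rule smooth_frechet_derivative [OF f])
  have s2: "smooth f2" unfolding f2_def [abs_def] by (rule smooth_frechet_derivative [OF s1])
  have d0: "(f has_derivative (\<lambda>h. h *\<^sub>R f1 x)) (at x)" for x
  proof -
    have d: "(f has_derivative frechet_derivative f (at x)) (at x)" by (rule smooth_has_derivative [OF f])
    have "frechet_derivative f (at x) = (\<lambda>h. h *\<^sub>R f1 x)"
    proof
      fix h
      show "frechet_derivative f (at x) h = h *\<^sub>R f1 x"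
        using linear_cmul [OF has_derivative_linear [OF d], of h 1] unfolding f1_def by simp
    qed
    then show ?thesis using d by simp
  qed
  have d1: "(f1 has_derivative (\<lambda>h. h *\<^sub>R f2 x)) (at x)" for x
  proof -
    have d: "(f1 has_derivative frechet_derivative f1 (at x)) (at x)" by (rule smooth_has_derivative [OF s1])
    have "frechet_derivative f1 (at x) = (\<lambda>h. h *\<^sub>R f2 x)"
    proof
      fix h
      show "frechet_derivative f1 (at x) h = h *\<^sub>R f2 x"
        using linear_cmul [OF has_derivative_linear [OF d], of h 1] unfolding f2_def by simp
    qed
    then show ?thesis using d by simp
  qed
  have "compact (f2 ` {0..1})"
    by (intro compact_continuous_image smooth_continuous s2) auto
  then have "bounded (f2 ` {0..1})" by (rule compact_imp_bounded)
  then obtain C where C: "\<And>x. x \<in> {0..1} \<Longrightarrow> norm (f2 x) \<le> C"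
    unfolding bounded_iff by (metis imageI)
  have C0: "C \<ge> 0" using C [of 0] norm_ge_zero [of "f2 0"] by (simp del: norm_ge_zero)
  have c1: "continuous_on S f1" for S by (rule smooth_continuous [OF s1])
  have b1: "norm (f1 x - f1 0) \<le> C * x" if "0 < x" "x \<le> 1" for x
  proof -
    have "\<exists>y\<in>{0<..<x}. norm (f1 x - f1 0) \<le> norm ((x - 0) *\<^sub>R f2 y)"
      by (rule mvt_general [OF that(1) c1 d1])
    then obtain y where y: "y \<in> {0<..<x}" "norm (f1 x - f1 0) \<le> norm (x *\<^sub>R f2 y)" by auto
    then have "norm (f1 x - f1 0) \<le> x * norm (f2 y)" using that by simp
    also have "\<dots> \<le> x * C" using y that by (intro mult_left_mono C) auto
    finally show ?thesis by (simp add: mult.commute)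
  qed
  have "norm (f \<epsilon> - f 0 - \<epsilon> *\<^sub>R f1 0) \<le> C * \<epsilon>\<^sup>2" if e: "0 \<le> \<epsilon>" "\<epsilon> \<le> 1" for \<epsilon>
  proof (cases "\<epsilon> = 0")
    case False
    then have e0: "0 < \<epsilon>" using e by simp
    have dg: "((\<lambda>x. f x - x *\<^sub>R f1 0) has_derivative (\<lambda>h. h *\<^sub>R (f1 x - f1 0))) (at x)" for x
      by (auto intro!: derivative_eq_intros d0 simp: scaleR_diff_right)
    have "continuous_on {0..\<epsilon>} (\<lambda>x. f x - x *\<^sub>R f1 0)"
      by (intro continuous_intros smooth_continuous [OF f])
    then have "\<exists>y\<in>{0<..<\<epsilon>}. norm ((f \<epsilon> - \<epsilon> *\<^sub>R f1 0) - (f 0 - 0 *\<^sub>R f1 0)) \<le> norm ((\<epsilon> - 0) *\<^sub>R (f1 y - f1 0))"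
      by (rule mvt_general [OF e0 _ dg])
    then obtain y where y: "y \<in> {0<..<\<epsilon>}" "norm (f \<epsilon> - f 0 - \<epsilon> *\<^sub>R f1 0) \<le> norm (\<epsilon> *\<^sub>R (f1 y - f1 0))"
      by (auto simp: algebra_simps)
    then have "norm (f \<epsilon> - f 0 - \<epsilon> *\<^sub>R f1 0) \<le> \<epsilon> * norm (f1 y - f1 0)" using e by simp
    also have "\<dots> \<le> \<epsilon> * (C * y)" using y e by (intro mult_left_mono b1) auto
    also have "\<dots> \<le> \<epsilon> * (C * \<epsilon>)" using y e C0 by (intro mult_left_mono) auto
    finally show ?thesis by (simp add: power2_eq_square mult_ac)
  qed simp
  then show ?thesis using C0 unfolding f1_def by blast
qed

lemma smooth_power: "smooth (\<lambda>x::real. x ^ k)"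
proof (induction k)
  case (Suc k)
  from smooth_scaleR [OF smooth_id Suc] show ?case by simp
qed simp

context nilpotent_lie_group
begin

lemma iter_field_add:
  assumes "smooth_fun G f" "x \<in> carrier G"
  shows "iter_field (us @ (u + v) # ws) f x = iter_field (us @ u # ws) f x + iter_field (us @ v # ws) f x"
  using iter_field_sum_vector [OF assms, of us "\<lambda>_. 1" "\<lambda>b. if b then u else v" UNIV ws]
  by (simp add: UNIV_bool add.commute)

lemma iter_field_scaleR:
  assumes "smooth_fun G f" "x \<in> carrier G"
  shows "iter_field (us @ (c *\<^sub>R u) # ws) f x = c * iter_field (us @ u # ws) f x"
  using iter_field_sum_vector [OF assms, of us "\<lambda>_. c" "\<lambda>_. u" "{()}" ws] by simp

lemma iter_field_diff:
  assumes "smooth_fun G f" "x \<in> carrier G"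
  shows "iter_field (us @ (u - v) # ws) f x = iter_field (us @ u # ws) f x - iter_field (us @ v # ws) f x"
  using iter_field_add [OF assms, of us u "- 1 *\<^sub>R v" ws] iter_field_scaleR [OF assms, of us "- 1" v ws]
  by simp

lemma iter_field_scaleR_map:
  assumes "smooth_fun G f" "x \<in> carrier G"
  shows "iter_field (ws @ map (\<lambda>u. c u *\<^sub>R v u) us) f x = prod_list (map c us) * iter_field (ws @ map v us) f x"
proof (induction us arbitrary: ws)
  case (Cons u us)
  show ?case
    using iter_field_scaleR [OF assms, of ws "c u" "v u" "map (\<lambda>u. c u *\<^sub>R v u) us"] Cons [of "ws @ [v u]"]
    by simp
qed simp

end

context stratified_lie_group
begin

section \<open>Taylor expansion along one-parameter subgroups and dilated increments\<close>

lemma taylor_order_1: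
  assumes h: "smooth_fun G h" and B: "deriv_bound 1 B h" and x: "x \<in> carrier G"
  shows "\<bar>h (x \<otimes> lexp G v) - h x\<bar> \<le> B * norm v"
proof -
  have "\<exists>s. 0 < s \<and> s < 1 \<and> h (x \<otimes> lexp G (1 *\<^sub>R v)) - h (x \<otimes> lexp G (0 *\<^sub>R v)) =
      (1 - 0) * left_field G v h (x \<otimes> lexp G (s *\<^sub>R v))"
    by (rule MVT2) (use left_field_DERIV [OF h x] in auto)
  then obtain s where "h (x \<otimes> lexp G v) - h x = left_field G v h (x \<otimes> lexp G (s *\<^sub>R v))"
    using x by auto
  then show ?thesis
    using deriv_boundD [OF B, of "[v]" "x \<otimes> lexp G (s *\<^sub>R v)"] x by simp
qed

text \<open>Along s -> x exp(sv) each derivative in s adds one field of v to the word, so this is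
  the Maclaurin formula of a real function with remainder \<open>D 3 s / 6\<close>.\<close>

lemma taylor_order_3:
  assumes h: "smooth_fun G h" and B: "deriv_bound 3 B h" and x: "x \<in> carrier G"
  shows "\<bar>h (x \<otimes> lexp G v) - h x - left_field G v h x - 1/2 * left_field G v (left_field G v h) x\<bar> \<le> B * norm v ^ 3"
proof -
  define D where "D k s = iter_field (replicate k v) h (x \<otimes> lexp G (s *\<^sub>R v))" for k s
  have "\<exists>s>0. s < 1 \<and> D 0 1 = (\<Sum>m<3. D m 0 / fact m * 1 ^ m) + D 3 s / fact 3 * 1 ^ 3"
  proof (rule Maclaurin)
    show "\<forall>m t. m < 3 \<and> 0 \<le> t \<and> t \<le> 1 \<longrightarrow> (D m has_real_derivative D (Suc m) t) (at t)"
      unfolding D_def [abs_def] using left_field_DERIV [OF smooth_fun_iter_field [OF h] x] by simp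
  qed auto
  then obtain s where "D 0 1 = (\<Sum>m<3. D m 0 / fact m) + D 3 s / fact 3" by auto
  moreover have "(\<Sum>m<3. g m) = g 0 + g 1 + g 2" for g :: "nat \<Rightarrow> real"
    by (simp add: numeral_3_eq_3 numeral_2_eq_2 One_nat_def)
  moreover have "D 0 1 = h (x \<otimes> lexp G v)" "D 0 0 = h x" "D 1 0 = left_field G v h x"
    "D 2 0 = left_field G v (left_field G v h) x"
    using x by (simp_all add: D_def numeral_2_eq_2 One_nat_def)
  ultimately have "h (x \<otimes> lexp G v) - h x - left_field G v h x - 1/2 * left_field G v (left_field G v h) x = D 3 s / 6"
    by (simp add: fact_numeral)
  moreover have "\<bar>D 3 s\<bar> \<le> B * norm v ^ 3"
    unfolding D_def using deriv_boundD [OF B, of "replicate 3 v" "x \<otimes> lexp G (s *\<^sub>R v)"] x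
    by (simp add: prod_list_replicate)
  ultimately show ?thesis by simp
qed

lemma layer_part_gt_step: "step G < k \<Longrightarrow> layer_part G k v = 0"
proof (rule lie_coord_eqI)
  fix i assume "step G < k" "i \<in> {1..DIM('l)}"
  then show "lie_coord G i (layer_part G k v) = lie_coord G i 0"
    using weight_in_steps [of i] by (auto simp: lie_coord_layer_part linear_0 [OF linear_lie_coord])
qed

lemma lie_dilation_split:
  "\<exists>M\<ge>0. \<forall>\<epsilon>. 0 \<le> \<epsilon> \<and> \<epsilon> \<le> 1 \<longrightarrow> (\<exists>r. norm r \<le> M \<and>
     lie_dilation \<epsilon> d = \<epsilon> *\<^sub>R layer_part G 1 d + (\<epsilon>\<^sup>2 *\<^sub>R layer_part G 2 d + \<epsilon> ^ 3 *\<^sub>R r))"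
proof (intro exI [of _ "\<Sum>k=3..step G + 2. norm (layer_part G k d)"] conjI allI impI)
  fix \<epsilon> :: real assume e: "0 \<le> \<epsilon> \<and> \<epsilon> \<le> 1"
  define r where "r = (\<Sum>k=3..step G + 2. \<epsilon> ^ (k - 3) *\<^sub>R layer_part G k d)"
  have "norm r \<le> (\<Sum>k=3..step G + 2. norm (layer_part G k d))"
    unfolding r_def
  proof (rule sum_norm_le)
    fix k
    show "norm (\<epsilon> ^ (k - 3) *\<^sub>R layer_part G k d) \<le> norm (layer_part G k d)"
      using e by (simp add: mult_left_le_one_le power_le_one)
  qed
  moreover have "lie_dilation \<epsilon> d = \<epsilon> *\<^sub>R layer_part G 1 d + (\<epsilon>\<^sup>2 *\<^sub>R layer_part G 2 d + \<epsilon> ^ 3 *\<^sub>R r)"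
  proof -
    \<comment> \<open>Summing up to \<open>step G + 2\<close> adds only zero layers and makes the
      indices 1 and 2 available even for step one.\<close>
    have "lie_dilation \<epsilon> d = (\<Sum>k=1..step G + 2. \<epsilon> ^ k *\<^sub>R layer_part G k d)"
      unfolding lie_dilation_def
      by (rule sum.mono_neutral_left) (auto intro: layer_part_gt_step)
    also have "\<dots> = \<epsilon> ^ 1 *\<^sub>R layer_part G 1 d + (\<epsilon> ^ 2 *\<^sub>R layer_part G 2 d +
        (\<Sum>k=3..step G + 2. \<epsilon> ^ k *\<^sub>R layer_part G k d))"
    proof -
      have "{1..step G + 2} = insert 1 (insert 2 {3..step G + 2})" by auto
      then show ?thesis by simp
    qed
    also have "(\<Sum>k=3..step G + 2. \<epsilon> ^ k *\<^sub>R layer_part G k d) = \<epsilon> ^ 3 *\<^sub>R r"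
      unfolding r_def scaleR_sum_right by (rule sum.cong) (auto simp flip: power_add)
    finally show ?thesis by simp
  qed
  ultimately show "\<exists>r. norm r \<le> (\<Sum>k=3..step G + 2. norm (layer_part G k d)) \<and>
     lie_dilation \<epsilon> d = \<epsilon> *\<^sub>R layer_part G 1 d + (\<epsilon>\<^sup>2 *\<^sub>R layer_part G 2 d + \<epsilon> ^ 3 *\<^sub>R r)"
    by blast
qed (simp add: sum_nonneg)

lemma norm_lie_dilation_le: "\<exists>M\<ge>0. \<forall>\<epsilon>. 0 \<le> \<epsilon> \<and> \<epsilon> \<le> 1 \<longrightarrow> norm (lie_dilation \<epsilon> d) \<le> M * \<epsilon>"
proof (intro exI [of _ "\<Sum>k=1..step G. norm (layer_part G k d)"] conjI allI impI)
  fix \<epsilon> :: real assume e: "0 \<le> \<epsilon> \<and> \<epsilon> \<le> 1"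
  have "norm (lie_dilation \<epsilon> d) \<le> (\<Sum>k=1..step G. norm (layer_part G k d) * \<epsilon>)"
    unfolding lie_dilation_def
  proof (rule sum_norm_le)
    fix k assume "k \<in> {1..step G}"
    then have "\<epsilon> ^ k \<le> \<epsilon> ^ 1" using e by (intro power_decreasing) auto
    then show "norm (\<epsilon> ^ k *\<^sub>R layer_part G k d) \<le> norm (layer_part G k d) * \<epsilon>"
      using e mult_right_mono [of "\<epsilon> ^ k" \<epsilon> "norm (layer_part G k d)"] by (simp add: mult.commute)
  qed
  then show "norm (lie_dilation \<epsilon> d) \<le> (\<Sum>k=1..step G. norm (layer_part G k d)) * \<epsilon>"
    by (simp add: sum_distrib_right)
qed (simp add: sum_nonneg)

text \<open>The coefficient of \<open>\<epsilon>\<^sup>2\<close> in the expansion along a dilated increment.\<close>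

definition second_order :: "'l \<Rightarrow> ('g \<Rightarrow> real) \<Rightarrow> 'g \<Rightarrow> real" where
  "second_order d h x = left_field G (layer_part G 2 d) h x +
     1/2 * left_field G (layer_part G 1 d) (left_field G (layer_part G 1 d) h) x"

text \<open>A dilated increment is \<epsilon> L1 + w with w = \<epsilon>^2 L2 + O(\<epsilon>^3). At
  order \<epsilon>^2 the single derivative contributes the second layer and the double derivative
  the square of the first layer; every word that mixes L1 with w is O(\<epsilon>^3).\<close>

lemma local_expansion:
  "\<exists>C\<ge>0. \<forall>\<epsilon> B h x. 0 \<le> \<epsilon> \<and> \<epsilon> \<le> 1 \<and> smooth_fun G h \<and> deriv_bound 3 B h \<and> x \<in> carrier G \<longrightarrow>
    \<bar>h (x \<otimes> lexp G (lie_dilation \<epsilon> d)) - h x - \<epsilon> * left_field G (layer_part G 1 d) h x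
      - \<epsilon>\<^sup>2 * second_order d h x\<bar> \<le> C * B * \<epsilon> ^ 3"
proof -
  obtain M where M: "M \<ge> 0" and split: "\<And>\<epsilon>. 0 \<le> \<epsilon> \<Longrightarrow> \<epsilon> \<le> 1 \<Longrightarrow> \<exists>r. norm r \<le> M \<and>
     lie_dilation \<epsilon> d = \<epsilon> *\<^sub>R layer_part G 1 d + (\<epsilon>\<^sup>2 *\<^sub>R layer_part G 2 d + \<epsilon> ^ 3 *\<^sub>R r)"
    using lie_dilation_split by metis
  obtain Q where Q: "Q \<ge> 0" "\<And>\<epsilon>. 0 \<le> \<epsilon> \<Longrightarrow> \<epsilon> \<le> 1 \<Longrightarrow> norm (lie_dilation \<epsilon> d) \<le> Q * \<epsilon>"
    using norm_lie_dilation_le by metis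
  define L1 where "L1 = layer_part G 1 d"
  define L2 where "L2 = layer_part G 2 d"
  define P where "P = norm L2 + M"
  have P: "P \<ge> 0" using M by (simp add: P_def)
  \<comment> \<open>In order: the Taylor remainder, the layers from the third on in the single
    derivative, the two mixed words together, and the word w w, whose factor 1/2 is dropped.\<close>
  define C where "C = Q ^ 3 + M + norm L1 * P + P\<^sup>2"
  have C: "C \<ge> 0" using Q M P by (simp add: C_def)
  have "\<bar>h (x \<otimes> lexp G (lie_dilation \<epsilon> d)) - h x - \<epsilon> * left_field G L1 h x - \<epsilon>\<^sup>2 * second_order d h x\<bar> \<le> C * B * \<epsilon> ^ 3"
    if e: "0 \<le> \<epsilon>" "\<epsilon> \<le> 1" and h: "smooth_fun G h" and B: "deriv_bound 3 B h" and x: "x \<in> carrier G" for \<epsilon> B h x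
  proof -
    obtain r where r: "norm r \<le> M" "lie_dilation \<epsilon> d = \<epsilon> *\<^sub>R L1 + (\<epsilon>\<^sup>2 *\<^sub>R L2 + \<epsilon> ^ 3 *\<^sub>R r)"
      using split [OF e] unfolding L1_def L2_def by blast
    have B0: "B \<ge> 0" using B by (rule deriv_bound_nonneg)
    define v where "v = lie_dilation \<epsilon> d"
    define a where "a = \<epsilon> *\<^sub>R L1"
    define w where "w = \<epsilon>\<^sup>2 *\<^sub>R L2 + \<epsilon> ^ 3 *\<^sub>R r"
    let ?F = "\<lambda>us. iter_field us h x"
    have v: "v = a + w" by (simp add: v_def a_def w_def r)
    have e32: "\<epsilon> ^ 3 \<le> \<epsilon>\<^sup>2" using e by (intro power_decreasing) auto
    have e43: "\<epsilon> ^ 4 \<le> \<epsilon> ^ 3" using e by (intro power_decreasing) auto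
    have na: "norm a = \<epsilon> * norm L1" using e by (simp add: a_def)
    have nw: "norm w \<le> P * \<epsilon>\<^sup>2"
    proof -
      have "norm w \<le> \<epsilon>\<^sup>2 * norm L2 + \<epsilon> ^ 3 * norm r"
        unfolding w_def using e norm_triangle_ineq [of "\<epsilon>\<^sup>2 *\<^sub>R L2" "\<epsilon> ^ 3 *\<^sub>R r"] by simp
      also have "\<dots> \<le> \<epsilon>\<^sup>2 * norm L2 + \<epsilon>\<^sup>2 * M"
        using e32 r(1) e by (intro add_mono mult_mono) auto
      finally show ?thesis by (simp add: P_def algebra_simps)
    qed
    have F2: "\<bar>?F [u, z]\<bar> \<le> B * (norm u * norm z)" for u z
      using deriv_boundD [OF B _ x, of "[u, z]"] by simp
    have t: "\<bar>h (x \<otimes> lexp G v) - h x - ?F [v] - 1/2 * ?F [v, v]\<bar> \<le> B * (Q * \<epsilon>) ^ 3"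
    proof -
      have "\<bar>h (x \<otimes> lexp G v) - h x - ?F [v] - 1/2 * ?F [v, v]\<bar> \<le> B * norm v ^ 3"
        using taylor_order_3 [OF h B x, of v] by simp
      also have "\<dots> \<le> B * (Q * \<epsilon>) ^ 3"
        using Q(2) [OF e] B0 unfolding v_def by (intro mult_left_mono power_mono) auto
      finally show ?thesis .
    qed
    have f1: "?F [v] = \<epsilon> * ?F [L1] + \<epsilon>\<^sup>2 * ?F [L2] + \<epsilon> ^ 3 * ?F [r]"
      using iter_field_add [OF h x, of "[]" a w "[]"] iter_field_add [OF h x, of "[]" "\<epsilon>\<^sup>2 *\<^sub>R L2" "\<epsilon> ^ 3 *\<^sub>R r" "[]"]
        iter_field_scaleR [OF h x, of "[]" _ _ "[]"]
      by (simp add: v a_def w_def)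
    have r1: "\<bar>\<epsilon> ^ 3 * ?F [r]\<bar> \<le> M * B * \<epsilon> ^ 3"
    proof -
      have "\<bar>?F [r]\<bar> \<le> B * M"
        using deriv_boundD [OF B _ x, of "[r]"] r(1) B0 by (simp add: mult_left_mono order_trans [OF _ mult_left_mono])
      then have "\<epsilon> ^ 3 * \<bar>?F [r]\<bar> \<le> \<epsilon> ^ 3 * (B * M)" using e by (intro mult_left_mono) auto
      then show ?thesis using e by (simp add: abs_mult mult_ac)
    qed
    have f2: "?F [v, v] = ?F [a, a] + ?F [a, w] + ?F [w, a] + ?F [w, w]"
      using iter_field_add [OF h x, of "[]" a w "[v]"] iter_field_add [OF h x, of "[a]" a w "[]"]
        iter_field_add [OF h x, of "[w]" a w "[]"]
      by (simp add: v)
    have faa: "?F [a, a] = \<epsilon>\<^sup>2 * ?F [L1, L1]"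
      using iter_field_scaleR_map [OF h x, of "[]" "\<lambda>_. \<epsilon>" "\<lambda>u. u" "[L1, L1]"]
      by (simp add: a_def power2_eq_square)
    have aw: "\<bar>?F [a, w]\<bar> \<le> norm L1 * P * B * \<epsilon> ^ 3" "\<bar>?F [w, a]\<bar> \<le> norm L1 * P * B * \<epsilon> ^ 3"
    proof -
      have "norm a * norm w \<le> (\<epsilon> * norm L1) * (P * \<epsilon>\<^sup>2)"
        unfolding na using nw e by (intro mult_left_mono) auto
      then have "B * (norm a * norm w) \<le> B * ((\<epsilon> * norm L1) * (P * \<epsilon>\<^sup>2))"
        using B0 by (rule mult_left_mono)
      also have "\<dots> = norm L1 * P * B * \<epsilon> ^ 3"
        by (simp add: power2_eq_square power3_eq_cube mult_ac)
      finally have *: "B * (norm a * norm w) \<le> norm L1 * P * B * \<epsilon> ^ 3" .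
      show "\<bar>?F [a, w]\<bar> \<le> norm L1 * P * B * \<epsilon> ^ 3" using F2 [of a w] * by linarith
      show "\<bar>?F [w, a]\<bar> \<le> norm L1 * P * B * \<epsilon> ^ 3" using F2 [of w a] * by (simp add: mult.commute)
    qed
    have ww: "\<bar>?F [w, w]\<bar> \<le> P\<^sup>2 * B * \<epsilon> ^ 3"
    proof -
      have "\<bar>?F [w, w]\<bar> \<le> B * (norm w * norm w)" by (rule F2)
      also have "\<dots> \<le> B * ((P * \<epsilon>\<^sup>2) * (P * \<epsilon>\<^sup>2))"
        using nw B0 P by (intro mult_left_mono mult_mono) auto
      also have "\<dots> = (P\<^sup>2 * B) * \<epsilon> ^ 4" by (simp add: power2_eq_square power4_eq_xxxx mult_ac)
      also have "\<dots> \<le> (P\<^sup>2 * B) * \<epsilon> ^ 3" using e43 B0 by (intro mult_left_mono) auto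
      finally show ?thesis .
    qed
    have so: "second_order d h x = ?F [L2] + 1/2 * ?F [L1, L1]"
      by (simp add: second_order_def L1_def L2_def)
    have "h (x \<otimes> lexp G v) - h x - \<epsilon> * ?F [L1] - \<epsilon>\<^sup>2 * second_order d h x =
        (h (x \<otimes> lexp G v) - h x - ?F [v] - 1/2 * ?F [v, v]) + \<epsilon> ^ 3 * ?F [r]
        + 1/2 * (?F [a, w] + ?F [w, a] + ?F [w, w])"
      unfolding so f1 f2 faa by (simp add: algebra_simps)
    also have "\<bar>\<dots>\<bar> \<le> B * (Q * \<epsilon>) ^ 3 + M * B * \<epsilon> ^ 3 + 1/2 * (norm L1 * P * B * \<epsilon> ^ 3 + norm L1 * P * B * \<epsilon> ^ 3 + P\<^sup>2 * B * \<epsilon> ^ 3)"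
    proof -
      have "\<bar>t + r + 1/2 * (a + b + c)\<bar> \<le> T + R + 1/2 * (A + A' + A'')"
        if "\<bar>t\<bar> \<le> T" "\<bar>r\<bar> \<le> R" "\<bar>a\<bar> \<le> A" "\<bar>b\<bar> \<le> A'" "\<bar>c\<bar> \<le> A''" for t r a b c T R A A' A'' :: real
      proof -
        have "\<bar>a + b + c\<bar> \<le> A + A' + A''" using that by linarith
        then have "\<bar>1/2 * (a + b + c)\<bar> \<le> 1/2 * (A + A' + A'')" by simp
        then show ?thesis using that(1,2) by linarith
      qed
      from this [OF t r1 aw ww] show ?thesis .
    qed
    also have "\<dots> \<le> C * B * \<epsilon> ^ 3"
    proof -
      have "0 \<le> P\<^sup>2 * B * \<epsilon> ^ 3" using B0 e by simp
      then show ?thesis by (simp add: C_def algebra_simps power_mult_distrib)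
    qed
    finally show ?thesis by (simp add: v_def)
  qed
  then show ?thesis
    using C unfolding L1_def by (intro exI [of _ C]) auto
qed

lemma smooth_fun_second_order:
  assumes "smooth_fun G h"
  shows "smooth_fun G (second_order d h)"
proof -
  have "smooth_fun G (\<lambda>x. \<Sum>b\<in>UNIV. (if b then 1 else 1/2) * iter_field (if b then [layer_part G 2 d] else [layer_part G 1 d, layer_part G 1 d]) h x)"
    by (intro smooth_fun_sum smooth_fun_iter_field assms)
  then show ?thesis by (simp add: second_order_def [abs_def] UNIV_bool add.commute)
qed

lemma deriv_bound_second_order:
  assumes h: "smooth_fun G h" and B: "deriv_bound (n + 2) B h"
  shows "deriv_bound n ((norm (layer_part G 2 d) + (norm (layer_part G 1 d))\<^sup>2) * B) (second_order d h)"
  unfolding deriv_bound_def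
proof (intro allI impI ballI)
  fix us :: "'l list" and x assume us: "length us \<le> n" and x: "x \<in> carrier G"
  define L1 where "L1 = layer_part G 1 d"
  define L2 where "L2 = layer_part G 2 d"
  have B0: "B \<ge> 0" using B by (rule deriv_bound_nonneg)
  let ?p = "prod_list (map norm us)"
  have p: "0 \<le> ?p" by (intro prod_list_nonneg) auto
  have "iter_field us (second_order d h) x =
      iter_field us (\<lambda>x. \<Sum>b\<in>UNIV. (if b then 1 else 1/2) * iter_field (if b then [L2] else [L1, L1]) h x) x"
    by (rule iter_field_cong [OF _ x]) (simp add: second_order_def L1_def L2_def UNIV_bool)
  also have "\<dots> = iter_field (us @ [L2]) h x + 1/2 * iter_field (us @ [L1, L1]) h x"
    by (subst iter_field_sum_fun [OF _ x]) (auto simp: UNIV_bool smooth_fun_iter_field smooth_fun_left_field h iter_field_append)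
  also have "\<bar>\<dots>\<bar> \<le> \<bar>iter_field (us @ [L2]) h x\<bar> + \<bar>iter_field (us @ [L1, L1]) h x\<bar>"
    by linarith
  also have "\<dots> \<le> B * (?p * norm L2) + B * (?p * (norm L1 * norm L1))"
    using deriv_boundD [OF B _ x, of "us @ [L2]"] deriv_boundD [OF B _ x, of "us @ [L1, L1]"] us
    by (simp add: mult.assoc)
  also have "\<dots> = (norm L2 + (norm L1)\<^sup>2) * B * ?p"
    by (simp add: algebra_simps power2_eq_square)
  finally show "\<bar>iter_field us (second_order d h) x\<bar> \<le> (norm (layer_part G 2 d) + (norm (layer_part G 1 d))\<^sup>2) * B * ?p"
    by (simp add: L1_def L2_def)
qed

lemma decaying_second_order:
  assumes "decaying h"
  shows "decaying (second_order d h)"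
proof -
  have "decaying (\<lambda>x. \<Sum>b\<in>UNIV. (if b then 1 else 1/2) * iter_field (if b then [layer_part G 2 d] else [layer_part G 1 d, layer_part G 1 d]) h x)"
    by (rule decaying_sum) (auto intro: decaying_left_field assms)
  then show ?thesis
    by (simp add: second_order_def [abs_def] UNIV_bool add.commute)
qed

subsection \<open>The coadjoint action of dilated increments\<close>

text \<open>The differential at 0 of x -> Ad(exp(-x))u in the direction w, that is, -[w, u].
  Expanding u in \<open>Basis\<close> makes it linear in u by construction; linearity in w is what
  centering exploits.\<close>

definition coadj_deriv :: "'l \<Rightarrow> 'l \<Rightarrow> 'l" where
  "coadj_deriv w u = (\<Sum>b\<in>Basis. (u \<bullet> b) *\<^sub>R frechet_derivative (\<lambda>x. coadj x b) (at 0) w)"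

lemma linear_coadj_deriv: "linear (\<lambda>w. coadj_deriv w u)"
proof -
  have "linear (frechet_derivative (\<lambda>x. coadj x b) (at 0))" for b
    by (rule linear_frechet_derivative, rule smooth_differentiable, rule smooth_coadj)
  then show ?thesis
    unfolding coadj_deriv_def
    by (intro linear_compose_sum ballI linear_compose_scale_right)
qed

lemma norm_coadj_deriv_le: "\<exists>L\<ge>0. \<forall>u. norm (coadj_deriv w u) \<le> L * norm u"
proof (intro exI [of _ "\<Sum>b\<in>Basis. norm (frechet_derivative (\<lambda>x. coadj x b) (at 0) w)"] conjI allI)
  fix u
  have "norm (coadj_deriv w u) \<le> (\<Sum>b\<in>Basis. norm (frechet_derivative (\<lambda>x. coadj x b) (at 0) w) * norm u)"
    unfolding coadj_deriv_def
    by (rule sum_norm_le) (simp add: mult.commute mult_right_mono Basis_le_norm)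
  then show "norm (coadj_deriv w u) \<le> (\<Sum>b\<in>Basis. norm (frechet_derivative (\<lambda>x. coadj x b) (at 0) w)) * norm u"
    by (simp add: sum_distrib_right)
qed (simp add: sum_nonneg)

lemma smooth_lie_dilation: "smooth (\<lambda>\<epsilon>. lie_dilation \<epsilon> d)"
  unfolding lie_dilation_def by (intro smooth_sum smooth_scaleR smooth_power smooth_const)

text \<open>The derivative of \<epsilon> -> \<open>lie_dilation \<epsilon> d\<close> at 0 is the
  first layer of d, so the first-order term is linear in the horizontal part alone. Treating the
  basis vectors separately gives a constant uniform in u.\<close>

lemma coadj_expansion:
  "\<exists>C\<ge>0. \<forall>\<epsilon> u. 0 \<le> \<epsilon> \<and> \<epsilon> \<le> 1 \<longrightarrow>
    norm (coadj (lie_dilation \<epsilon> d) u - u - \<epsilon> *\<^sub>R coadj_deriv (layer_part G 1 d) u) \<le> C * \<epsilon>\<^sup>2 * norm u"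
proof -
  have z: "lie_dilation 0 d = 0"
    by (auto simp: lie_dilation_def power_0_left intro!: sum.neutral)
  have "\<exists>C\<ge>0. \<forall>\<epsilon>. 0 \<le> \<epsilon> \<and> \<epsilon> \<le> 1 \<longrightarrow>
    norm (coadj (lie_dilation \<epsilon> d) b - b - \<epsilon> *\<^sub>R frechet_derivative (\<lambda>x. coadj x b) (at 0) (layer_part G 1 d)) \<le> C * \<epsilon>\<^sup>2" for b
  proof -
    let ?f = "\<lambda>\<epsilon>. coadj (lie_dilation \<epsilon> d) b"
    have sm: "smooth ?f"
      by (rule smooth_compose [OF smooth_coadj smooth_lie_dilation])
    have "((\<lambda>x. coadj x b) has_derivative frechet_derivative (\<lambda>x. coadj x b) (at 0)) (at (lie_dilation 0 d))"
      unfolding z by (rule smooth_has_derivative [OF smooth_coadj])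
    from has_derivative_compose [OF lie_dilation_has_vector_derivative_0 [of d, unfolded has_vector_derivative_def] this]
    have "(?f has_derivative (\<lambda>r. frechet_derivative (\<lambda>x. coadj x b) (at 0) (r *\<^sub>R layer_part G 1 d))) (at 0)" .
    then have "frechet_derivative ?f (at 0) 1 = frechet_derivative (\<lambda>x. coadj x b) (at 0) (layer_part G 1 d)"
      by (simp flip: frechet_derivative_at)
    then show ?thesis
      using smooth_real_second_order [OF sm] by (simp add: z)
  qed
  then obtain C where C0: "\<And>b. C b \<ge> 0" and C: "\<And>b \<epsilon>. 0 \<le> \<epsilon> \<Longrightarrow> \<epsilon> \<le> 1 \<Longrightarrow>
    norm (coadj (lie_dilation \<epsilon> d) b - b - \<epsilon> *\<^sub>R frechet_derivative (\<lambda>x. coadj x b) (at 0) (layer_part G 1 d)) \<le> C b * \<epsilon>\<^sup>2"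
    by metis
  have "norm (coadj (lie_dilation \<epsilon> d) u - u - \<epsilon> *\<^sub>R coadj_deriv (layer_part G 1 d) u) \<le> (\<Sum>b\<in>Basis. C b) * \<epsilon>\<^sup>2 * norm u"
    if e: "0 \<le> \<epsilon>" "\<epsilon> \<le> 1" for \<epsilon> u
  proof -
    have "coadj (lie_dilation \<epsilon> d) u = (\<Sum>b\<in>Basis. (u \<bullet> b) *\<^sub>R coadj (lie_dilation \<epsilon> d) b)"
      using linear_sum [OF linear_coadj, of "lie_dilation \<epsilon> d" "\<lambda>b. (u \<bullet> b) *\<^sub>R b" Basis]
      by (simp add: euclidean_representation linear_cmul [OF linear_coadj])
    moreover have "u = (\<Sum>b\<in>Basis. (u \<bullet> b) *\<^sub>R b)"
      by (simp add: euclidean_representation)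
    ultimately have "coadj (lie_dilation \<epsilon> d) u - u - \<epsilon> *\<^sub>R coadj_deriv (layer_part G 1 d) u =
        (\<Sum>b\<in>Basis. (u \<bullet> b) *\<^sub>R (coadj (lie_dilation \<epsilon> d) b - b - \<epsilon> *\<^sub>R frechet_derivative (\<lambda>x. coadj x b) (at 0) (layer_part G 1 d)))"
      unfolding coadj_deriv_def
      by (simp add: scaleR_diff_right sum_subtractf scaleR_sum_right mult.commute)
    also have "norm \<dots> \<le> (\<Sum>b\<in>Basis. C b * \<epsilon>\<^sup>2 * norm u)"
    proof (rule sum_norm_le)
      fix b :: 'l assume "b \<in> Basis"
      then have "\<bar>u \<bullet> b\<bar> * norm (coadj (lie_dilation \<epsilon> d) b - b - \<epsilon> *\<^sub>R frechet_derivative (\<lambda>x. coadj x b) (at 0) (layer_part G 1 d))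
          \<le> norm u * (C b * \<epsilon>\<^sup>2)"
        using C [OF e] C0 by (intro mult_mono) (auto simp: Basis_le_norm)
      then show "norm ((u \<bullet> b) *\<^sub>R (coadj (lie_dilation \<epsilon> d) b - b - \<epsilon> *\<^sub>R frechet_derivative (\<lambda>x. coadj x b) (at 0) (layer_part G 1 d))) \<le> C b * \<epsilon>\<^sup>2 * norm u"
        by (simp add: mult_ac)
    qed
    finally show ?thesis by (simp add: sum_distrib_right)
  qed
  moreover have "(\<Sum>b\<in>Basis. C b) \<ge> 0" using C0 by (simp add: sum_nonneg)
  ultimately show ?thesis by blast
qed

lemma coadj_first_order:
  "\<exists>C\<ge>0. \<forall>\<epsilon> u. 0 \<le> \<epsilon> \<and> \<epsilon> \<le> 1 \<longrightarrow> norm (coadj (lie_dilation \<epsilon> d) u - u) \<le> C * \<epsilon> * norm u"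
proof -
  obtain C where C: "C \<ge> 0" "\<And>\<epsilon> u. 0 \<le> \<epsilon> \<Longrightarrow> \<epsilon> \<le> 1 \<Longrightarrow>
    norm (coadj (lie_dilation \<epsilon> d) u - u - \<epsilon> *\<^sub>R coadj_deriv (layer_part G 1 d) u) \<le> C * \<epsilon>\<^sup>2 * norm u"
    using coadj_expansion by metis
  obtain L where L: "L \<ge> 0" "\<And>u. norm (coadj_deriv (layer_part G 1 d) u) \<le> L * norm u"
    using norm_coadj_deriv_le by metis
  have "norm (coadj (lie_dilation \<epsilon> d) u - u) \<le> (C + L) * \<epsilon> * norm u" if e: "0 \<le> \<epsilon>" "\<epsilon> \<le> 1" for \<epsilon> u
  proof -
    have "norm (coadj (lie_dilation \<epsilon> d) u - u) \<le> C * \<epsilon>\<^sup>2 * norm u + norm (\<epsilon> *\<^sub>R coadj_deriv (layer_part G 1 d) u)"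
      using norm_triangle_sub [of "coadj (lie_dilation \<epsilon> d) u - u" "\<epsilon> *\<^sub>R coadj_deriv (layer_part G 1 d) u"] C(2) [OF e, of u]
      by linarith
    also have "norm (\<epsilon> *\<^sub>R coadj_deriv (layer_part G 1 d) u) \<le> \<epsilon> * (L * norm u)"
      using L(2) [of u] e by (simp add: mult_left_mono)
    also have "C * \<epsilon>\<^sup>2 * norm u \<le> C * \<epsilon> * norm u"
      using C(1) e power_decreasing [of 1 2 \<epsilon>] by (intro mult_right_mono mult_left_mono) auto
    finally show ?thesis by (simp add: algebra_simps)
  qed
  then show ?thesis using C L by (intro exI [of _ "C + L"]) auto
qed

end

section \<open>Averaged random walks on the group\<close>

text \<open>Squared norms are polynomial, so the change under a small linear map has an exact
  first-order term free of absolute values, which can cancel on averaging.\<close>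

definition sum_sq :: "'a::real_normed_vector list \<Rightarrow> real" where
  "sum_sq us = sum_list (map (\<lambda>u. (norm u)\<^sup>2) us)"

lemma sum_sq_simps [simp]: "sum_sq [] = 0" "sum_sq (u # us) = (norm u)\<^sup>2 + sum_sq us"
  by (simp_all add: sum_sq_def)

lemma sum_sq_nonneg: "0 \<le> sum_sq us"
  by (auto simp: sum_sq_def intro!: sum_list_nonneg)

text \<open>Each norm is at most a = sqrt(\<open>sum_sq us\<close>), so the product is at most a
  power of a with exponent at most 4; the summand 1 covers the case a \<le> 1.\<close>

lemma prod_list_norm_le:
  assumes "length us \<le> 4"
  shows "prod_list (map norm us) \<le> 1 + (sum_sq us)\<^sup>2"
proof -
  define a where "a = sqrt (sum_sq us)"
  have a: "a \<ge> 0" by (simp add: a_def sum_sq_nonneg)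
  have "(norm u)\<^sup>2 \<le> sum_sq us" if "u \<in> set us" for u
    using that by (induction us) (auto simp: sum_sq_nonneg add_increasing add_increasing2)
  then have "norm u \<le> a" if "u \<in> set us" for u
    using that unfolding a_def by (simp add: real_le_rsqrt)
  then have "prod_list (map norm us) \<le> a ^ length us"
    using a by (induction us) (auto intro!: mult_mono prod_list_nonneg)
  also have "\<dots> \<le> 1 + a ^ 4"
  proof (cases "a \<le> 1")
    case True
    then have "a ^ length us \<le> 1" using a by (intro power_le_one)
    then show ?thesis using a zero_le_power [OF a, of 4] by linarith
  next
    case False
    then have "a ^ length us \<le> a ^ 4" using assms by (intro power_increasing) auto
    then show ?thesis by simp
  qed
  also have "a ^ 4 = (sum_sq us)\<^sup>2"
    using real_sqrt_pow2 [OF sum_sq_nonneg, of us] power_mult [of a 2 2] by (simp add: a_def)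
  finally show ?thesis .
qed

context stratified_lie_group
begin

text \<open>The term of order \<epsilon> is kept with its sign and is linear in the first layer of
  d; the rest is absorbed in a multiple of \<epsilon>^2 \<open>(sum_sq us)\<^sup>2\<close>. Only
  this separation survives averaging with a bounded growth rate.\<close>

lemma sum_sq_coadj_expansion:
  "\<exists>C\<ge>0. \<forall>\<epsilon> us. 0 \<le> \<epsilon> \<and> \<epsilon> \<le> 1 \<longrightarrow>
    (sum_sq (map (coadj (lie_dilation \<epsilon> d)) us))\<^sup>2 \<le>
    (sum_sq us)\<^sup>2 + 4 * \<epsilon> * sum_sq us * (\<Sum>u\<leftarrow>us. u \<bullet> coadj_deriv (layer_part G 1 d) u) + C * \<epsilon>\<^sup>2 * (sum_sq us)\<^sup>2"
proof -
  let ?B = "\<lambda>\<epsilon>. coadj (lie_dilation \<epsilon> d)" and ?\<Lambda> = "coadj_deriv (layer_part G 1 d)"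
  obtain C0 where C0: "C0 \<ge> 0" "\<And>\<epsilon> u. 0 \<le> \<epsilon> \<Longrightarrow> \<epsilon> \<le> 1 \<Longrightarrow> norm (?B \<epsilon> u - u) \<le> C0 * \<epsilon> * norm u"
    using coadj_first_order by metis
  obtain C2 where C2: "C2 \<ge> 0" "\<And>\<epsilon> u. 0 \<le> \<epsilon> \<Longrightarrow> \<epsilon> \<le> 1 \<Longrightarrow> norm (?B \<epsilon> u - u - \<epsilon> *\<^sub>R ?\<Lambda> u) \<le> C2 * \<epsilon>\<^sup>2 * norm u"
    using coadj_expansion by metis
  obtain L where L: "L \<ge> 0" "\<And>u. norm (?\<Lambda> u) \<le> L * norm u"
    using norm_coadj_deriv_le by metis
  define C1 where "C1 = 2 * C2 + C0\<^sup>2"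
  have C1: "C1 \<ge> 0" using C2 by (simp add: C1_def)
  define l where "l us = (\<Sum>u\<leftarrow>us. u \<bullet> ?\<Lambda> u)" for us
  have single: "\<bar>(norm (?B \<epsilon> u))\<^sup>2 - (norm u)\<^sup>2 - 2 * \<epsilon> * (u \<bullet> ?\<Lambda> u)\<bar> \<le> C1 * \<epsilon>\<^sup>2 * (norm u)\<^sup>2"
    if e: "0 \<le> \<epsilon>" "\<epsilon> \<le> 1" for \<epsilon> u
  proof -
    define x where "x = ?B \<epsilon> u - u"
    have "?B \<epsilon> u = u + x" by (simp add: x_def)
    then have "(norm (?B \<epsilon> u))\<^sup>2 = (norm u)\<^sup>2 + 2 * (u \<bullet> x) + (norm x)\<^sup>2"
      by (simp add: power2_norm_eq_inner inner_add_left inner_add_right inner_commute)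
    then have eq: "(norm (?B \<epsilon> u))\<^sup>2 - (norm u)\<^sup>2 - 2 * \<epsilon> * (u \<bullet> ?\<Lambda> u) = 2 * (u \<bullet> (x - \<epsilon> *\<^sub>R ?\<Lambda> u)) + (norm x)\<^sup>2"
      by (simp add: inner_diff_right algebra_simps)
    have "\<bar>u \<bullet> (x - \<epsilon> *\<^sub>R ?\<Lambda> u)\<bar> \<le> norm u * (C2 * \<epsilon>\<^sup>2 * norm u)"
      using Cauchy_Schwarz_ineq2 [of u "x - \<epsilon> *\<^sub>R ?\<Lambda> u"] C2(2) [OF e, of u] unfolding x_def
      by (meson mult_left_mono norm_ge_zero order_trans)
    moreover have "(norm x)\<^sup>2 \<le> (C0 * \<epsilon> * norm u)\<^sup>2"
      unfolding x_def using C0(2) [OF e] by (intro power_mono) auto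
    ultimately have "\<bar>2 * (u \<bullet> (x - \<epsilon> *\<^sub>R ?\<Lambda> u)) + (norm x)\<^sup>2\<bar> \<le> 2 * (norm u * (C2 * \<epsilon>\<^sup>2 * norm u)) + (C0 * \<epsilon> * norm u)\<^sup>2"
      using zero_le_power2 [of "norm x"] by linarith
    also have "\<dots> = C1 * \<epsilon>\<^sup>2 * (norm u)\<^sup>2"
      by (simp add: C1_def power2_eq_square algebra_simps)
    finally show ?thesis unfolding eq .
  qed
  have list: "\<bar>sum_sq (map (?B \<epsilon>) us) - sum_sq us - 2 * \<epsilon> * l us\<bar> \<le> C1 * \<epsilon>\<^sup>2 * sum_sq us"
    if e: "0 \<le> \<epsilon>" "\<epsilon> \<le> 1" for \<epsilon> us
  proof (induction us)
    case (Cons u us)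
    have "sum_sq (map (?B \<epsilon>) (u # us)) - sum_sq (u # us) - 2 * \<epsilon> * l (u # us) =
      ((norm (?B \<epsilon> u))\<^sup>2 - (norm u)\<^sup>2 - 2 * \<epsilon> * (u \<bullet> ?\<Lambda> u)) + (sum_sq (map (?B \<epsilon>) us) - sum_sq us - 2 * \<epsilon> * l us)"
      by (simp add: l_def algebra_simps)
    also have "\<bar>\<dots>\<bar> \<le> C1 * \<epsilon>\<^sup>2 * (norm u)\<^sup>2 + C1 * \<epsilon>\<^sup>2 * sum_sq us"
      using single [OF e, of u] Cons by linarith
    finally show ?case by (simp add: distrib_left)
  qed (simp add: l_def)
  have lL: "\<bar>l us\<bar> \<le> L * sum_sq us" for us
  proof (induction us)
    case (Cons u us)
    have "\<bar>u \<bullet> ?\<Lambda> u\<bar> \<le> norm u * (L * norm u)"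
      using Cauchy_Schwarz_ineq2 [of u "?\<Lambda> u"] L(2) [of u] by (meson mult_left_mono norm_ge_zero order_trans)
    then have "\<bar>u \<bullet> ?\<Lambda> u\<bar> \<le> L * (norm u)\<^sup>2" by (simp add: power2_eq_square mult_ac)
    moreover have "l (u # us) = u \<bullet> ?\<Lambda> u + l us" by (simp add: l_def)
    ultimately show ?case using Cons by (simp add: distrib_left)
  qed (simp add: l_def)
  \<comment> \<open>Writing the new sum of squares as S + (2 \<epsilon> l + R), the summand 2 C1
    comes from the cross term 2SR and the square from (2 \<epsilon> l + R)^2, with R of size C1
    \<epsilon>^2 S and \<epsilon>^2 \<le> \<epsilon>.\<close>
  define C where "C = 2 * C1 + (2 * L + C1)\<^sup>2"
  have C: "C \<ge> 0" using C1 by (simp add: C_def)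
  have "(sum_sq (map (?B \<epsilon>) us))\<^sup>2 \<le> (sum_sq us)\<^sup>2 + 4 * \<epsilon> * sum_sq us * l us + C * \<epsilon>\<^sup>2 * (sum_sq us)\<^sup>2"
    if e: "0 \<le> \<epsilon>" "\<epsilon> \<le> 1" for \<epsilon> us
  proof -
    define S where "S = sum_sq us"
    define R where "R = sum_sq (map (?B \<epsilon>) us) - sum_sq us - 2 * \<epsilon> * l us"
    have S: "S \<ge> 0" by (simp add: S_def sum_sq_nonneg)
    have R: "\<bar>R\<bar> \<le> C1 * \<epsilon>\<^sup>2 * S" using list [OF e] by (simp add: R_def S_def)
    have "\<epsilon>\<^sup>2 \<le> \<epsilon>" using e power_decreasing [of 1 2 \<epsilon>] by simp
    then have "C1 * \<epsilon>\<^sup>2 * S \<le> C1 * \<epsilon> * S" using C1 S by (intro mult_right_mono mult_left_mono)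
    moreover have "\<bar>2 * \<epsilon> * l us\<bar> \<le> 2 * \<epsilon> * (L * S)"
      using lL [of us] e by (simp add: S_def abs_mult mult_left_mono)
    ultimately have "\<bar>2 * \<epsilon> * l us + R\<bar> \<le> (2 * L + C1) * \<epsilon> * S"
      using R by (simp add: algebra_simps)
    then have "\<bar>2 * \<epsilon> * l us + R\<bar>\<^sup>2 \<le> ((2 * L + C1) * \<epsilon> * S)\<^sup>2"
      by (intro power_mono) auto
    then have sq: "(2 * \<epsilon> * l us + R)\<^sup>2 \<le> (2 * L + C1)\<^sup>2 * \<epsilon>\<^sup>2 * S\<^sup>2"
      by (simp add: power_mult_distrib)
    have SR: "S * R \<le> S * (C1 * \<epsilon>\<^sup>2 * S)"
      using R S by (intro mult_left_mono) auto
    have "(sum_sq (map (?B \<epsilon>) us))\<^sup>2 = (S + (2 * \<epsilon> * l us + R))\<^sup>2"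
      by (simp add: R_def S_def)
    also have "\<dots> = S\<^sup>2 + 4 * \<epsilon> * S * l us + 2 * (S * R) + (2 * \<epsilon> * l us + R)\<^sup>2"
      by (simp add: power2_eq_square algebra_simps)
    also have "\<dots> \<le> S\<^sup>2 + 4 * \<epsilon> * S * l us + 2 * (S * (C1 * \<epsilon>\<^sup>2 * S)) + (2 * L + C1)\<^sup>2 * \<epsilon>\<^sup>2 * S\<^sup>2"
      using SR sq by linarith
    also have "\<dots> = S\<^sup>2 + 4 * \<epsilon> * S * l us + C * \<epsilon>\<^sup>2 * S\<^sup>2"
      by (simp add: C_def power2_eq_square algebra_simps)
    finally show ?thesis by (simp add: S_def)
  qed
  then show ?thesis using C unfolding l_def by blast
qed

lemma deriv_bound_iter_field:
  assumes "deriv_bound (n + length us) B h"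
  shows "deriv_bound n (B * prod_list (map norm us)) (iter_field us h)"
  unfolding deriv_bound_def
proof (intro allI impI ballI)
  fix vs :: "'l list" and x assume "length vs \<le> n" "x \<in> carrier G"
  then show "\<bar>iter_field vs (iter_field us h) x\<bar> \<le> B * prod_list (map norm us) * prod_list (map norm vs)"
    using deriv_boundD [OF assms, of "vs @ us" x] by (simp add: iter_field_append mult_ac)
qed

text \<open>Two effects of size \<epsilon> add up: the vectors are conjugated by a matrix close to
  the identity (K), and the base point moves (M). The latter costs one more derivative, hence order
  three for words of length two.\<close>

lemma left_fields_translate_bound:
  "\<exists>C\<ge>0. \<forall>\<epsilon> B h u v x. 0 \<le> \<epsilon> \<and> \<epsilon> \<le> 1 \<and> smooth_fun G h \<and> deriv_bound 3 B h \<and> x \<in> carrier G \<longrightarrow>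
    \<bar>iter_field [u] (\<lambda>g. h (g \<otimes> lexp G (lie_dilation \<epsilon> d))) x - iter_field [u] h x\<bar> \<le> C * B * \<epsilon> * norm u \<and>
    \<bar>iter_field [u, v] (\<lambda>g. h (g \<otimes> lexp G (lie_dilation \<epsilon> d))) x - iter_field [u, v] h x\<bar> \<le> C * B * \<epsilon> * (norm u * norm v)"
proof -
  obtain M where M: "M \<ge> 0" "\<And>\<epsilon>. 0 \<le> \<epsilon> \<Longrightarrow> \<epsilon> \<le> 1 \<Longrightarrow> norm (lie_dilation \<epsilon> d) \<le> M * \<epsilon>"
    using norm_lie_dilation_le by metis
  obtain K where K: "K \<ge> 0" "\<And>\<epsilon> u. 0 \<le> \<epsilon> \<Longrightarrow> \<epsilon> \<le> 1 \<Longrightarrow> norm (coadj (lie_dilation \<epsilon> d) u - u) \<le> K * \<epsilon> * norm u"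
    using coadj_first_order by metis
  define C where "C = M + K + K * (1 + K)"
  have C: "C \<ge> 0" using M K by (simp add: C_def)
  have main: "\<bar>iter_field [u] (\<lambda>g. h (g \<otimes> lexp G (lie_dilation \<epsilon> d))) x - iter_field [u] h x\<bar> \<le> C * B * \<epsilon> * norm u \<and>
    \<bar>iter_field [u, v] (\<lambda>g. h (g \<otimes> lexp G (lie_dilation \<epsilon> d))) x - iter_field [u, v] h x\<bar> \<le> C * B * \<epsilon> * (norm u * norm v)"
    if e: "0 \<le> \<epsilon>" "\<epsilon> \<le> 1" and h: "smooth_fun G h" and B: "deriv_bound 3 B h" and x: "x \<in> carrier G" for \<epsilon> B h u v x
  proof -
    define y where "y = lexp G (lie_dilation \<epsilon> d)"
    define A where "A = coadj (lie_dilation \<epsilon> d)"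
    have y: "y \<in> carrier G" "llog G y = lie_dilation \<epsilon> d" and xy: "x \<otimes> y \<in> carrier G"
      using x by (simp_all add: y_def)
    have B0: "B \<ge> 0" using B by (rule deriv_bound_nonneg)
    have Ad: "norm (A w - w) \<le> K * \<epsilon> * norm w" for w unfolding A_def by (rule K(2) [OF e])
    have A: "norm (A w) \<le> (1 + K) * norm w" for w
    proof -
      have "norm (A w) \<le> norm w + norm (A w - w)" using norm_triangle_sub [of "A w" w] by simp
      also have "\<dots> \<le> norm w + K * 1 * norm w"
        using Ad [of w] e K by (meson add_left_mono mult_left_mono mult_right_mono norm_ge_zero order_trans)
      finally show ?thesis by (simp add: distrib_right)
    qed
    have base: "\<bar>iter_field us h (x \<otimes> y) - iter_field us h x\<bar> \<le> B * prod_list (map norm us) * (M * \<epsilon>)" if "length us \<le> 2" for us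
    proof -
      have "deriv_bound 1 (B * prod_list (map norm us)) (iter_field us h)"
        using that by (intro deriv_bound_iter_field deriv_bound_mono [OF B]) simp
      from taylor_order_1 [OF smooth_fun_iter_field [OF h] this x]
      have "\<bar>iter_field us h (x \<otimes> y) - iter_field us h x\<bar> \<le> B * prod_list (map norm us) * norm (lie_dilation \<epsilon> d)"
        unfolding y_def .
      also have "\<dots> \<le> B * prod_list (map norm us) * (M * \<epsilon>)"
        using M(2) [OF e] B0 by (intro mult_left_mono mult_nonneg_nonneg prod_list_nonneg) auto
      finally show ?thesis .
    qed
    have tr: "iter_field us (\<lambda>g. h (g \<otimes> y)) x = iter_field (map A us) h (x \<otimes> y)" for us
      using iter_field_translate [OF h y(1) x] by (simp add: A_def y(2))
    have "iter_field [u] (\<lambda>g. h (g \<otimes> y)) x - iter_field [u] h x =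
        iter_field [A u - u] h (x \<otimes> y) + (iter_field [u] h (x \<otimes> y) - iter_field [u] h x)"
      using iter_field_diff [OF h xy, of "[]" "A u" u "[]"] by (simp add: tr [of "[u]", simplified])
    also have "\<bar>\<dots>\<bar> \<le> B * (K * \<epsilon> * norm u) + B * norm u * (M * \<epsilon>)"
    proof -
      have "\<bar>iter_field [A u - u] h (x \<otimes> y)\<bar> \<le> B * norm (A u - u)"
        using deriv_boundD [OF B _ xy, of "[A u - u]"] by simp
      also have "\<dots> \<le> B * (K * \<epsilon> * norm u)" using Ad B0 by (intro mult_left_mono) auto
      finally show ?thesis using base [of "[u]"] by (simp del: iter_field_Cons)
    qed
    also have "\<dots> = (M + K) * B * \<epsilon> * norm u" by (simp add: algebra_simps)
    also have "\<dots> \<le> C * B * \<epsilon> * norm u"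
      using K B0 e by (intro mult_right_mono) (auto simp: C_def)
    finally have 1: "\<bar>iter_field [u] (\<lambda>g. h (g \<otimes> y)) x - iter_field [u] h x\<bar> \<le> C * B * \<epsilon> * norm u" .
    have "iter_field [u, v] (\<lambda>g. h (g \<otimes> y)) x - iter_field [u, v] h x =
        iter_field [A u - u, A v] h (x \<otimes> y) + iter_field [u, A v - v] h (x \<otimes> y) +
        (iter_field [u, v] h (x \<otimes> y) - iter_field [u, v] h x)"
      using iter_field_diff [OF h xy, of "[]" "A u" u "[A v]"] iter_field_diff [OF h xy, of "[u]" "A v" v "[]"]
      by (simp add: tr [of "[u, v]", simplified])
    also have "\<bar>\<dots>\<bar> \<le> B * ((K * \<epsilon> * norm u) * ((1 + K) * norm v)) + B * (norm u * (K * \<epsilon> * norm v)) + B * (norm u * norm v) * (M * \<epsilon>)"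
    proof -
      have "\<bar>iter_field [A u - u, A v] h (x \<otimes> y)\<bar> \<le> B * (norm (A u - u) * norm (A v))"
        using deriv_boundD [OF B _ xy, of "[A u - u, A v]"] by simp
      also have "\<dots> \<le> B * ((K * \<epsilon> * norm u) * ((1 + K) * norm v))"
        using Ad A B0 K e by (intro mult_left_mono mult_mono) auto
      finally have a: "\<bar>iter_field [A u - u, A v] h (x \<otimes> y)\<bar> \<le> B * ((K * \<epsilon> * norm u) * ((1 + K) * norm v))" .
      have "\<bar>iter_field [u, A v - v] h (x \<otimes> y)\<bar> \<le> B * (norm u * norm (A v - v))"
        using deriv_boundD [OF B _ xy, of "[u, A v - v]"] by simp
      also have "\<dots> \<le> B * (norm u * (K * \<epsilon> * norm v))"
        using Ad B0 by (intro mult_left_mono) auto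
      finally have b: "\<bar>iter_field [u, A v - v] h (x \<otimes> y)\<bar> \<le> B * (norm u * (K * \<epsilon> * norm v))" .
      have c: "\<bar>iter_field [u, v] h (x \<otimes> y) - iter_field [u, v] h x\<bar> \<le> B * (norm u * norm v) * (M * \<epsilon>)"
        using base [of "[u, v]"] by simp
      have "\<bar>p + q + r\<bar> \<le> P + Q + R" if "\<bar>p\<bar> \<le> P" "\<bar>q\<bar> \<le> Q" "\<bar>r\<bar> \<le> R" for p q r P Q R :: real
        using that by linarith
      from this [OF a b c] show ?thesis .
    qed
    also have "\<dots> = C * B * \<epsilon> * (norm u * norm v)" by (simp add: C_def algebra_simps)
    finally show ?thesis using 1 by (simp only: y_def)
  qed
  show ?thesis
    by (intro exI [of _ C] conjI C allI impI) (use main in blast)+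
qed

end

text \<open>Independent increments from a finite set with horizontal mean zero. It is applied to the
  arcs of the quotient graph, weighted by \<open>edge_measure\<close>.\<close>

locale centered_steps = stratified_lie_group G
  for G :: "('g, 'l::euclidean_space, 'm) stratified_group_scheme" (structure) +
  fixes E :: "'i set" and \<mu> :: "'i \<Rightarrow> real" and d :: "'i \<Rightarrow> 'l"
  assumes finite_E: "finite E"
    and \<mu>_nonneg: "e \<in> E \<Longrightarrow> 0 \<le> \<mu> e"
    and sum_\<mu>: "(\<Sum>e\<in>E. \<mu> e) = 1"
    and centered: "(\<Sum>e\<in>E. \<mu> e *\<^sub>R layer_part G 1 (d e)) = 0"
begin

definition average :: "real \<Rightarrow> ('g \<Rightarrow> real) \<Rightarrow> 'g \<Rightarrow> real" where
  "average \<epsilon> h x = (\<Sum>e\<in>E. \<mu> e * h (x \<otimes> lexp G (lie_dilation \<epsilon> (d e))))"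

text \<open>The basis-free form of the generator; \<open>generator_A_eq\<close> identifies it with
  the coordinate expression.\<close>

definition limit_generator :: "('g \<Rightarrow> real) \<Rightarrow> 'g \<Rightarrow> real" where
  "limit_generator h x = (\<Sum>e\<in>E. \<mu> e * second_order (d e) h x)"

lemma decaying_average: "decaying h \<Longrightarrow> decaying (average \<epsilon> h)"
  unfolding average_def [abs_def] by (intro decaying_sum decaying_translate) auto

lemma decaying_average_power: "decaying h \<Longrightarrow> decaying ((average \<epsilon> ^^ k) h)"
  by (induction k) (auto intro: decaying_average)

lemma decaying_limit_generator: "decaying h \<Longrightarrow> decaying (limit_generator h)"
  unfolding limit_generator_def [abs_def] by (intro decaying_sum decaying_second_order)

lemma iter_field_average:
  assumes h: "smooth_fun G h" and x: "x \<in> carrier G"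
  shows "iter_field us (average \<epsilon> h) x =
    (\<Sum>e\<in>E. \<mu> e * iter_field us (\<lambda>g. h (g \<otimes> lexp G (lie_dilation \<epsilon> (d e)))) x)"
  unfolding average_def [abs_def]
  by (rule iter_field_sum_fun [OF _ x]) (simp add: smooth_fun_translate h)

lemma abs_sum_\<mu>_le:
  assumes "\<And>e. e \<in> E \<Longrightarrow> \<bar>f e\<bar> \<le> g e"
  shows "\<bar>\<Sum>e\<in>E. \<mu> e * f e\<bar> \<le> (\<Sum>e\<in>E. \<mu> e * g e)"
proof -
  have "\<bar>\<Sum>e\<in>E. \<mu> e * f e\<bar> \<le> (\<Sum>e\<in>E. \<bar>\<mu> e * f e\<bar>)" by (rule sum_abs)
  also have "\<dots> \<le> (\<Sum>e\<in>E. \<mu> e * g e)"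
    using assms \<mu>_nonneg by (intro sum_mono) (auto simp: abs_mult intro: mult_left_mono)
  finally show ?thesis .
qed

lemma sum_\<mu>_const: "(\<Sum>e\<in>E. \<mu> e * c) = c"
  using sum_\<mu> by (simp flip: sum_distrib_right)

text \<open>In the mean, the terms of order \<epsilon> combine into \<open>coadj_deriv\<close> in
  the direction of the mean horizontal increment, which is 0. The growth factor per step is
  therefore 1 + C \<epsilon>^2, harmless over about \<epsilon>^(-2) steps.\<close>

lemma moment_step:
  "\<exists>C\<ge>0. \<forall>\<epsilon> us. 0 \<le> \<epsilon> \<and> \<epsilon> \<le> 1 \<longrightarrow>
    (\<Sum>e\<in>E. \<mu> e * (sum_sq (map (coadj (lie_dilation \<epsilon> (d e))) us))\<^sup>2) \<le> (1 + C * \<epsilon>\<^sup>2) * (sum_sq us)\<^sup>2"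
proof -
  have "\<exists>C. \<forall>e. C e \<ge> 0 \<and> (\<forall>\<epsilon> us. 0 \<le> \<epsilon> \<and> \<epsilon> \<le> 1 \<longrightarrow>
    (sum_sq (map (coadj (lie_dilation \<epsilon> (d e))) us))\<^sup>2 \<le>
    (sum_sq us)\<^sup>2 + 4 * \<epsilon> * sum_sq us * (\<Sum>u\<leftarrow>us. u \<bullet> coadj_deriv (layer_part G 1 (d e)) u) + C e * \<epsilon>\<^sup>2 * (sum_sq us)\<^sup>2)"
    using sum_sq_coadj_expansion by (intro choice) blast
  then obtain C where C0: "\<And>e. C e \<ge> 0" and C: "\<And>e \<epsilon> us. 0 \<le> \<epsilon> \<Longrightarrow> \<epsilon> \<le> 1 \<Longrightarrow>
    (sum_sq (map (coadj (lie_dilation \<epsilon> (d e))) us))\<^sup>2 \<le>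
    (sum_sq us)\<^sup>2 + 4 * \<epsilon> * sum_sq us * (\<Sum>u\<leftarrow>us. u \<bullet> coadj_deriv (layer_part G 1 (d e)) u) + C e * \<epsilon>\<^sup>2 * (sum_sq us)\<^sup>2"
    by blast
  have cen: "(\<Sum>e\<in>E. \<mu> e * (\<Sum>u\<leftarrow>us. u \<bullet> coadj_deriv (layer_part G 1 (d e)) u)) = 0" for us
  proof (induction us)
    case (Cons u us)
    have "(\<Sum>e\<in>E. \<mu> e * (u \<bullet> coadj_deriv (layer_part G 1 (d e)) u)) =
        u \<bullet> coadj_deriv (\<Sum>e\<in>E. \<mu> e *\<^sub>R layer_part G 1 (d e)) u"
      by (simp add: linear_sum [OF linear_coadj_deriv] linear_cmul [OF linear_coadj_deriv] inner_sum_right)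
    then have "(\<Sum>e\<in>E. \<mu> e * (u \<bullet> coadj_deriv (layer_part G 1 (d e)) u)) = 0"
      by (simp add: centered linear_0 [OF linear_coadj_deriv])
    then show ?case using Cons by (simp add: distrib_left sum.distrib)
  qed simp
  have "(\<Sum>e\<in>E. \<mu> e * (sum_sq (map (coadj (lie_dilation \<epsilon> (d e))) us))\<^sup>2) \<le> (1 + (\<Sum>e\<in>E. \<mu> e * C e) * \<epsilon>\<^sup>2) * (sum_sq us)\<^sup>2"
    if e: "0 \<le> \<epsilon>" "\<epsilon> \<le> 1" for \<epsilon> us
  proof -
    let ?l = "\<lambda>e. (\<Sum>u\<leftarrow>us. u \<bullet> coadj_deriv (layer_part G 1 (d e)) u)"
    have "(\<Sum>e\<in>E. \<mu> e * (sum_sq (map (coadj (lie_dilation \<epsilon> (d e))) us))\<^sup>2) \<le>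
        (\<Sum>e\<in>E. \<mu> e * ((sum_sq us)\<^sup>2 + 4 * \<epsilon> * sum_sq us * ?l e + C e * \<epsilon>\<^sup>2 * (sum_sq us)\<^sup>2))"
      using C [OF e] \<mu>_nonneg by (intro sum_mono mult_left_mono) auto
    also have "\<dots> = (\<Sum>e\<in>E. \<mu> e * (sum_sq us)\<^sup>2) + 4 * \<epsilon> * sum_sq us * (\<Sum>e\<in>E. \<mu> e * ?l e)
        + (\<Sum>e\<in>E. \<mu> e * C e) * \<epsilon>\<^sup>2 * (sum_sq us)\<^sup>2"
      by (simp add: distrib_left sum.distrib sum_distrib_left sum_distrib_right mult_ac)
    also have "\<dots> = (1 + (\<Sum>e\<in>E. \<mu> e * C e) * \<epsilon>\<^sup>2) * (sum_sq us)\<^sup>2"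
      by (simp add: cen sum_\<mu>_const distrib_right)
    finally show ?thesis .
  qed
  moreover have "(\<Sum>e\<in>E. \<mu> e * C e) \<ge> 0" using C0 \<mu>_nonneg by (simp add: sum_nonneg)
  ultimately show ?thesis by blast
qed

text \<open>Derivatives of the iterates involve products of the matrices \<^term>\<open>coadj\<close> along the path;
  their fourth moments grow at most like \<open>(1 + C\<epsilon>\<^sup>2)\<^sup>k\<close> because the increments are centered.\<close>

lemma average_power_deriv_bound:
  "\<exists>C\<ge>0. \<forall>\<epsilon> B f k. 0 \<le> \<epsilon> \<and> \<epsilon> \<le> 1 \<and> decaying f \<and> deriv_bound 4 B f \<longrightarrow>
    deriv_bound 4 (17 * B * (1 + C * \<epsilon>\<^sup>2) ^ k) ((average \<epsilon> ^^ k) f)"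
proof -
  obtain C where C0: "C \<ge> 0" and C: "\<And>\<epsilon> us. 0 \<le> \<epsilon> \<Longrightarrow> \<epsilon> \<le> 1 \<Longrightarrow>
    (\<Sum>e\<in>E. \<mu> e * (sum_sq (map (coadj (lie_dilation \<epsilon> (d e))) us))\<^sup>2) \<le> (1 + C * \<epsilon>\<^sup>2) * (sum_sq us)\<^sup>2"
    using moment_step by blast
  have "deriv_bound 4 (17 * B * (1 + C * \<epsilon>\<^sup>2) ^ k) ((average \<epsilon> ^^ k) f)"
    if e: "0 \<le> \<epsilon>" "\<epsilon> \<le> 1" and f: "decaying f" and B: "deriv_bound 4 B f" for \<epsilon> B f k
  proof -
    have B0: "B \<ge> 0" using B by (rule deriv_bound_nonneg)
    define c where "c = 1 + C * \<epsilon>\<^sup>2"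
    have c: "c \<ge> 1" using C0 by (simp add: c_def)
    \<comment> \<open>A step replaces the word by conjugated words, so the induction needs a
      quantity that \<open>moment_step\<close> controls; the product of norms is not one, while 1 +
      \<open>(sum_sq us)\<^sup>2\<close> is.\<close>
    have growth: "\<bar>iter_field us ((average \<epsilon> ^^ k) f) x\<bar> \<le> B * c ^ k * (1 + (sum_sq us)\<^sup>2)"
      if "length us \<le> 4" "x \<in> carrier G" for us x k
      using that
    proof (induction k arbitrary: us x)
      case 0
      have "\<bar>iter_field us f x\<bar> \<le> B * prod_list (map norm us)" by (rule deriv_boundD [OF B 0])
      also have "\<dots> \<le> B * (1 + (sum_sq us)\<^sup>2)"
        using B0 prod_list_norm_le [OF 0(1)] by (rule mult_left_mono [rotated])
      finally show ?case by simp
    next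
      case (Suc k)
      let ?h = "(average \<epsilon> ^^ k) f" and ?A = "\<lambda>e. coadj (lie_dilation \<epsilon> (d e))"
      have h: "smooth_fun G ?h" by (rule decaying_smooth_fun [OF decaying_average_power [OF f]])
      have "\<bar>iter_field us ((average \<epsilon> ^^ Suc k) f) x\<bar> =
          \<bar>\<Sum>e\<in>E. \<mu> e * iter_field (map (?A e) us) ?h (x \<otimes> lexp G (lie_dilation \<epsilon> (d e)))\<bar>"
        using Suc.prems by (simp add: iter_field_average [OF h] iter_field_translate [OF h])
      also have "\<dots> \<le> (\<Sum>e\<in>E. \<mu> e * (B * c ^ k * (1 + (sum_sq (map (?A e) us))\<^sup>2)))"
        by (rule abs_sum_\<mu>_le, rule Suc.IH) (use Suc.prems in auto)
      also have "\<dots> = B * c ^ k * (\<Sum>e\<in>E. \<mu> e * (1 + (sum_sq (map (?A e) us))\<^sup>2))"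
        by (simp add: sum_distrib_left mult_ac)
      also have "\<dots> = B * c ^ k * (1 + (\<Sum>e\<in>E. \<mu> e * (sum_sq (map (?A e) us))\<^sup>2))"
        by (simp add: distrib_left sum.distrib sum_\<mu>)
      also have "\<dots> \<le> B * c ^ k * (c * (1 + (sum_sq us)\<^sup>2))"
      proof (intro mult_left_mono)
        show "1 + (\<Sum>e\<in>E. \<mu> e * (sum_sq (map (?A e) us))\<^sup>2) \<le> c * (1 + (sum_sq us)\<^sup>2)"
          using C [OF e, of us] c by (simp add: c_def distrib_left)
      qed (use B0 c in simp)
      finally show ?case by (simp add: mult_ac)
    qed
    show ?thesis
      unfolding deriv_bound_def
    proof (intro allI impI ballI)
      fix us :: "'l list" and x assume us: "length us \<le> 4" and x: "x \<in> carrier G"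
      let ?h = "(average \<epsilon> ^^ k) f"
      \<comment> \<open>The growth bound is not multilinear, so it is used on normalized vectors and
        rescaled. At most four vectors of norm at most 1 give 1 + 4^2 = 17; zero vectors stay zero
        under the normalization.\<close>
      define vs where "vs = map (\<lambda>u. u /\<^sub>R norm u) us"
      have h: "smooth_fun G ?h" by (rule decaying_smooth_fun [OF decaying_average_power [OF f]])
      have "(norm (u /\<^sub>R norm u))\<^sup>2 \<le> 1" for u :: 'l by (cases "u = 0") auto
      then have "sum_sq vs \<le> real (length us)"
        unfolding vs_def by (induction us) (auto intro: add_mono simp del: norm_scaleR)
      then have "(sum_sq vs)\<^sup>2 \<le> 4\<^sup>2"
        using us by (intro power_mono) (auto simp: sum_sq_nonneg)
      have p: "0 \<le> prod_list (map norm us)" by (intro prod_list_nonneg) auto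
      have "map (\<lambda>u. norm u *\<^sub>R (u /\<^sub>R norm u)) us = us"
      proof (rule map_idI)
        show "norm u *\<^sub>R (u /\<^sub>R norm u) = u" for u :: 'l by (cases "u = 0") auto
      qed
      then have "iter_field us ?h x = prod_list (map norm us) * iter_field vs ?h x"
        using iter_field_scaleR_map [OF h x, of "[]" norm "\<lambda>u. u /\<^sub>R norm u" us]
        by (simp only: vs_def append_Nil)
      also have "\<bar>\<dots>\<bar> = prod_list (map norm us) * \<bar>iter_field vs ?h x\<bar>"
        using p by (simp add: abs_mult)
      also have "\<dots> \<le> prod_list (map norm us) * (B * c ^ k * (1 + (sum_sq vs)\<^sup>2))"
        using p us x by (intro mult_left_mono growth) (auto simp: vs_def)
      also have "\<dots> \<le> prod_list (map norm us) * (B * c ^ k * 17)"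
        using p \<open>(sum_sq vs)\<^sup>2 \<le> 4\<^sup>2\<close> B0 c by (intro mult_left_mono) auto
      finally show "\<bar>iter_field us ?h x\<bar> \<le> 17 * B * (1 + C * \<epsilon>\<^sup>2) ^ k * prod_list (map norm us)"
        by (simp add: c_def mult_ac)
    qed
  qed
  then show ?thesis using C0 by blast
qed

lemma average_expansion:
  "\<exists>C\<ge>0. \<forall>\<epsilon> B h x. 0 \<le> \<epsilon> \<and> \<epsilon> \<le> 1 \<and> smooth_fun G h \<and> deriv_bound 3 B h \<and> x \<in> carrier G \<longrightarrow>
    \<bar>average \<epsilon> h x - h x - \<epsilon>\<^sup>2 * limit_generator h x\<bar> \<le> C * B * \<epsilon> ^ 3"
proof -
  have "\<exists>C. \<forall>e. C e \<ge> 0 \<and> (\<forall>\<epsilon> B h x. 0 \<le> \<epsilon> \<and> \<epsilon> \<le> 1 \<and> smooth_fun G h \<and> deriv_bound 3 B h \<and> x \<in> carrier G \<longrightarrow>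
    \<bar>h (x \<otimes> lexp G (lie_dilation \<epsilon> (d e))) - h x - \<epsilon> * left_field G (layer_part G 1 (d e)) h x
      - \<epsilon>\<^sup>2 * second_order (d e) h x\<bar> \<le> C e * B * \<epsilon> ^ 3)"
    using local_expansion by (intro choice) blast
  then obtain C where C0: "\<And>e. C e \<ge> 0" and C: "\<And>e \<epsilon> B h x. 0 \<le> \<epsilon> \<Longrightarrow> \<epsilon> \<le> 1 \<Longrightarrow> smooth_fun G h \<Longrightarrow>
     deriv_bound 3 B h \<Longrightarrow> x \<in> carrier G \<Longrightarrow>
    \<bar>h (x \<otimes> lexp G (lie_dilation \<epsilon> (d e))) - h x - \<epsilon> * left_field G (layer_part G 1 (d e)) h x
      - \<epsilon>\<^sup>2 * second_order (d e) h x\<bar> \<le> C e * B * \<epsilon> ^ 3"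
    by blast
  have "\<bar>average \<epsilon> h x - h x - \<epsilon>\<^sup>2 * limit_generator h x\<bar> \<le> (\<Sum>e\<in>E. \<mu> e * C e) * B * \<epsilon> ^ 3"
    if e: "0 \<le> \<epsilon>" "\<epsilon> \<le> 1" and h: "smooth_fun G h" and B: "deriv_bound 3 B h" and x: "x \<in> carrier G" for \<epsilon> B h x
  proof -
    have "(\<Sum>e\<in>E. \<mu> e * left_field G (layer_part G 1 (d e)) h x) = left_field G 0 h x"
      using left_field_sum_vector [OF h x, of \<mu> "\<lambda>e. layer_part G 1 (d e)" E] by (simp add: centered)
    also have "\<dots> = 0" using left_field_scaleR [OF h x, of 0 0] by simp
    finally have cen: "(\<Sum>e\<in>E. \<mu> e * left_field G (layer_part G 1 (d e)) h x) = 0" .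
    have "average \<epsilon> h x - h x - \<epsilon>\<^sup>2 * limit_generator h x =
      average \<epsilon> h x - (\<Sum>e\<in>E. \<mu> e * h x) - \<epsilon> * (\<Sum>e\<in>E. \<mu> e * left_field G (layer_part G 1 (d e)) h x) - \<epsilon>\<^sup>2 * limit_generator h x"
      by (simp add: cen sum_\<mu>_const)
    also have "\<dots> = (\<Sum>e\<in>E. \<mu> e * (h (x \<otimes> lexp G (lie_dilation \<epsilon> (d e))) - h x
        - \<epsilon> * left_field G (layer_part G 1 (d e)) h x - \<epsilon>\<^sup>2 * second_order (d e) h x))"
      unfolding average_def limit_generator_def
      by (simp add: right_diff_distrib sum_subtractf sum_distrib_left mult_ac)
    also have "\<bar>\<dots>\<bar> \<le> (\<Sum>e\<in>E. \<mu> e * (C e * B * \<epsilon> ^ 3))"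
      by (rule abs_sum_\<mu>_le, rule C [OF e h B x])
    finally show ?thesis by (simp add: sum_distrib_left sum_distrib_right mult_ac)
  qed
  moreover have "(\<Sum>e\<in>E. \<mu> e * C e) \<ge> 0" using C0 \<mu>_nonneg by (simp add: sum_nonneg)
  ultimately show ?thesis by blast
qed

lemma deriv_bound_limit_generator:
  "\<exists>K\<ge>0. \<forall>n B h. smooth_fun G h \<and> deriv_bound (n + 2) B h \<longrightarrow> deriv_bound n (K * B) (limit_generator h)"
proof (intro exI conjI allI impI)
  define K where "K e = norm (layer_part G 2 (d e)) + (norm (layer_part G 1 (d e)))\<^sup>2" for e
  show "(\<Sum>e\<in>E. \<mu> e * K e) \<ge> 0" using \<mu>_nonneg by (simp add: sum_nonneg K_def)
  fix n B h assume hB: "smooth_fun G h \<and> deriv_bound (n + 2) B h"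
  show "deriv_bound n ((\<Sum>e\<in>E. \<mu> e * K e) * B) (limit_generator h)"
    unfolding deriv_bound_def
  proof (intro allI impI ballI)
    fix us :: "'l list" and x assume us: "length us \<le> n" and x: "x \<in> carrier G"
    have sm: "smooth_fun G (second_order d h)" for d
      using hB by (simp add: smooth_fun_second_order)
    have "\<bar>iter_field us (limit_generator h) x\<bar> = \<bar>\<Sum>e\<in>E. \<mu> e * iter_field us (second_order (d e) h) x\<bar>"
      unfolding limit_generator_def [abs_def] by (simp add: iter_field_sum_fun sm x)
    also have "\<dots> \<le> (\<Sum>e\<in>E. \<mu> e * (K e * B * prod_list (map norm us)))"
      unfolding K_def
      by (intro abs_sum_\<mu>_le deriv_boundD [OF deriv_bound_second_order us x]) (use hB in auto)
    finally show "\<bar>iter_field us (limit_generator h) x\<bar> \<le> (\<Sum>e\<in>E. \<mu> e * K e) * B * prod_list (map norm us)"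
      by (simp add: sum_distrib_left sum_distrib_right mult_ac)
  qed
qed

text \<open>Allows the corrector to be carried from h to its average: the error is O(\<epsilon>),
  and the corrector comes with a factor \<epsilon>^2.\<close>

lemma second_order_average:
  "\<exists>C\<ge>0. \<forall>\<epsilon> B h x. 0 \<le> \<epsilon> \<and> \<epsilon> \<le> 1 \<and> smooth_fun G h \<and> deriv_bound 3 B h \<and> x \<in> carrier G \<longrightarrow>
    \<bar>second_order d' (average \<epsilon> h) x - second_order d' h x\<bar> \<le> C * B * \<epsilon>"
proof -
  let ?P = "\<lambda>C e. \<forall>\<epsilon> B h u v x. 0 \<le> \<epsilon> \<and> \<epsilon> \<le> 1 \<and> smooth_fun G h \<and> deriv_bound 3 B h \<and> x \<in> carrier G \<longrightarrow>
    \<bar>iter_field [u] (\<lambda>g. h (g \<otimes> lexp G (lie_dilation \<epsilon> (d e)))) x - iter_field [u] h x\<bar> \<le> C * B * \<epsilon> * norm u \<and>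
    \<bar>iter_field [u, v] (\<lambda>g. h (g \<otimes> lexp G (lie_dilation \<epsilon> (d e)))) x - iter_field [u, v] h x\<bar> \<le> C * B * \<epsilon> * (norm u * norm v)"
  have "\<exists>C. \<forall>e. C e \<ge> 0 \<and> ?P (C e) e"
    using left_fields_translate_bound by (intro choice) blast
  then obtain C where C0: "\<And>e. C e \<ge> 0" and C: "\<And>e. ?P (C e) e" by blast
  define L1 where "L1 = layer_part G 1 d'"
  define L2 where "L2 = layer_part G 2 d'"
  define c where "c = (\<Sum>e\<in>E. \<mu> e * C e)"
  have c: "c \<ge> 0" using C0 \<mu>_nonneg by (simp add: sum_nonneg c_def)
  have "\<bar>second_order d' (average \<epsilon> h) x - second_order d' h x\<bar> \<le> c * (norm L2 + (norm L1)\<^sup>2) * B * \<epsilon>"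
    if e: "0 \<le> \<epsilon>" "\<epsilon> \<le> 1" and h: "smooth_fun G h" and B: "deriv_bound 3 B h" and x: "x \<in> carrier G" for \<epsilon> B h x
  proof -
    have B0: "B \<ge> 0" using B by (rule deriv_bound_nonneg)
    let ?h = "\<lambda>e g. h (g \<otimes> lexp G (lie_dilation \<epsilon> (d e)))"
    have diff: "iter_field us (average \<epsilon> h) x - iter_field us h x =
      (\<Sum>e\<in>E. \<mu> e * (iter_field us (?h e) x - iter_field us h x))" for us
      by (simp add: iter_field_average [OF h x] right_diff_distrib sum_subtractf sum_\<mu>_const)
    have 1: "\<bar>iter_field [L2] (average \<epsilon> h) x - iter_field [L2] h x\<bar> \<le> c * B * \<epsilon> * norm L2"
    proof -
      have "\<bar>iter_field [L2] (average \<epsilon> h) x - iter_field [L2] h x\<bar> \<le> (\<Sum>e\<in>E. \<mu> e * (C e * B * \<epsilon> * norm L2))"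
        unfolding diff by (rule abs_sum_\<mu>_le) (use C e h B x in blast)
      then show ?thesis by (simp add: c_def sum_distrib_left sum_distrib_right mult_ac)
    qed
    have 2: "\<bar>iter_field [L1, L1] (average \<epsilon> h) x - iter_field [L1, L1] h x\<bar> \<le> c * B * \<epsilon> * (norm L1 * norm L1)"
    proof -
      have "\<bar>iter_field [L1, L1] (average \<epsilon> h) x - iter_field [L1, L1] h x\<bar> \<le> (\<Sum>e\<in>E. \<mu> e * (C e * B * \<epsilon> * (norm L1 * norm L1)))"
        unfolding diff by (rule abs_sum_\<mu>_le) (use C e h B x in blast)
      then show ?thesis by (simp add: c_def sum_distrib_left sum_distrib_right mult_ac)
    qed
    have "second_order d' (average \<epsilon> h) x - second_order d' h x =
      (iter_field [L2] (average \<epsilon> h) x - iter_field [L2] h x) + 1/2 * (iter_field [L1, L1] (average \<epsilon> h) x - iter_field [L1, L1] h x)"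
      by (simp add: second_order_def L1_def L2_def algebra_simps)
    also have "\<bar>\<dots>\<bar> \<le> c * B * \<epsilon> * norm L2 + c * B * \<epsilon> * (norm L1 * norm L1)"
    proof -
      have "\<bar>p + 1/2 * q\<bar> \<le> P + Q" if "\<bar>p\<bar> \<le> P" "\<bar>q\<bar> \<le> Q" for p q P Q :: real
        using that by linarith
      from this [OF 1 2] show ?thesis .
    qed
    finally show ?thesis by (simp add: algebra_simps power2_eq_square)
  qed
  then show ?thesis using c by (intro exI [of _ "c * (norm L2 + (norm L1)\<^sup>2)"]) auto
qed

end

section \<open>Comparison with the limit semigroup\<close>

context stratified_lie_group
begin

lemma C_inf_lincomb:
  assumes "f \<in> C_inf G" "g \<in> C_inf G"
  shows "(\<lambda>x. a * f x + b * g x) \<in> C_inf G"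
proof -
  have "vanishes_at_infinity G (\<lambda>x. a * f x + b * g x)"
    using assms unfolding C_inf_def vanishes_at_infinity_iff
    by (auto intro!: tendsto_add_zero tendsto_mult_right_zero)
  then show ?thesis
    using assms by (auto simp: C_inf_def intro!: continuous_map_add continuous_map_real_mult_left)
qed

text \<open>Integration against a probability measure has norm 1, whereas
  \<open>C0_semigroup\<close> provides a bound that may depend on t. Constant 1 is what lets the
  one-step errors merely add up.\<close>

lemma convolution_operator_contraction:
  assumes \<nu>: "convolution_semigroup G \<nu>" and t: "0 \<le> t" and x: "x \<in> carrier G"
    and f: "\<And>y. y \<in> carrier G \<Longrightarrow> \<bar>f y\<bar> \<le> B"
  shows "\<bar>convolution_operator G \<nu> t f x\<bar> \<le> B"
proof -
  interpret prob_space "\<nu> t"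
    using \<nu> t by (simp add: convolution_semigroup_def)
  have "sets (\<nu> t) = sets (lie_borel G)"
    using \<nu> t by (simp add: convolution_semigroup_def)
  then have space: "space (\<nu> t) = carrier G"
    by (simp add: sets_eq_imp_space_eq lie_borel_def space_measure_of_conv)
  show ?thesis
  proof (cases "integrable (\<nu> t) (\<lambda>y. f (x \<otimes> y))")
    case True
    have "\<bar>\<integral>y. f (x \<otimes> y) \<partial>\<nu> t\<bar> \<le> (\<integral>y. \<bar>f (x \<otimes> y)\<bar> \<partial>\<nu> t)"
      by (rule integral_abs_bound)
    also have "\<dots> \<le> (\<integral>y. B \<partial>\<nu> t)"
      using True x f by (intro integral_mono) (auto simp: space)
    finally show ?thesis
      by (simp add: convolution_operator_def prob_space)
  next
    case False
    \<comment> \<open>The integral of a non-integrable function is 0 by convention, so the claim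
      reduces to B being nonnegative.\<close>
    have "0 \<le> B" using f [OF x] by simp
    then show ?thesis
      using False by (simp add: convolution_operator_def not_integrable_integral_eq)
  qed
qed

end

locale limit_semigroup = centered_steps G E \<mu> d
  for G :: "('g, 'l::euclidean_space, 'm) stratified_group_scheme" (structure)
    and E :: "'i set" and \<mu> :: "'i \<Rightarrow> real" and d :: "'i \<Rightarrow> 'l" +
  fixes \<nu> :: "real \<Rightarrow> 'g measure" and \<A> :: "('g \<Rightarrow> real) \<Rightarrow> 'g \<Rightarrow> real"
  assumes convolution: "convolution_semigroup G \<nu>"
    and generator: "has_generator G (convolution_operator G \<nu>) \<A>"
    and \<A>_eq: "\<lbrakk>decaying h; x \<in> carrier G\<rbrakk> \<Longrightarrow> \<A> h x = limit_generator h x"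
begin

abbreviation T :: "real \<Rightarrow> ('g \<Rightarrow> real) \<Rightarrow> 'g \<Rightarrow> real" where
  "T \<equiv> convolution_operator G \<nu>"

lemma T_contraction:
  "0 \<le> t \<Longrightarrow> x \<in> carrier G \<Longrightarrow> (\<And>y. y \<in> carrier G \<Longrightarrow> \<bar>f y\<bar> \<le> B) \<Longrightarrow> \<bar>T t f x\<bar> \<le> B"
  using convolution by (rule convolution_operator_contraction)

lemma T_closed: "0 \<le> t \<Longrightarrow> f \<in> C_inf G \<Longrightarrow> T t f \<in> C_inf G"
  using generator by (simp add: has_generator_def C0_semigroup_def)

lemma T_lincomb: "0 \<le> t \<Longrightarrow> f \<in> C_inf G \<Longrightarrow> g \<in> C_inf G \<Longrightarrow> x \<in> carrier G \<Longrightarrow>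
    T t (\<lambda>y. a * f y + b * g y) x = a * T t f x + b * T t g x"
  using generator by (simp add: has_generator_def C0_semigroup_def)

lemma T_0: "f \<in> C_inf G \<Longrightarrow> x \<in> carrier G \<Longrightarrow> T 0 f x = f x"
  using generator by (simp add: has_generator_def C0_semigroup_def)

lemma T_add: "0 \<le> s \<Longrightarrow> 0 \<le> t \<Longrightarrow> f \<in> C_inf G \<Longrightarrow> x \<in> carrier G \<Longrightarrow> T (s + t) f x = T s (T t f) x"
  using generator by (simp add: has_generator_def C0_semigroup_def)

lemma T_diff_contraction:
  assumes "0 \<le> t" "x \<in> carrier G" "f \<in> C_inf G" "g \<in> C_inf G"
    and "\<And>y. y \<in> carrier G \<Longrightarrow> \<bar>f y - g y\<bar> \<le> B"
  shows "\<bar>T t f x - T t g x\<bar> \<le> B"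
  using T_lincomb [OF assms(1,3,4,2), of 1 "- 1"] T_contraction [OF assms(1,2), of "\<lambda>y. f y - g y" B] assms(5)
  by simp

text \<open>The constant sequence h places h, with this value of the generator, in the closure graph
  and thereby in the generator graph.\<close>

lemma generator_limit:
  assumes "decaying h"
  shows "uniform_limit (carrier G) (\<lambda>s x. (T s h x - h x) / s) (limit_generator h) (at_right 0)"
proof -
  have "uniform_limit (carrier G) (\<lambda>n::nat. \<A> h) (limit_generator h) sequentially"
    unfolding uniform_limit_iff by (auto simp: \<A>_eq assms)
  then have "(h, limit_generator h) \<in> closure_graph G \<A>"
    using assms by (auto simp: closure_graph_def C_inf_smooth_iff intro!: exI [of _ "\<lambda>_. h"] uniform_limit_const)
  then have "(h, limit_generator h) \<in> generator_graph G T"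
    using generator by (simp add: has_generator_def)
  then show ?thesis by (simp add: generator_graph_def)
qed

text \<open>Splitting \<open>[0, s]\<close> into short intervals replaces the integral formula
  \<open>T s h - h = \<integral>\<^sub>0\<^sup>s T r (A h) dr\<close>.\<close>

lemma T_increment_bound:
  assumes h: "decaying h" and x: "x \<in> carrier G" and s: "0 \<le> s"
    and K: "\<And>r. 0 \<le> r \<Longrightarrow> r \<le> s \<Longrightarrow> \<bar>T r (limit_generator h) x - c\<bar> \<le> K"
  shows "\<bar>T s h x - h x - s * c\<bar> \<le> s * K"
proof (cases "s = 0")
  case True
  then show ?thesis using T_0 [OF decaying_C_inf [OF h] x] by simp
next
  case False
  then have s0: "0 < s" using s by simp
  let ?g = "limit_generator h"
  have hC: "h \<in> C_inf G" and gC: "?g \<in> C_inf G"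
    using h by (auto intro: decaying_C_inf decaying_limit_generator)
  have "\<bar>T s h x - h x - s * c\<bar> \<le> s * K + s * \<eta>" if \<eta>: "0 < \<eta>" for \<eta>
  proof -
    obtain \<delta> where \<delta>: "\<delta> > 0" "\<And>\<tau> y. 0 < \<tau> \<Longrightarrow> \<tau> < \<delta> \<Longrightarrow> y \<in> carrier G \<Longrightarrow> \<bar>(T \<tau> h y - h y) / \<tau> - ?g y\<bar> < \<eta>"
      using generator_limit [OF h] \<eta> unfolding uniform_limit_iff eventually_at_right_field dist_real_def
      by (metis add_0)
    obtain m :: nat where m: "s / \<delta> < real m" using reals_Archimedean2 by blast
    have m0: "0 < real m" using m s0 \<delta>(1) by (meson divide_pos_pos less_trans)
    define \<tau> where "\<tau> = s / real m"
    have \<tau>: "0 < \<tau>" "\<tau> < \<delta>" "real m * \<tau> = s"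
      using m m0 s0 \<delta>(1) by (auto simp: \<tau>_def field_simps)
    \<comment> \<open>Uniformity in y is essential: this one-interval error is later transported by
      \<open>T (real k * \<tau>)\<close>, which preserves uniform bounds only.\<close>
    have err: "\<bar>T \<tau> h y - (1 * h y + \<tau> * ?g y)\<bar> \<le> \<tau> * \<eta>" if "y \<in> carrier G" for y
    proof -
      have "T \<tau> h y - h y - \<tau> * ?g y = \<tau> * ((T \<tau> h y - h y) / \<tau> - ?g y)"
        using \<tau>(1) by (simp add: field_simps)
      then have "\<bar>T \<tau> h y - h y - \<tau> * ?g y\<bar> = \<tau> * \<bar>(T \<tau> h y - h y) / \<tau> - ?g y\<bar>"
        using \<tau>(1) by (simp only: abs_mult abs_of_pos)
      also have "\<dots> \<le> \<tau> * \<eta>"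
        using \<delta>(2) [OF \<tau>(1,2) that] \<tau>(1) by (intro mult_left_mono) auto
      finally show ?thesis by (simp add: algebra_simps)
    qed
    have "\<bar>T (real k * \<tau>) h x - h x - real k * \<tau> * c\<bar> \<le> real k * \<tau> * (K + \<eta>)" if "k \<le> m" for k
      using that
    proof (induction k)
      case 0
      then show ?case using T_0 [OF hC x] by simp
    next
      case (Suc k)
      have kt: "0 \<le> real k * \<tau>" "real k * \<tau> \<le> s"
        using \<tau> Suc.prems by (auto simp flip: \<tau>(3))
      have "T (real (Suc k) * \<tau>) h x = T (real k * \<tau>) (T \<tau> h) x"
        using T_add [OF kt(1) _ hC x, of \<tau>] \<tau>(1) by (simp add: distrib_right add.commute)
      moreover have "\<bar>T (real k * \<tau>) (T \<tau> h) x - T (real k * \<tau>) (\<lambda>y. 1 * h y + \<tau> * ?g y) x\<bar> \<le> \<tau> * \<eta>"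
        using \<tau>(1) by (intro T_diff_contraction err kt x T_closed hC C_inf_lincomb gC) auto
      moreover have "T (real k * \<tau>) (\<lambda>y. 1 * h y + \<tau> * ?g y) x = T (real k * \<tau>) h x + \<tau> * T (real k * \<tau>) ?g x"
        using T_lincomb [OF kt(1) hC gC x, of 1 \<tau>] by simp
      moreover have "\<bar>\<tau> * T (real k * \<tau>) ?g x - \<tau> * c\<bar> \<le> \<tau> * K"
        using K [OF kt] \<tau>(1) by (simp add: abs_mult flip: right_diff_distrib)
      moreover have "\<bar>T (real k * \<tau>) h x - h x - real k * \<tau> * c\<bar> \<le> real k * \<tau> * (K + \<eta>)"
        using Suc by simp
      ultimately have "\<bar>T (real (Suc k) * \<tau>) h x - h x - (real k * \<tau> * c + \<tau> * c)\<bar> \<le> real k * \<tau> * (K + \<eta>) + (\<tau> * K + \<tau> * \<eta>)"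
        by linarith
      then show ?case by (simp add: algebra_simps)
    qed
    from this [of m] show ?thesis by (simp add: \<tau>(3) distrib_left)
  qed
  \<comment> \<open>Taking \<eta> = e / s turns the error of the difference quotient into an
    arbitrary e > 0.\<close>
  then have "\<bar>T s h x - h x - s * c\<bar> \<le> s * K + e" if "0 < e" for e
    using that s0 by (metis divide_pos_pos nonzero_mult_div_cancel_left times_divide_eq_right less_irrefl)
  then show ?thesis by (rule field_le_epsilon)
qed

lemma T_first_order:
  assumes h: "decaying h" and x: "x \<in> carrier G" and s: "0 \<le> s"
    and K: "\<And>y. y \<in> carrier G \<Longrightarrow> \<bar>limit_generator h y\<bar> \<le> K"
  shows "\<bar>T s h x - h x\<bar> \<le> s * K"
  using T_increment_bound [OF h x s, of 0 K] T_contraction [OF _ x K] by simp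

text \<open>\<open>limit_generator h\<close> is decaying again, so the first-order bound controls
  how far it drifts during [0, s]; the increment bound then contributes the second factor s.\<close>

lemma T_second_order:
  assumes h: "decaying h" and x: "x \<in> carrier G" and s: "0 \<le> s"
    and K: "\<And>y. y \<in> carrier G \<Longrightarrow> \<bar>limit_generator (limit_generator h) y\<bar> \<le> K"
  shows "\<bar>T s h x - h x - s * limit_generator h x\<bar> \<le> s * (s * K)"
proof (rule T_increment_bound [OF h x s])
  fix r assume r: "0 \<le> r" "r \<le> s"
  have "\<bar>T r (limit_generator h) x - limit_generator h x\<bar> \<le> r * K"
    by (rule T_first_order [OF decaying_limit_generator [OF h] x r(1) K])
  also have "\<dots> \<le> s * K"
    using r K [OF x] by (intro mult_right_mono) auto
  finally show "\<bar>T r (limit_generator h) x - limit_generator h x\<bar> \<le> s * K" .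
qed

text \<open>Lindeberg telescoping: one step of the average is exchanged for one step of the
  semigroup on the outside, so the expansion is applied to an iterate of the average and the
  remaining difference passes through a contraction. The four derivatives are spent on applying the
  generator twice.\<close>

lemma average_power_T:
  "\<exists>C\<ge>0. \<forall>\<epsilon> B f k x. 0 \<le> \<epsilon> \<and> \<epsilon> \<le> 1 \<and> decaying f \<and> x \<in> carrier G \<and>
     (\<forall>j<k. deriv_bound 4 B ((average \<epsilon> ^^ j) f)) \<longrightarrow>
     \<bar>(average \<epsilon> ^^ k) f x - T (real k * \<epsilon>\<^sup>2) f x\<bar> \<le> real k * (C * B * \<epsilon> ^ 3)"
proof -
  obtain C where C0: "C \<ge> 0" and C: "\<And>\<epsilon> B h x. 0 \<le> \<epsilon> \<Longrightarrow> \<epsilon> \<le> 1 \<Longrightarrow> smooth_fun G h \<Longrightarrow> deriv_bound 3 B h \<Longrightarrow> x \<in> carrier G \<Longrightarrow>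
    \<bar>average \<epsilon> h x - h x - \<epsilon>\<^sup>2 * limit_generator h x\<bar> \<le> C * B * \<epsilon> ^ 3"
    using average_expansion by blast
  obtain K where K0: "K \<ge> 0" and K: "\<And>n B h. smooth_fun G h \<Longrightarrow> deriv_bound (n + 2) B h \<Longrightarrow> deriv_bound n (K * B) (limit_generator h)"
    using deriv_bound_limit_generator by blast
  have one: "\<bar>average \<epsilon> h x - T (\<epsilon>\<^sup>2) h x\<bar> \<le> (C + K\<^sup>2) * B * \<epsilon> ^ 3"
    if e: "0 \<le> \<epsilon>" "\<epsilon> \<le> 1" and h: "decaying h" and B: "deriv_bound 4 B h" and x: "x \<in> carrier G" for \<epsilon> B h x
  proof -
    have B0: "B \<ge> 0" using B by (rule deriv_bound_nonneg)
    have sm: "smooth_fun G h" "smooth_fun G (limit_generator h)"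
      using h decaying_limit_generator decaying_smooth_fun by blast+
    have "deriv_bound 2 (K * B) (limit_generator h)"
      using K [OF sm(1), of 2] B by simp
    then have "deriv_bound 0 (K * (K * B)) (limit_generator (limit_generator h))"
      using K [OF sm(2), of 0 "K * B"] by (simp add: numeral_2_eq_2)
    then have "\<bar>limit_generator (limit_generator h) y\<bar> \<le> K\<^sup>2 * B" if "y \<in> carrier G" for y
      using deriv_boundD [of 0 _ _ "[]" y] that by (fastforce simp: power2_eq_square mult_ac)
    then have "\<bar>T (\<epsilon>\<^sup>2) h x - h x - \<epsilon>\<^sup>2 * limit_generator h x\<bar> \<le> \<epsilon>\<^sup>2 * (\<epsilon>\<^sup>2 * (K\<^sup>2 * B))"
      by (intro T_second_order [OF h x]) auto
    also have "\<dots> = (K\<^sup>2 * B) * \<epsilon> ^ 4" by (simp add: power2_eq_square power4_eq_xxxx mult_ac)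
    also have "\<dots> \<le> (K\<^sup>2 * B) * \<epsilon> ^ 3"
      using e B0 by (intro mult_left_mono power_decreasing) auto
    finally have 1: "\<bar>T (\<epsilon>\<^sup>2) h x - h x - \<epsilon>\<^sup>2 * limit_generator h x\<bar> \<le> (K\<^sup>2 * B) * \<epsilon> ^ 3" .
    have 2: "\<bar>average \<epsilon> h x - h x - \<epsilon>\<^sup>2 * limit_generator h x\<bar> \<le> C * B * \<epsilon> ^ 3"
      by (rule C [OF e sm(1) deriv_bound_mono [OF B] x]) simp
    have "\<bar>average \<epsilon> h x - T (\<epsilon>\<^sup>2) h x\<bar> \<le> C * B * \<epsilon> ^ 3 + (K\<^sup>2 * B) * \<epsilon> ^ 3"
      using 1 2 by linarith
    then show ?thesis by (simp add: algebra_simps)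
  qed
  have "\<bar>(average \<epsilon> ^^ k) f x - T (real k * \<epsilon>\<^sup>2) f x\<bar> \<le> real k * ((C + K\<^sup>2) * B * \<epsilon> ^ 3)"
    if e: "0 \<le> \<epsilon>" "\<epsilon> \<le> 1" and f: "decaying f" and x: "x \<in> carrier G"
      and B: "\<forall>j<k. deriv_bound 4 B ((average \<epsilon> ^^ j) f)" for \<epsilon> B f k x
    using x B
  proof (induction k arbitrary: x)
    case 0
    then show ?case using T_0 [OF decaying_C_inf [OF f]] by simp
  next
    case (Suc k)
    let ?h = "(average \<epsilon> ^^ k) f"
    have h: "decaying ?h" by (rule decaying_average_power [OF f])
    have fC: "f \<in> C_inf G" "?h \<in> C_inf G" using f h decaying_C_inf by auto
    have "\<bar>average \<epsilon> ?h x - T (\<epsilon>\<^sup>2) ?h x\<bar> \<le> (C + K\<^sup>2) * B * \<epsilon> ^ 3"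
      using Suc.prems by (intro one e h) auto
    moreover have "\<bar>T (\<epsilon>\<^sup>2) ?h x - T (\<epsilon>\<^sup>2) (T (real k * \<epsilon>\<^sup>2) f) x\<bar> \<le> real k * ((C + K\<^sup>2) * B * \<epsilon> ^ 3)"
      using Suc by (intro T_diff_contraction Suc.IH T_closed fC) auto
    moreover have "T (\<epsilon>\<^sup>2) (T (real k * \<epsilon>\<^sup>2) f) x = T (real (Suc k) * \<epsilon>\<^sup>2) f x"
      using T_add [OF _ _ fC(1) Suc.prems(1), of "\<epsilon>\<^sup>2" "real k * \<epsilon>\<^sup>2"] by (simp add: distrib_right)
    ultimately show ?case by (simp add: distrib_right)
  qed
  then show ?thesis
    using C0 by (intro exI [of _ "C + K\<^sup>2"]) (auto simp del: power_Suc)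
qed

lemma T_time_change:
  assumes f: "decaying f" and x: "x \<in> carrier G" and st: "0 \<le> s" "s \<le> t"
    and K: "\<And>y. y \<in> carrier G \<Longrightarrow> \<bar>limit_generator f y\<bar> \<le> K"
  shows "\<bar>T t f x - T s f x\<bar> \<le> (t - s) * K"
proof -
  have fC: "f \<in> C_inf G" using f by (rule decaying_C_inf)
  have "T t f x = T s (T (t - s) f) x"
    using T_add [OF st(1) _ fC x, of "t - s"] st by simp
  moreover have "\<bar>T s (T (t - s) f) x - T s f x\<bar> \<le> (t - s) * K"
    using st by (intro T_diff_contraction T_first_order [OF f _ _ K] T_closed fC x) auto
  ultimately show ?thesis by simp
qed

end

section \<open>The Poisson equation of a finite irreducible walk\<close>

text \<open>Gaussian elimination with one pivot.\<close>

lemma finite_linear_system_solvable: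
  fixes a :: "'r \<Rightarrow> 'c \<Rightarrow> real"
  assumes "finite R" "finite C" "card R = card C"
    and "\<And>\<psi>. (\<forall>x\<in>R. (\<Sum>y\<in>C. a x y * \<psi> y) = 0) \<Longrightarrow> \<forall>y\<in>C. \<psi> y = 0"
  shows "\<exists>\<psi>. \<forall>x\<in>R. (\<Sum>y\<in>C. a x y * \<psi> y) = c x"
  using assms
proof (induction "card C" arbitrary: R C a c)
  case 0
  then have "R = {}" by auto
  then show ?case by simp
next
  case (Suc n)
  obtain y0 where y0: "y0 \<in> C" using Suc.hyps(2) by (metis card.empty ex_in_conv nat.distinct(1))
  have "\<exists>x0\<in>R. a x0 y0 \<noteq> 0"
  proof (rule ccontr)
    assume no: "\<not> (\<exists>x0\<in>R. a x0 y0 \<noteq> 0)"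
    have "\<forall>x\<in>R. (\<Sum>y\<in>C. a x y * (if y = y0 then 1 else 0)) = 0"
      using no y0 Suc.prems(2) by (simp add: if_distrib cong: if_cong)
    then show False using Suc.prems(4) [of "\<lambda>y. if y = y0 then 1 else 0"] y0 by fastforce
  qed
  then obtain x0 where x0: "x0 \<in> R" "a x0 y0 \<noteq> 0" by blast
  let ?R = "R - {x0}" and ?C = "C - {y0}"
  define b where "b x y = a x y - a x y0 / a x0 y0 * a x0 y" for x y
  have C: "(\<Sum>y\<in>C. f y) = f y0 + (\<Sum>y\<in>?C. f y)" for f :: "'c \<Rightarrow> real"
    using y0 Suc.prems(2) by (simp add: sum.remove)
  have b: "(\<Sum>y\<in>?C. b x y * \<psi> y) = (\<Sum>y\<in>?C. a x y * \<psi> y) - a x y0 / a x0 y0 * (\<Sum>y\<in>?C. a x0 y * \<psi> y)" for x \<psi>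
    by (simp add: b_def left_diff_distrib right_diff_distrib sum_subtractf sum_distrib_left mult_ac)
  have "\<exists>\<psi>. \<forall>x\<in>?R. (\<Sum>y\<in>?C. b x y * \<psi> y) = c x - a x y0 / a x0 y0 * c x0"
  proof (rule Suc.hyps(1))
    show "n = card ?C" "finite ?R" "finite ?C" "card ?R = card ?C"
      using Suc.hyps(2) Suc.prems x0 y0 by auto
    fix \<psi> assume *: "\<forall>x\<in>?R. (\<Sum>y\<in>?C. b x y * \<psi> y) = 0"
    \<comment> \<open>A kernel vector of the reduced system extends to one of the full system by
      solving the pivot row for the coordinate y0.\<close>
    define \<psi>' where "\<psi>' = \<psi>(y0 := - (\<Sum>y\<in>?C. a x0 y * \<psi> y) / a x0 y0)"
    have s: "(\<Sum>y\<in>?C. a x y * \<psi>' y) = (\<Sum>y\<in>?C. a x y * \<psi> y)" for x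
      by (rule sum.cong) (auto simp: \<psi>'_def)
    have "(\<Sum>y\<in>C. a x y * \<psi>' y) = 0" if "x \<in> R" for x
    proof (cases "x = x0")
      case True
      then show ?thesis using x0 by (simp add: C s) (simp add: \<psi>'_def)
    next
      case False
      then have "(\<Sum>y\<in>?C. a x y * \<psi> y) = a x y0 / a x0 y0 * (\<Sum>y\<in>?C. a x0 y * \<psi> y)"
        using * that b by simp
      then show ?thesis by (simp add: C s) (simp add: \<psi>'_def)
    qed
    then have "\<forall>y\<in>C. \<psi>' y = 0" using Suc.prems(4) by blast
    then show "\<forall>y\<in>?C. \<psi> y = 0" by (auto simp: \<psi>'_def split: if_splits)
  qed
  then obtain \<psi> where \<psi>: "\<And>x. x \<in> ?R \<Longrightarrow> (\<Sum>y\<in>?C. b x y * \<psi> y) = c x - a x y0 / a x0 y0 * c x0"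
    by blast
  define \<psi>' where "\<psi>' = \<psi>(y0 := (c x0 - (\<Sum>y\<in>?C. a x0 y * \<psi> y)) / a x0 y0)"
  have s: "(\<Sum>y\<in>?C. a x y * \<psi>' y) = (\<Sum>y\<in>?C. a x y * \<psi> y)" for x
    by (rule sum.cong) (auto simp: \<psi>'_def)
  have "(\<Sum>y\<in>C. a x y * \<psi>' y) = c x" if "x \<in> R" for x
  proof (cases "x = x0")
    case True
    then show ?thesis using x0 by (simp add: C s) (simp add: \<psi>'_def)
  next
    case False
    have "a x y0 * ((c x0 - (\<Sum>y\<in>?C. a x0 y * \<psi> y)) / a x0 y0) =
        a x y0 / a x0 y0 * c x0 - a x y0 / a x0 y0 * (\<Sum>y\<in>?C. a x0 y * \<psi> y)"
      by (simp add: right_diff_distrib diff_divide_distrib)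
    then show ?thesis using \<psi> [of x] False that b [of x \<psi>] by (simp add: C s) (simp add: \<psi>'_def)
  qed
  then show ?case by blast
qed

text \<open>P - 1 is singular because it kills constants. Subtracting the m-mean, a rank-one term,
  makes the system injective and hence solvable; integrating the solution against m shows that the
  added term vanishes when c has m-mean 0.\<close>

lemma poisson_equation:
  fixes Y :: "('w, 'i) pre_digraph"
  assumes fin: "finite (verts Y)" "finite (arcs Y)"
    and wf: "\<And>e. e \<in> arcs Y \<Longrightarrow> head Y e \<in> verts Y"
    and q0: "\<And>e. e \<in> arcs Y \<Longrightarrow> 0 \<le> q e"
    and q1: "\<And>x. x \<in> verts Y \<Longrightarrow> (\<Sum>e\<in>out_arcs Y x. q e) = 1"
    and irr: "irreducible_walk Y q"
    and m1: "(\<Sum>x\<in>verts Y. m x) = 1"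
    and inv: "\<And>\<psi>. (\<Sum>x\<in>verts Y. m x * (\<Sum>e\<in>out_arcs Y x. q e * \<psi> (head Y e))) = (\<Sum>x\<in>verts Y. m x * \<psi> x)"
    and c: "(\<Sum>x\<in>verts Y. m x * c x) = (0::real)"
  shows "\<exists>\<psi>. \<forall>x\<in>verts Y. (\<Sum>e\<in>out_arcs Y x. q e * \<psi> (head Y e)) - \<psi> x = c x"
proof -
  let ?V = "verts Y" and ?P = "\<lambda>\<psi> x. \<Sum>e\<in>out_arcs Y x. q e * \<psi> (head Y e)"
  \<comment> \<open>The matrix of P - 1 minus the m-mean, with parallel edges collected in the inner
    sum.\<close>
  define a where "a x y = (\<Sum>e\<in>out_arcs Y x. q e * (if head Y e = y then 1 else 0)) - (if x = y then 1 else 0) - m y" for x y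
  have fo: "finite (out_arcs Y x)" for x
    using fin(2) by (simp add: out_arcs_def)
  have a: "(\<Sum>y\<in>?V. a x y * \<psi> y) = ?P \<psi> x - \<psi> x - (\<Sum>y\<in>?V. m y * \<psi> y)" if "x \<in> ?V" for x and \<psi> :: "'w \<Rightarrow> real"
  proof -
    have "(\<Sum>y\<in>?V. (\<Sum>e\<in>out_arcs Y x. q e * (if head Y e = y then 1 else 0)) * \<psi> y) =
        (\<Sum>e\<in>out_arcs Y x. \<Sum>y\<in>?V. q e * (if head Y e = y then \<psi> y else 0))"
      unfolding sum_distrib_right by (subst sum.swap) (intro sum.cong, auto)
    also have "\<dots> = ?P \<psi> x"
      using wf fin(1) by (intro sum.cong) (auto simp: if_distrib cong: if_cong)
    finally show ?thesis
      using that fin(1) by (simp add: a_def left_diff_distrib sum_subtractf if_distrib [of "\<lambda>c. c * _"] cong: if_cong)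
  qed
  have m_const: "(\<Sum>x\<in>?V. m x * k) = k" for k
    using m1 by (simp flip: sum_distrib_right)
  have "\<exists>\<psi>. \<forall>x\<in>?V. (\<Sum>y\<in>?V. a x y * \<psi> y) = c x"
  proof (rule finite_linear_system_solvable [OF fin(1) fin(1) refl])
    fix \<psi> assume *: "\<forall>x\<in>?V. (\<Sum>y\<in>?V. a x y * \<psi> y) = 0"
    \<comment> \<open>For a kernel vector P \<psi> = \<psi> + k; integration against m forces k = 0,
      so \<psi> is harmonic and the maximum principle makes it constant, the constant being its mean
      k = 0.\<close>
    define k where "k = (\<Sum>y\<in>?V. m y * \<psi> y)"
    have P: "?P \<psi> x = \<psi> x + k" if "x \<in> ?V" for x
      using bspec [OF * that] a [OF that, of \<psi>] unfolding k_def by linarith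
    have "k = (\<Sum>x\<in>?V. m x * ?P \<psi> x)" using inv [of \<psi>] by (simp add: k_def)
    also have "\<dots> = (\<Sum>x\<in>?V. m x * \<psi> x) + (\<Sum>x\<in>?V. m x * k)"
      by (simp add: P distrib_left sum.distrib)
    finally have k: "k = 0" by (simp add: m_const k_def [symmetric])
    show "\<forall>y\<in>?V. \<psi> y = 0"
    proof (cases "?V = {}")
      case False
      define M where "M = Max (\<psi> ` ?V)"
      have Mle: "\<psi> x \<le> M" if "x \<in> ?V" for x unfolding M_def using fin(1) that by simp
      have "M \<in> \<psi> ` ?V" unfolding M_def using fin(1) False by (intro Max_in) auto
      then obtain x1 where x1: "x1 \<in> ?V" "\<psi> x1 = M" by blast
      \<comment> \<open>At a maximum the average of the nonnegative differences M - \<psi> is 0, so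
        each successor of positive probability is a maximum as well.\<close>
      have propagate: "\<psi> (head Y e) = M" if e: "e \<in> arcs Y" "0 < q e" and x: "tail Y e \<in> ?V" "\<psi> (tail Y e) = M" for e
      proof -
        let ?x = "tail Y e"
        have "(\<Sum>e\<in>out_arcs Y ?x. q e * (M - \<psi> (head Y e))) = (\<Sum>e\<in>out_arcs Y ?x. q e) * M - ?P \<psi> ?x"
          by (simp add: right_diff_distrib sum_subtractf sum_distrib_right)
        also have "\<dots> = 0" using P [OF x(1)] q1 [OF x(1)] x(2) k by simp
        finally have "\<forall>e\<in>out_arcs Y ?x. q e * (M - \<psi> (head Y e)) = 0"
          using q0 Mle wf by (subst (asm) sum_nonneg_eq_0_iff [OF fo]) auto
        moreover have "e \<in> out_arcs Y ?x" using e by simp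
        ultimately have "q e * (M - \<psi> (head Y e)) = 0" by blast
        then show ?thesis using e(2) by simp
      qed
      have walk: "\<psi> y = M" if "pre_digraph.cas Y x es y" "set es \<subseteq> arcs Y" "\<forall>e\<in>set es. 0 < q e" "x \<in> ?V" "\<psi> x = M" for x es y
        using that
      proof (induction es arbitrary: x)
        case Nil
        then show ?case by (simp add: pre_digraph.cas.simps)
      next
        case (Cons e es)
        then have "\<psi> (head Y e) = M" by (intro propagate) (auto simp: pre_digraph.cas.simps)
        then show ?case using Cons wf by (intro Cons.IH [of "head Y e"]) (auto simp: pre_digraph.cas.simps)
      qed
      have all: "\<psi> y = M" if "y \<in> ?V" for y
        using irr that x1 walk unfolding irreducible_walk_def pre_digraph.awalk_def by metis
      have "k = (\<Sum>y\<in>?V. m y * M)" unfolding k_def using all by (intro sum.cong) auto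
      then have "M = 0" using k m_const by simp
      then show ?thesis using all by simp
    qed simp
  qed
  then obtain \<psi> where \<psi>: "\<And>x. x \<in> ?V \<Longrightarrow> (\<Sum>y\<in>?V. a x y * \<psi> y) = c x" by blast
  define k where "k = (\<Sum>y\<in>?V. m y * \<psi> y)"
  have P: "?P \<psi> x = \<psi> x + k + c x" if "x \<in> ?V" for x
    using \<psi> [OF that] a [OF that, of \<psi>] unfolding k_def by linarith
  have "k = (\<Sum>x\<in>?V. m x * ?P \<psi> x)" using inv [of \<psi>] by (simp add: k_def)
  also have "\<dots> = (\<Sum>x\<in>?V. m x * \<psi> x) + (\<Sum>x\<in>?V. m x * k) + (\<Sum>x\<in>?V. m x * c x)"
    by (simp add: P distrib_left sum.distrib)
  finally have "k = 0" by (simp add: m_const k_def [symmetric] c)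
  then show ?thesis using P by (intro exI [of _ \<psi>]) simp
qed

section \<open>Walks modulated by a finite chain\<close>

text \<open>A walk on \<open>V\<close> whose steps \<open>e\<close> move the position \<open>\<Psi>\<close> in \<open>G\<close> by the increment
  of their class \<open>cl e \<in> E\<close>. The corrector \<open>\<xi>\<close> compares the frequency of the classes seen from \<open>x\<close>
  with their mean frequency \<open>\<mu>\<close>.\<close>

locale modulated_walk = limit_semigroup G E \<mu> d \<nu> \<A>
  for G :: "('g, 'l::euclidean_space, 'm) stratified_group_scheme" (structure)
    and E :: "'i set" and \<mu> :: "'i \<Rightarrow> real" and d :: "'i \<Rightarrow> 'l"
    and \<nu> :: "real \<Rightarrow> 'g measure" and \<A> :: "('g \<Rightarrow> real) \<Rightarrow> 'g \<Rightarrow> real" +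
  fixes V :: "'v set" and out :: "'v \<Rightarrow> 'e set" and target :: "'e \<Rightarrow> 'v" and p :: "'e \<Rightarrow> real"
    and cl :: "'e \<Rightarrow> 'i" and \<Psi> :: "'v \<Rightarrow> 'g" and \<xi> :: "'i \<Rightarrow> 'v \<Rightarrow> real"
  assumes finite_out: "x \<in> V \<Longrightarrow> finite (out x)"
    and target_in: "x \<in> V \<Longrightarrow> e \<in> out x \<Longrightarrow> target e \<in> V"
    and p_nonneg: "x \<in> V \<Longrightarrow> e \<in> out x \<Longrightarrow> 0 \<le> p e"
    and sum_p: "x \<in> V \<Longrightarrow> (\<Sum>e\<in>out x. p e) = 1"
    and cl_in: "x \<in> V \<Longrightarrow> e \<in> out x \<Longrightarrow> cl e \<in> E"
    and \<Psi>_closed: "x \<in> V \<Longrightarrow> \<Psi> x \<in> carrier G"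
    and \<Psi>_step: "x \<in> V \<Longrightarrow> e \<in> out x \<Longrightarrow> \<Psi> (target e) = \<Psi> x \<otimes> lexp G (d (cl e))"
    and step_centered: "x \<in> V \<Longrightarrow> (\<Sum>e\<in>out x. p e *\<^sub>R layer_part G 1 (d (cl e))) = 0"
    and corrector: "x \<in> V \<Longrightarrow> i \<in> E \<Longrightarrow>
      (\<Sum>e\<in>out x. p e * \<xi> i (target e)) - \<xi> i x = (\<Sum>e\<in>out x. p e * (if cl e = i then 1 else 0)) - \<mu> i"
    and corrector_bounded: "\<exists>K. \<forall>i\<in>E. \<forall>x\<in>V. \<bar>\<xi> i x\<bar> \<le> K"
begin

definition L :: "('v \<Rightarrow> real) \<Rightarrow> 'v \<Rightarrow> real" where
  "L H x = (\<Sum>e\<in>out x. p e * H (target e))"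

definition pos :: "real \<Rightarrow> 'v \<Rightarrow> 'g" where
  "pos \<epsilon> x = dilation G \<epsilon> (\<Psi> x)"

text \<open>Since \<xi> i turns, under L - 1, into the local frequency of class i minus \<mu> i,
  this sum turns to leading order into the local second-order term minus its mean
  \<open>limit_generator\<close>.\<close>

definition correction :: "real \<Rightarrow> ('g \<Rightarrow> real) \<Rightarrow> 'v \<Rightarrow> real" where
  "correction \<epsilon> h x = (\<Sum>i\<in>E. \<xi> i x * second_order (d i) h (pos \<epsilon> x))"

definition corrected :: "real \<Rightarrow> ('g \<Rightarrow> real) \<Rightarrow> 'v \<Rightarrow> real" where
  "corrected \<epsilon> h x = h (pos \<epsilon> x) - \<epsilon>\<^sup>2 * correction \<epsilon> h x"

section \<open>One-step estimates for the walk and its corrector\<close>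

lemma pos_closed [simp]: "pos \<epsilon> x \<in> carrier G"
  by (simp add: pos_def)

lemma pos_step:
  "x \<in> V \<Longrightarrow> e \<in> out x \<Longrightarrow> pos \<epsilon> (target e) = pos \<epsilon> x \<otimes> lexp G (lie_dilation \<epsilon> (d (cl e)))"
  by (simp add: pos_def \<Psi>_step dilation_mult \<Psi>_closed) (simp add: dilation_eq)

lemma abs_sum_p_le:
  assumes x: "x \<in> V" and f: "\<And>e. e \<in> out x \<Longrightarrow> \<bar>f e\<bar> \<le> B"
  shows "\<bar>\<Sum>e\<in>out x. p e * f e\<bar> \<le> B"
proof -
  have "\<bar>\<Sum>e\<in>out x. p e * f e\<bar> \<le> (\<Sum>e\<in>out x. \<bar>p e * f e\<bar>)" by (rule sum_abs)
  also have "\<dots> \<le> (\<Sum>e\<in>out x. p e * B)"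
    using f p_nonneg [OF x] by (intro sum_mono) (auto simp: abs_mult intro: mult_left_mono)
  also have "\<dots> = B" using sum_p [OF x] by (simp flip: sum_distrib_right)
  finally show ?thesis .
qed

lemma L_diff_contraction:
  assumes "x \<in> V" and "\<And>y. y \<in> V \<Longrightarrow> \<bar>H y - H' y\<bar> \<le> B"
  shows "\<bar>L H x - L H' x\<bar> \<le> B"
proof -
  have "L H x - L H' x = (\<Sum>e\<in>out x. p e * (H (target e) - H' (target e)))"
    by (simp add: L_def right_diff_distrib sum_subtractf)
  then show ?thesis using abs_sum_p_le assms target_in by simp
qed

lemma L_power_diff_contraction:
  assumes "x \<in> V" and "\<And>y. y \<in> V \<Longrightarrow> \<bar>H y - H' y\<bar> \<le> B"
  shows "\<bar>(L ^^ k) H x - (L ^^ k) H' x\<bar> \<le> B"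
  using assms(1)
proof (induction k arbitrary: x)
  case (Suc k)
  then show ?case by (simp add: L_diff_contraction)
qed (simp add: assms(2))

text \<open>The term of order \<epsilon> vanishes at every vertex separately, by harmonicity with
  zero drift; the term of order \<epsilon>^2 still depends on the vertex. Classes are finite in
  number, so summing their constants makes the bound uniform.\<close>

lemma L_expansion:
  "\<exists>C\<ge>0. \<forall>\<epsilon> B h x. 0 \<le> \<epsilon> \<and> \<epsilon> \<le> 1 \<and> smooth_fun G h \<and> deriv_bound 3 B h \<and> x \<in> V \<longrightarrow>
    \<bar>L (\<lambda>y. h (pos \<epsilon> y)) x - h (pos \<epsilon> x) - \<epsilon>\<^sup>2 * (\<Sum>e\<in>out x. p e * second_order (d (cl e)) h (pos \<epsilon> x))\<bar> \<le> C * B * \<epsilon> ^ 3"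
proof -
  have "\<exists>C. \<forall>i. C i \<ge> 0 \<and> (\<forall>\<epsilon> B h x. 0 \<le> \<epsilon> \<and> \<epsilon> \<le> 1 \<and> smooth_fun G h \<and> deriv_bound 3 B h \<and> x \<in> carrier G \<longrightarrow>
    \<bar>h (x \<otimes> lexp G (lie_dilation \<epsilon> (d i))) - h x - \<epsilon> * left_field G (layer_part G 1 (d i)) h x
      - \<epsilon>\<^sup>2 * second_order (d i) h x\<bar> \<le> C i * B * \<epsilon> ^ 3)"
    using local_expansion by (intro choice) blast
  then obtain C where C0: "\<And>i. C i \<ge> 0" and C: "\<And>i \<epsilon> B h x. 0 \<le> \<epsilon> \<Longrightarrow> \<epsilon> \<le> 1 \<Longrightarrow> smooth_fun G h \<Longrightarrow>
     deriv_bound 3 B h \<Longrightarrow> x \<in> carrier G \<Longrightarrow>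
    \<bar>h (x \<otimes> lexp G (lie_dilation \<epsilon> (d i))) - h x - \<epsilon> * left_field G (layer_part G 1 (d i)) h x
      - \<epsilon>\<^sup>2 * second_order (d i) h x\<bar> \<le> C i * B * \<epsilon> ^ 3"
    by blast
  have "\<bar>L (\<lambda>y. h (pos \<epsilon> y)) x - h (pos \<epsilon> x) - \<epsilon>\<^sup>2 * (\<Sum>e\<in>out x. p e * second_order (d (cl e)) h (pos \<epsilon> x))\<bar> \<le> (\<Sum>i\<in>E. C i) * B * \<epsilon> ^ 3"
    if e: "0 \<le> \<epsilon>" "\<epsilon> \<le> 1" and h: "smooth_fun G h" and B: "deriv_bound 3 B h" and x: "x \<in> V" for \<epsilon> B h x
  proof -
    have B0: "B \<ge> 0" using B by (rule deriv_bound_nonneg)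
    let ?g = "pos \<epsilon> x"
    have "(\<Sum>e\<in>out x. p e * left_field G (layer_part G 1 (d (cl e))) h ?g) = left_field G 0 h ?g"
      using left_field_sum_vector [OF h, of ?g p "\<lambda>e. layer_part G 1 (d (cl e))" "out x"] by (simp add: step_centered x)
    also have "\<dots> = 0" using left_field_scaleR [OF h, of ?g 0 0] by simp
    finally have cen: "(\<Sum>e\<in>out x. p e * left_field G (layer_part G 1 (d (cl e))) h ?g) = 0" .
    have "L (\<lambda>y. h (pos \<epsilon> y)) x = (\<Sum>e\<in>out x. p e * h (?g \<otimes> lexp G (lie_dilation \<epsilon> (d (cl e)))))"
      using pos_step [OF x] by (simp add: L_def)
    moreover have "h ?g = (\<Sum>e\<in>out x. p e * h ?g)" using sum_p [OF x] by (simp flip: sum_distrib_right)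
    ultimately have "L (\<lambda>y. h (pos \<epsilon> y)) x - h ?g - \<epsilon>\<^sup>2 * (\<Sum>e\<in>out x. p e * second_order (d (cl e)) h ?g) =
      (\<Sum>e\<in>out x. p e * h (?g \<otimes> lexp G (lie_dilation \<epsilon> (d (cl e))))) - (\<Sum>e\<in>out x. p e * h ?g)
      - \<epsilon> * (\<Sum>e\<in>out x. p e * left_field G (layer_part G 1 (d (cl e))) h ?g)
      - \<epsilon>\<^sup>2 * (\<Sum>e\<in>out x. p e * second_order (d (cl e)) h ?g)"
      using cen by simp
    also have "\<dots> = (\<Sum>e\<in>out x. p e * (h (?g \<otimes> lexp G (lie_dilation \<epsilon> (d (cl e)))) - h ?g
        - \<epsilon> * left_field G (layer_part G 1 (d (cl e))) h ?g - \<epsilon>\<^sup>2 * second_order (d (cl e)) h ?g))"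
      by (simp add: right_diff_distrib sum_subtractf sum_distrib_left mult_ac)
    also have "\<bar>\<dots>\<bar> \<le> (\<Sum>i\<in>E. C i) * B * \<epsilon> ^ 3"
    proof (rule abs_sum_p_le [OF x])
      fix a assume a: "a \<in> out x"
      have "C (cl a) \<le> (\<Sum>i\<in>E. C i)"
        by (rule member_le_sum) (use cl_in [OF x a] C0 finite_E in auto)
      then have "C (cl a) * B * \<epsilon> ^ 3 \<le> (\<Sum>i\<in>E. C i) * B * \<epsilon> ^ 3"
        using B0 e by (intro mult_right_mono) auto
      then show "\<bar>h (?g \<otimes> lexp G (lie_dilation \<epsilon> (d (cl a)))) - h ?g
        - \<epsilon> * left_field G (layer_part G 1 (d (cl a))) h ?g - \<epsilon>\<^sup>2 * second_order (d (cl a)) h ?g\<bar> \<le> (\<Sum>i\<in>E. C i) * B * \<epsilon> ^ 3"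
        using C [OF e h B, of ?g "cl a"] by simp
    qed
    finally show ?thesis .
  qed
  moreover have "(\<Sum>i\<in>E. C i) \<ge> 0" using C0 by (simp add: sum_nonneg)
  ultimately show ?thesis by blast
qed

lemma sum_\<xi>_bound: "\<exists>K\<ge>0. \<forall>i\<in>E. \<forall>x\<in>V. \<bar>\<xi> i x\<bar> \<le> K"
proof -
  obtain K where K: "\<And>i x. i \<in> E \<Longrightarrow> x \<in> V \<Longrightarrow> \<bar>\<xi> i x\<bar> \<le> K" using corrector_bounded by blast
  then have "\<bar>\<xi> i x\<bar> \<le> \<bar>K\<bar>" if "i \<in> E" "x \<in> V" for i x
    using that by (meson abs_ge_self order_trans)
  then show ?thesis by (meson abs_ge_zero)
qed

lemma correction_bound:
  "\<exists>C\<ge>0. \<forall>\<epsilon> B h x. smooth_fun G h \<and> deriv_bound 2 B h \<and> x \<in> V \<longrightarrow> \<bar>correction \<epsilon> h x\<bar> \<le> C * B"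
proof -
  obtain K where K: "K \<ge> 0" "\<And>i x. i \<in> E \<Longrightarrow> x \<in> V \<Longrightarrow> \<bar>\<xi> i x\<bar> \<le> K" using sum_\<xi>_bound by blast
  define N where "N i = norm (layer_part G 2 (d i)) + (norm (layer_part G 1 (d i)))\<^sup>2" for i
  have "\<bar>correction \<epsilon> h x\<bar> \<le> (\<Sum>i\<in>E. K * N i) * B"
    if h: "smooth_fun G h" and B: "deriv_bound 2 B h" and x: "x \<in> V" for \<epsilon> B h x
  proof -
    have "\<bar>second_order (d i) h (pos \<epsilon> x)\<bar> \<le> N i * B" for i
      using deriv_boundD [OF deriv_bound_second_order [OF h, of 0 B "d i"], of "[]" "pos \<epsilon> x"] B
      by (simp add: N_def numeral_2_eq_2)
    then have "\<bar>correction \<epsilon> h x\<bar> \<le> (\<Sum>i\<in>E. K * (N i * B))"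
      unfolding correction_def
      by (intro order_trans [OF sum_abs] sum_mono) (auto simp: abs_mult intro!: mult_mono K x)
    then show ?thesis by (simp add: sum_distrib_left sum_distrib_right mult_ac)
  qed
  moreover have "(\<Sum>i\<in>E. K * N i) \<ge> 0" using K by (simp add: sum_nonneg N_def)
  ultimately show ?thesis by blast
qed

lemma correction_average:
  "\<exists>C\<ge>0. \<forall>\<epsilon> B h x. 0 \<le> \<epsilon> \<and> \<epsilon> \<le> 1 \<and> smooth_fun G h \<and> deriv_bound 3 B h \<and> x \<in> V \<longrightarrow>
    \<bar>correction \<epsilon> (average \<epsilon> h) x - correction \<epsilon> h x\<bar> \<le> C * B * \<epsilon>"
proof -
  obtain K where K: "K \<ge> 0" "\<And>i x. i \<in> E \<Longrightarrow> x \<in> V \<Longrightarrow> \<bar>\<xi> i x\<bar> \<le> K" using sum_\<xi>_bound by blast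
  have "\<exists>C. \<forall>i. C i \<ge> 0 \<and> (\<forall>\<epsilon> B h x. 0 \<le> \<epsilon> \<and> \<epsilon> \<le> 1 \<and> smooth_fun G h \<and> deriv_bound 3 B h \<and> x \<in> carrier G \<longrightarrow>
    \<bar>second_order (d i) (average \<epsilon> h) x - second_order (d i) h x\<bar> \<le> C i * B * \<epsilon>)"
    using second_order_average by (intro choice) blast
  then obtain C where C0: "\<And>i. C i \<ge> 0" and C: "\<And>i \<epsilon> B h x. 0 \<le> \<epsilon> \<Longrightarrow> \<epsilon> \<le> 1 \<Longrightarrow> smooth_fun G h \<Longrightarrow> deriv_bound 3 B h \<Longrightarrow> x \<in> carrier G \<Longrightarrow>
    \<bar>second_order (d i) (average \<epsilon> h) x - second_order (d i) h x\<bar> \<le> C i * B * \<epsilon>"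
    by blast
  have "\<bar>correction \<epsilon> (average \<epsilon> h) x - correction \<epsilon> h x\<bar> \<le> (\<Sum>i\<in>E. K * C i) * B * \<epsilon>"
    if e: "0 \<le> \<epsilon>" "\<epsilon> \<le> 1" and h: "smooth_fun G h" and B: "deriv_bound 3 B h" and x: "x \<in> V" for \<epsilon> B h x
  proof -
    have "correction \<epsilon> (average \<epsilon> h) x - correction \<epsilon> h x =
      (\<Sum>i\<in>E. \<xi> i x * (second_order (d i) (average \<epsilon> h) (pos \<epsilon> x) - second_order (d i) h (pos \<epsilon> x)))"
      by (simp add: correction_def right_diff_distrib sum_subtractf)
    also have "\<bar>\<dots>\<bar> \<le> (\<Sum>i\<in>E. K * (C i * B * \<epsilon>))"
      using C [OF e h B] by (intro order_trans [OF sum_abs] sum_mono) (auto simp: abs_mult intro!: mult_mono K x)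
    finally show ?thesis by (simp add: sum_distrib_left sum_distrib_right mult_ac)
  qed
  moreover have "(\<Sum>i\<in>E. K * C i) \<ge> 0" using K C0 by (simp add: sum_nonneg)
  ultimately show ?thesis by blast
qed

lemma L_correction:
  "\<exists>C\<ge>0. \<forall>\<epsilon> B h x. 0 \<le> \<epsilon> \<and> \<epsilon> \<le> 1 \<and> smooth_fun G h \<and> deriv_bound 3 B h \<and> x \<in> V \<longrightarrow>
    \<bar>L (correction \<epsilon> h) x - correction \<epsilon> h x - (\<Sum>e\<in>out x. p e * second_order (d (cl e)) h (pos \<epsilon> x))
      + limit_generator h (pos \<epsilon> x)\<bar> \<le> C * B * \<epsilon>"
proof -
  obtain K where K: "K \<ge> 0" "\<And>i x. i \<in> E \<Longrightarrow> x \<in> V \<Longrightarrow> \<bar>\<xi> i x\<bar> \<le> K" using sum_\<xi>_bound by blast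
  define N where "N i = norm (layer_part G 2 (d i)) + (norm (layer_part G 1 (d i)))\<^sup>2" for i
  have N: "N i \<ge> 0" for i by (simp add: N_def)
  have "\<exists>M. \<forall>i. M i \<ge> 0 \<and> (\<forall>\<epsilon>. 0 \<le> \<epsilon> \<and> \<epsilon> \<le> 1 \<longrightarrow> norm (lie_dilation \<epsilon> (d i)) \<le> M i * \<epsilon>)"
    using norm_lie_dilation_le by (intro choice) blast
  then obtain M where M0: "\<And>i. M i \<ge> 0" and M: "\<And>i \<epsilon>. 0 \<le> \<epsilon> \<Longrightarrow> \<epsilon> \<le> 1 \<Longrightarrow> norm (lie_dilation \<epsilon> (d i)) \<le> M i * \<epsilon>"
    by blast
  define Q where "Q = (\<Sum>i\<in>E. M i)"
  have Q0: "Q \<ge> 0" using M0 by (simp add: Q_def sum_nonneg)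
  have "\<bar>L (correction \<epsilon> h) x - correction \<epsilon> h x - (\<Sum>e\<in>out x. p e * second_order (d (cl e)) h (pos \<epsilon> x))
      + limit_generator h (pos \<epsilon> x)\<bar> \<le> (\<Sum>i\<in>E. K * N i * Q) * B * \<epsilon>"
    if e: "0 \<le> \<epsilon>" "\<epsilon> \<le> 1" and h: "smooth_fun G h" and B: "deriv_bound 3 B h" and x: "x \<in> V" for \<epsilon> B h x
  proof -
    have B0: "B \<ge> 0" using B by (rule deriv_bound_nonneg)
    let ?g = "pos \<epsilon> x" and ?k = "\<lambda>i. second_order (d i) h"
    have k1: "deriv_bound 1 (N i * B) (?k i)" for i
      unfolding N_def by (rule deriv_bound_second_order [OF h]) (simp add: B)
    have sm: "smooth_fun G (?k i)" for i
      by (rule smooth_fun_second_order [OF h])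
    have near: "\<bar>?k i (pos \<epsilon> (target a)) - ?k i ?g\<bar> \<le> N i * B * (Q * \<epsilon>)" if a: "a \<in> out x" for i a
    proof -
      have "\<bar>?k i (pos \<epsilon> (target a)) - ?k i ?g\<bar> \<le> N i * B * norm (lie_dilation \<epsilon> (d (cl a)))"
        unfolding pos_step [OF x a] by (rule taylor_order_1 [OF sm k1]) simp
      also have "norm (lie_dilation \<epsilon> (d (cl a))) \<le> M (cl a) * \<epsilon>" by (rule M [OF e])
      also have "M (cl a) \<le> Q"
        unfolding Q_def by (rule member_le_sum) (use cl_in [OF x a] M0 finite_E in auto)
      finally show ?thesis
        using N B0 e by (simp add: mult_left_mono mult_right_mono)
    qed
    have "L (correction \<epsilon> h) x = (\<Sum>i\<in>E. \<Sum>a\<in>out x. p a * (\<xi> i (target a) * ?k i (pos \<epsilon> (target a))))"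
      unfolding L_def correction_def sum_distrib_left by (rule sum.swap)
    also have "\<dots> = (\<Sum>i\<in>E. \<Sum>a\<in>out x. p a * (\<xi> i (target a) * (?k i (pos \<epsilon> (target a)) - ?k i ?g)))
        + (\<Sum>i\<in>E. (\<Sum>a\<in>out x. p a * \<xi> i (target a)) * ?k i ?g)"
      by (simp add: right_diff_distrib sum_subtractf sum_distrib_left sum_distrib_right sum.distrib mult_ac)
    also have "(\<Sum>i\<in>E. (\<Sum>a\<in>out x. p a * \<xi> i (target a)) * ?k i ?g) =
        (\<Sum>i\<in>E. (\<xi> i x + (\<Sum>a\<in>out x. p a * (if cl a = i then 1 else 0)) - \<mu> i) * ?k i ?g)"
    proof (rule sum.cong [OF refl])
      fix i assume "i \<in> E"
      then have "(\<Sum>a\<in>out x. p a * \<xi> i (target a)) = \<xi> i x + (\<Sum>a\<in>out x. p a * (if cl a = i then 1 else 0)) - \<mu> i"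
        using corrector [OF x, of i] by linarith
      then show "(\<Sum>a\<in>out x. p a * \<xi> i (target a)) * ?k i ?g =
          (\<xi> i x + (\<Sum>a\<in>out x. p a * (if cl a = i then 1 else 0)) - \<mu> i) * ?k i ?g"
        by simp
    qed
    also have "\<dots> = correction \<epsilon> h x + (\<Sum>i\<in>E. (\<Sum>a\<in>out x. p a * (if cl a = i then 1 else 0)) * ?k i ?g) - limit_generator h ?g"
      by (simp add: correction_def limit_generator_def algebra_simps sum.distrib sum_subtractf)
    \<comment> \<open>Weighting each class by its frequency among the edges at x is the same as
      summing over those edges.\<close>
    also have "(\<Sum>i\<in>E. (\<Sum>a\<in>out x. p a * (if cl a = i then 1 else 0)) * ?k i ?g) = (\<Sum>a\<in>out x. p a * ?k (cl a) ?g)"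
    proof -
      have "(\<Sum>i\<in>E. (\<Sum>a\<in>out x. p a * (if cl a = i then 1 else 0)) * ?k i ?g) =
          (\<Sum>a\<in>out x. \<Sum>i\<in>E. p a * (if cl a = i then ?k i ?g else 0))"
        unfolding sum_distrib_right by (subst sum.swap) (intro sum.cong, auto)
      also have "\<dots> = (\<Sum>a\<in>out x. p a * ?k (cl a) ?g)"
        using cl_in [OF x] finite_E by (intro sum.cong) (auto simp: if_distrib cong: if_cong)
      finally show ?thesis .
    qed
    finally have "L (correction \<epsilon> h) x - correction \<epsilon> h x - (\<Sum>a\<in>out x. p a * ?k (cl a) ?g) + limit_generator h ?g =
        (\<Sum>i\<in>E. \<Sum>a\<in>out x. p a * (\<xi> i (target a) * (?k i (pos \<epsilon> (target a)) - ?k i ?g)))"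
      by simp
    also have "\<bar>\<dots>\<bar> \<le> (\<Sum>i\<in>E. K * (N i * B * (Q * \<epsilon>)))"
    proof (rule order_trans [OF sum_abs], rule sum_mono, rule abs_sum_p_le [OF x])
      fix i a assume i: "i \<in> E" and a: "a \<in> out x"
      show "\<bar>\<xi> i (target a) * (?k i (pos \<epsilon> (target a)) - ?k i ?g)\<bar> \<le> K * (N i * B * (Q * \<epsilon>))"
        unfolding abs_mult using K near [OF a] i target_in [OF x a] by (intro mult_mono) auto
    qed
    finally show ?thesis by (simp add: sum_distrib_left sum_distrib_right mult_ac)
  qed
  moreover have "(\<Sum>i\<in>E. K * N i * Q) \<ge> 0" using K N Q0 by (simp add: sum_nonneg)
  ultimately show ?thesis by blast
qed

text \<open>The vertex-dependent second-order term appears in the expansion of L and in the action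
  of L on the corrector, and cancels. What remains is the averaged generator, which is the
  \<epsilon>^2 term of \<open>average\<close>; all other contributions are O(\<epsilon>^3).\<close>

lemma corrected_step:
  "\<exists>C\<ge>0. \<forall>\<epsilon> B h x. 0 \<le> \<epsilon> \<and> \<epsilon> \<le> 1 \<and> smooth_fun G h \<and> deriv_bound 3 B h \<and> x \<in> V \<longrightarrow>
    \<bar>L (corrected \<epsilon> h) x - corrected \<epsilon> (average \<epsilon> h) x\<bar> \<le> C * B * \<epsilon> ^ 3"
proof -
  obtain C1 where C1: "C1 \<ge> 0" "\<And>\<epsilon> B h x. 0 \<le> \<epsilon> \<Longrightarrow> \<epsilon> \<le> 1 \<Longrightarrow> smooth_fun G h \<Longrightarrow> deriv_bound 3 B h \<Longrightarrow> x \<in> V \<Longrightarrow>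
    \<bar>L (\<lambda>y. h (pos \<epsilon> y)) x - h (pos \<epsilon> x) - \<epsilon>\<^sup>2 * (\<Sum>e\<in>out x. p e * second_order (d (cl e)) h (pos \<epsilon> x))\<bar> \<le> C1 * B * \<epsilon> ^ 3"
    using L_expansion by blast
  obtain C2 where C2: "C2 \<ge> 0" "\<And>\<epsilon> B h x. 0 \<le> \<epsilon> \<Longrightarrow> \<epsilon> \<le> 1 \<Longrightarrow> smooth_fun G h \<Longrightarrow> deriv_bound 3 B h \<Longrightarrow> x \<in> V \<Longrightarrow>
    \<bar>L (correction \<epsilon> h) x - correction \<epsilon> h x - (\<Sum>e\<in>out x. p e * second_order (d (cl e)) h (pos \<epsilon> x))
      + limit_generator h (pos \<epsilon> x)\<bar> \<le> C2 * B * \<epsilon>"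
    using L_correction by blast
  obtain C3 where C3: "C3 \<ge> 0" "\<And>\<epsilon> B h x. 0 \<le> \<epsilon> \<Longrightarrow> \<epsilon> \<le> 1 \<Longrightarrow> smooth_fun G h \<Longrightarrow> deriv_bound 3 B h \<Longrightarrow> x \<in> V \<Longrightarrow>
    \<bar>correction \<epsilon> (average \<epsilon> h) x - correction \<epsilon> h x\<bar> \<le> C3 * B * \<epsilon>"
    using correction_average by blast
  obtain C4 where C4: "C4 \<ge> 0" "\<And>\<epsilon> B h x. 0 \<le> \<epsilon> \<Longrightarrow> \<epsilon> \<le> 1 \<Longrightarrow> smooth_fun G h \<Longrightarrow> deriv_bound 3 B h \<Longrightarrow> x \<in> carrier G \<Longrightarrow>
    \<bar>average \<epsilon> h x - h x - \<epsilon>\<^sup>2 * limit_generator h x\<bar> \<le> C4 * B * \<epsilon> ^ 3"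
    using average_expansion by blast
  have "\<bar>L (corrected \<epsilon> h) x - corrected \<epsilon> (average \<epsilon> h) x\<bar> \<le> (C1 + C2 + C3 + C4) * B * \<epsilon> ^ 3"
    if e: "0 \<le> \<epsilon>" "\<epsilon> \<le> 1" and h: "smooth_fun G h" and B: "deriv_bound 3 B h" and x: "x \<in> V" for \<epsilon> B h x
  proof -
    define g where "g = pos \<epsilon> x"
    define s where "s = (\<Sum>e\<in>out x. p e * second_order (d (cl e)) h g)"
    define r2 where "r2 = L (correction \<epsilon> h) x - correction \<epsilon> h x - s + limit_generator h g"
    define r3 where "r3 = correction \<epsilon> (average \<epsilon> h) x - correction \<epsilon> h x"
    have Lc: "L (corrected \<epsilon> h) x = L (\<lambda>y. h (pos \<epsilon> y)) x - \<epsilon>\<^sup>2 * L (correction \<epsilon> h) x"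
      by (simp add: L_def corrected_def right_diff_distrib sum_subtractf sum_distrib_left mult_ac)
    have b1: "\<bar>L (\<lambda>y. h (pos \<epsilon> y)) x - h g - \<epsilon>\<^sup>2 * s\<bar> \<le> C1 * B * \<epsilon> ^ 3"
      unfolding g_def s_def by (rule C1(2) [OF e h B x])
    have b4: "\<bar>average \<epsilon> h g - h g - \<epsilon>\<^sup>2 * limit_generator h g\<bar> \<le> C4 * B * \<epsilon> ^ 3"
      by (rule C4(2) [OF e h B]) (simp add: g_def)
    have scale: "\<bar>\<epsilon>\<^sup>2 * r\<bar> \<le> c * B * \<epsilon> ^ 3" if "\<bar>r\<bar> \<le> c * B * \<epsilon>" for r c
    proof -
      have "\<epsilon>\<^sup>2 * \<bar>r\<bar> \<le> \<epsilon>\<^sup>2 * (c * B * \<epsilon>)" using that by (intro mult_left_mono) auto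
      then show ?thesis by (simp add: abs_mult power2_eq_square power3_eq_cube mult_ac)
    qed
    have b2: "\<bar>\<epsilon>\<^sup>2 * r2\<bar> \<le> C2 * B * \<epsilon> ^ 3"
      unfolding r2_def g_def s_def by (rule scale, rule C2(2) [OF e h B x])
    have b3: "\<bar>\<epsilon>\<^sup>2 * r3\<bar> \<le> C3 * B * \<epsilon> ^ 3"
      unfolding r3_def by (rule scale, rule C3(2) [OF e h B x])
    have "L (corrected \<epsilon> h) x - corrected \<epsilon> (average \<epsilon> h) x =
      (L (\<lambda>y. h (pos \<epsilon> y)) x - h g - \<epsilon>\<^sup>2 * s) - \<epsilon>\<^sup>2 * r2 + \<epsilon>\<^sup>2 * r3 - (average \<epsilon> h g - h g - \<epsilon>\<^sup>2 * limit_generator h g)"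
      unfolding Lc corrected_def r2_def r3_def g_def by (simp add: algebra_simps)
    then have "\<bar>L (corrected \<epsilon> h) x - corrected \<epsilon> (average \<epsilon> h) x\<bar> \<le> C1 * B * \<epsilon> ^ 3 + C2 * B * \<epsilon> ^ 3 + C3 * B * \<epsilon> ^ 3 + C4 * B * \<epsilon> ^ 3"
      using b1 b2 b3 b4 by linarith
    then show ?thesis by (simp add: algebra_simps)
  qed
  then show ?thesis
    using C1(1) C2(1) C3(1) C4(1) by (intro exI [of _ "C1 + C2 + C3 + C4"]) auto
qed

text \<open>Telescoping is done with corrected functions. The corrector itself is inserted at time 0
  and removed at time k, so its size \<epsilon>^2 enters twice and does not accumulate.\<close>

lemma L_power_average:
  "\<exists>C\<ge>0. \<forall>\<epsilon> B f k x. 0 \<le> \<epsilon> \<and> \<epsilon> \<le> 1 \<and> decaying f \<and> x \<in> V \<and>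
     (\<forall>j\<le>k. deriv_bound 4 B ((average \<epsilon> ^^ j) f)) \<longrightarrow>
     \<bar>(L ^^ k) (\<lambda>y. f (pos \<epsilon> y)) x - (average \<epsilon> ^^ k) f (pos \<epsilon> x)\<bar> \<le> C * B * (\<epsilon>\<^sup>2 + real k * \<epsilon> ^ 3)"
proof -
  obtain C where C: "C \<ge> 0" "\<And>\<epsilon> B h x. 0 \<le> \<epsilon> \<Longrightarrow> \<epsilon> \<le> 1 \<Longrightarrow> smooth_fun G h \<Longrightarrow> deriv_bound 3 B h \<Longrightarrow> x \<in> V \<Longrightarrow>
    \<bar>L (corrected \<epsilon> h) x - corrected \<epsilon> (average \<epsilon> h) x\<bar> \<le> C * B * \<epsilon> ^ 3"
    using corrected_step by blast
  obtain K where K: "K \<ge> 0" "\<And>\<epsilon> B h x. smooth_fun G h \<Longrightarrow> deriv_bound 2 B h \<Longrightarrow> x \<in> V \<Longrightarrow> \<bar>correction \<epsilon> h x\<bar> \<le> K * B"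
    using correction_bound by blast
  have "\<bar>(L ^^ k) (\<lambda>y. f (pos \<epsilon> y)) x - (average \<epsilon> ^^ k) f (pos \<epsilon> x)\<bar> \<le> (2 * K + C) * B * (\<epsilon>\<^sup>2 + real k * \<epsilon> ^ 3)"
    if e: "0 \<le> \<epsilon>" "\<epsilon> \<le> 1" and f: "decaying f" and x: "x \<in> V"
      and B: "\<And>j. j \<le> k \<Longrightarrow> deriv_bound 4 B ((average \<epsilon> ^^ j) f)" for \<epsilon> B f k x
  proof -
    have B0: "B \<ge> 0" using B [of 0] by (auto intro: deriv_bound_nonneg)
    have sm: "smooth_fun G ((average \<epsilon> ^^ j) f)" for j
      by (rule decaying_smooth_fun [OF decaying_average_power [OF f]])
    have corr: "\<bar>(average \<epsilon> ^^ j) f (pos \<epsilon> y) - corrected \<epsilon> ((average \<epsilon> ^^ j) f) y\<bar> \<le> \<epsilon>\<^sup>2 * (K * B)"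
      if "j \<le> k" "y \<in> V" for j y
      using K(2) [OF sm deriv_bound_mono [OF B [OF that(1)]] that(2), of \<epsilon>]
      by (simp add: corrected_def abs_mult mult_left_mono)
    have iter: "\<bar>(L ^^ j) (corrected \<epsilon> f) y - corrected \<epsilon> ((average \<epsilon> ^^ j) f) y\<bar> \<le> real j * (C * B * \<epsilon> ^ 3)"
      if "j \<le> k" "y \<in> V" for j y
      using that
    proof (induction j arbitrary: y)
      case (Suc j)
      have "\<bar>L ((L ^^ j) (corrected \<epsilon> f)) y - L (corrected \<epsilon> ((average \<epsilon> ^^ j) f)) y\<bar> \<le> real j * (C * B * \<epsilon> ^ 3)"
        using Suc by (intro L_diff_contraction) auto
      moreover have "\<bar>L (corrected \<epsilon> ((average \<epsilon> ^^ j) f)) y - corrected \<epsilon> (average \<epsilon> ((average \<epsilon> ^^ j) f)) y\<bar> \<le> C * B * \<epsilon> ^ 3"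
        using Suc.prems by (intro C e sm deriv_bound_mono [OF B]) auto
      ultimately show ?case by (simp add: distrib_right)
    qed simp
    have "\<bar>(L ^^ k) (\<lambda>y. f (pos \<epsilon> y)) x - (L ^^ k) (corrected \<epsilon> f) x\<bar> \<le> \<epsilon>\<^sup>2 * (K * B)"
      using corr [of 0] by (intro L_power_diff_contraction x) auto
    then have "\<bar>(L ^^ k) (\<lambda>y. f (pos \<epsilon> y)) x - (average \<epsilon> ^^ k) f (pos \<epsilon> x)\<bar> \<le> 2 * (\<epsilon>\<^sup>2 * (K * B)) + real k * (C * B * \<epsilon> ^ 3)"
      using iter [OF order_refl x] corr [OF order_refl x] by linarith
    also have "\<dots> \<le> (2 * K + C) * B * (\<epsilon>\<^sup>2 + real k * \<epsilon> ^ 3)"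
      using K(1) C(1) B0 e by (simp add: algebra_simps)
    finally show ?thesis .
  qed
  then show ?thesis using C(1) K(1) by (intro exI [of _ "2 * K + C"]) auto
qed

text \<open>With \<epsilon>^2 = 1/n and k the integer part of nt, the growth factors stay below
  exp(C1 t), the k errors of order \<epsilon>^3 sum to at most a constant times t \<epsilon>, and
  the time defect t - k \<epsilon>^2 is at most \<epsilon>^2.\<close>

theorem L_power_rate:
  assumes f: "decaying f" and t: "0 < t"
  shows "\<exists>C>0. \<forall>n::nat. 1 \<le> n \<longrightarrow> (\<forall>x\<in>V.
    \<bar>(L ^^ nat \<lfloor>real n * t\<rfloor>) (\<lambda>y. f (pos (1 / sqrt (real n)) y)) x - T t f (pos (1 / sqrt (real n)) x)\<bar>
      \<le> C / sqrt (real n))"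
proof -
  obtain B where B: "deriv_bound 4 B f" using decaying_deriv_bound [OF f] by blast
  have B0: "B \<ge> 0" using B by (rule deriv_bound_nonneg)
  obtain C1 where C1: "C1 \<ge> 0" "\<And>\<epsilon> k. 0 \<le> \<epsilon> \<Longrightarrow> \<epsilon> \<le> 1 \<Longrightarrow> deriv_bound 4 (17 * B * (1 + C1 * \<epsilon>\<^sup>2) ^ k) ((average \<epsilon> ^^ k) f)"
    using average_power_deriv_bound f B by blast
  obtain C2 where C2: "C2 \<ge> 0" "\<And>\<epsilon> B f k x. 0 \<le> \<epsilon> \<Longrightarrow> \<epsilon> \<le> 1 \<Longrightarrow> decaying f \<Longrightarrow> x \<in> carrier G \<Longrightarrow>
     (\<forall>j<k. deriv_bound 4 B ((average \<epsilon> ^^ j) f)) \<Longrightarrow>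
     \<bar>(average \<epsilon> ^^ k) f x - T (real k * \<epsilon>\<^sup>2) f x\<bar> \<le> real k * (C2 * B * \<epsilon> ^ 3)"
    using average_power_T by blast
  obtain C3 where C3: "C3 \<ge> 0" "\<And>\<epsilon> B f k x. 0 \<le> \<epsilon> \<Longrightarrow> \<epsilon> \<le> 1 \<Longrightarrow> decaying f \<Longrightarrow> x \<in> V \<Longrightarrow>
     (\<forall>j\<le>k. deriv_bound 4 B ((average \<epsilon> ^^ j) f)) \<Longrightarrow>
     \<bar>(L ^^ k) (\<lambda>y. f (pos \<epsilon> y)) x - (average \<epsilon> ^^ k) f (pos \<epsilon> x)\<bar> \<le> C3 * B * (\<epsilon>\<^sup>2 + real k * \<epsilon> ^ 3)"
    using L_power_average by blast
  obtain K where K: "K \<ge> 0" "\<And>y. y \<in> carrier G \<Longrightarrow> \<bar>limit_generator f y\<bar> \<le> K"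
    using decaying_bounded [OF decaying_limit_generator [OF f]] by blast
  define B' where "B' = 17 * B * exp (C1 * t)"
  have B'0: "B' \<ge> 0" using B0 by (simp add: B'_def)
  \<comment> \<open>The summands stem from walk versus average, average versus semigroup, and the
    time defect; the 1 only secures strict positivity.\<close>
  define C where "C = C3 * B' * (1 + t) + t * (C2 * B') + K + 1"
  have "C > 0" using C2 C3 B'0 t K by (simp add: C_def add_nonneg_pos)
  moreover have "\<bar>(L ^^ nat \<lfloor>real n * t\<rfloor>) (\<lambda>y. f (pos (1 / sqrt (real n)) y)) x - T t f (pos (1 / sqrt (real n)) x)\<bar>
      \<le> C / sqrt (real n)" if n: "1 \<le> n" and x: "x \<in> V" for n x
  proof -
    define \<epsilon> where "\<epsilon> = 1 / sqrt (real n)"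
    define k where "k = nat \<lfloor>real n * t\<rfloor>"
    have e: "0 \<le> \<epsilon>" "\<epsilon> \<le> 1" "\<epsilon>\<^sup>2 = 1 / real n" using n by (auto simp: \<epsilon>_def power_divide)
    have k: "real k \<le> real n * t" "real n * t \<le> real k + 1"
      unfolding k_def using t by (auto simp: of_nat_nat)
    have kt: "real k * \<epsilon>\<^sup>2 \<le> t" "t \<le> real k * \<epsilon>\<^sup>2 + \<epsilon>\<^sup>2"
      using k n unfolding e(3) by (auto simp: field_simps)
    have bd: "deriv_bound 4 B' ((average \<epsilon> ^^ j) f)" if "j \<le> k" for j
    proof -
      have "(1 + C1 * \<epsilon>\<^sup>2) ^ j \<le> exp (C1 * \<epsilon>\<^sup>2) ^ j"
        using C1(1) by (intro power_mono exp_ge_add_one_self) auto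
      also have "\<dots> = exp (C1 * (real j * \<epsilon>\<^sup>2))" by (simp add: mult_ac flip: exp_of_nat_mult)
      also have "\<dots> \<le> exp (C1 * t)"
      proof -
        have "real j * \<epsilon>\<^sup>2 \<le> real k * \<epsilon>\<^sup>2" using that by (intro mult_right_mono) auto
        then show ?thesis using kt(1) C1(1) by (simp add: mult_left_mono)
      qed
      finally have "17 * B * (1 + C1 * \<epsilon>\<^sup>2) ^ j \<le> B'"
        unfolding B'_def using B0 by (intro mult_left_mono) auto
      then have "17 * B * (1 + C1 * \<epsilon>\<^sup>2) ^ j * prod_list (map norm us) \<le> B' * prod_list (map norm us)" for us :: "'l list"
        by (intro mult_right_mono prod_list_nonneg) auto
      then show ?thesis
        using C1(2) [OF e(1,2), of j] unfolding deriv_bound_def by (meson order_trans)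
    qed
    have "\<epsilon>\<^sup>2 \<le> \<epsilon>" using e power_decreasing [of 1 2 \<epsilon>] by simp
    have ke3: "real k * \<epsilon> ^ 3 \<le> t * \<epsilon>"
    proof -
      have "real k * \<epsilon> ^ 3 = (real k * \<epsilon>\<^sup>2) * \<epsilon>" by (simp add: power2_eq_square power3_eq_cube)
      also have "\<dots> \<le> t * \<epsilon>" using kt(1) e(1) by (rule mult_right_mono)
      finally show ?thesis .
    qed
    let ?g = "pos \<epsilon> x"
    have 1: "\<bar>(L ^^ k) (\<lambda>y. f (pos \<epsilon> y)) x - (average \<epsilon> ^^ k) f ?g\<bar> \<le> C3 * B' * (\<epsilon> + t * \<epsilon>)"
    proof -
      have "\<bar>(L ^^ k) (\<lambda>y. f (pos \<epsilon> y)) x - (average \<epsilon> ^^ k) f ?g\<bar> \<le> C3 * B' * (\<epsilon>\<^sup>2 + real k * \<epsilon> ^ 3)"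
        using bd by (intro C3(2) e f x) auto
      also have "\<dots> \<le> C3 * B' * (\<epsilon> + t * \<epsilon>)"
        using \<open>\<epsilon>\<^sup>2 \<le> \<epsilon>\<close> ke3 C3(1) B'0 by (intro mult_left_mono add_mono) auto
      finally show ?thesis .
    qed
    have 2: "\<bar>(average \<epsilon> ^^ k) f ?g - T (real k * \<epsilon>\<^sup>2) f ?g\<bar> \<le> (C2 * B') * (t * \<epsilon>)"
    proof -
      have "\<bar>(average \<epsilon> ^^ k) f ?g - T (real k * \<epsilon>\<^sup>2) f ?g\<bar> \<le> real k * (C2 * B' * \<epsilon> ^ 3)"
        using bd by (intro C2(2) e f) auto
      also have "\<dots> = (C2 * B') * (real k * \<epsilon> ^ 3)" by simp
      also have "\<dots> \<le> (C2 * B') * (t * \<epsilon>)"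
        using ke3 C2(1) B'0 by (intro mult_left_mono) auto
      finally show ?thesis .
    qed
    have 3: "\<bar>T t f ?g - T (real k * \<epsilon>\<^sup>2) f ?g\<bar> \<le> \<epsilon> * K"
    proof -
      have "\<bar>T t f ?g - T (real k * \<epsilon>\<^sup>2) f ?g\<bar> \<le> (t - real k * \<epsilon>\<^sup>2) * K"
        using kt(1) by (intro T_time_change f K) auto
      also have "\<dots> \<le> \<epsilon> * K"
        using kt(2) \<open>\<epsilon>\<^sup>2 \<le> \<epsilon>\<close> K(1) by (intro mult_right_mono) auto
      finally show ?thesis .
    qed
    have "\<bar>(L ^^ k) (\<lambda>y. f (pos \<epsilon> y)) x - T t f ?g\<bar> \<le> C3 * B' * (\<epsilon> + t * \<epsilon>) + (C2 * B') * (t * \<epsilon>) + \<epsilon> * K"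
      using 1 2 3 by linarith
    also have "\<dots> \<le> C * \<epsilon>" using e(1) by (simp add: C_def algebra_simps)
    finally show ?thesis by (simp add: k_def \<epsilon>_def)
  qed
  ultimately show ?thesis by blast
qed

end

section \<open>The drift of a random walk\<close>

text \<open>Paths are lists of vertices, as \<open>random_walk\<close> fixes cylinder probabilities
  of vertex sequences. Taking images under \<open>head X\<close> merges parallel edges.\<close>

primrec walk_paths :: "('v, 'e) pre_digraph \<Rightarrow> 'v \<Rightarrow> nat \<Rightarrow> 'v list set" where
  "walk_paths X x 0 = {[x]}"
| "walk_paths X x (Suc n) =
     (\<lambda>(xs, y). xs @ [y]) ` (SIGMA xs:walk_paths X x n. head X ` out_arcs X (last xs))"

lemma sum_walk_paths_Suc:
  "(\<Sum>xs\<in>walk_paths X x (Suc n). f xs) = (\<Sum>xs\<in>walk_paths X x n. \<Sum>y\<in>head X ` out_arcs X (last xs). f (xs @ [y]))"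
  if fin: "finite (walk_paths X x n)" "\<And>xs. xs \<in> walk_paths X x n \<Longrightarrow> finite (out_arcs X (last xs))"
  for f :: "'v list \<Rightarrow> 'b::comm_monoid_add"
proof -
  have "inj_on (\<lambda>(xs, y). xs @ [y]) A" for A :: "('v list \<times> 'v) set"
    by (auto simp: inj_on_def)
  then have "(\<Sum>xs\<in>walk_paths X x (Suc n). f xs) =
      (\<Sum>(xs, y)\<in>(SIGMA xs:walk_paths X x n. head X ` out_arcs X (last xs)). f (xs @ [y]))"
    by (simp add: sum.reindex case_prod_unfold)
  also have "\<dots> = (\<Sum>xs\<in>walk_paths X x n. \<Sum>y\<in>head X ` out_arcs X (last xs). f (xs @ [y]))"
    using fin by (intro sum.Sigma [symmetric]) auto
  finally show ?thesis .
qed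

text \<open>The finitely many vertex paths of each length carry probability 1, so the expectation of
  \<theta>(w n) is a finite sum and equals \<theta>(x) + n v. After division by n it tends to v; the
  bound |\<theta>(w n)| \<le> |\<theta>(x)| + n K lets the almost sure limit 0 pass to the
  expectation.\<close>

lemma random_walk_drift_eq_0:
  fixes X :: "('v, 'e) pre_digraph" and \<theta> :: "'v \<Rightarrow> 'l::euclidean_space"
  assumes rw: "random_walk X p x M w"
    and fo: "\<And>x. x \<in> verts X \<Longrightarrow> finite (out_arcs X x)"
    and wf: "\<And>e. e \<in> arcs X \<Longrightarrow> head X e \<in> verts X"
    and p1: "\<And>x. x \<in> verts X \<Longrightarrow> (\<Sum>e\<in>out_arcs X x. p e) = 1"
    and drift: "\<And>x. x \<in> verts X \<Longrightarrow> (\<Sum>e\<in>out_arcs X x. p e *\<^sub>R \<theta> (head X e)) = \<theta> x + v"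
    and K: "\<And>e. e \<in> arcs X \<Longrightarrow> norm (\<theta> (head X e) - \<theta> (tail X e)) \<le> K"
    and lim: "AE \<omega> in M. (\<lambda>n. (1 / real n) *\<^sub>R \<theta> (w n \<omega>)) \<longlonglongrightarrow> 0"
  shows "v = 0"
proof -
  interpret prob_space M using rw by (simp add: random_walk_def)
  have w: "w n \<in> measurable M (count_space (verts X))" for n
    using rw by (simp add: random_walk_def)
  have x: "x \<in> verts X" and w0: "AE \<omega> in M. w 0 \<omega> = x" using rw by (simp_all add: random_walk_def)
  let ?W = "walk_paths X x"
  define A where "A xs = {\<omega> \<in> space M. \<forall>k<length xs. w k \<omega> = xs ! k}" for xs
  have W: "xs \<in> ?W n \<Longrightarrow> length xs = Suc n \<and> set xs \<subseteq> verts X" for xs n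
    by (induction n arbitrary: xs) (use x wf in \<open>force simp: out_arcs_def\<close>)+
  have last_in: "last xs \<in> verts X" if "xs \<in> ?W n" for xs n
    using W [OF that] by (metis Zero_not_Suc last_in_set list.size(3) subsetD)
  have finW: "finite (?W n)" for n
    by (induction n) (auto intro!: finite_SigmaI fo last_in)
  have A_sets: "A xs \<in> sets M" if "set xs \<subseteq> verts X" for xs
  proof -
    have "{\<omega> \<in> space M. w k \<omega> = xs ! k} \<in> sets M" if "k < length xs" for k
    proof -
      have "w k -` {xs ! k} \<inter> space M \<in> sets M"
        using that \<open>set xs \<subseteq> verts X\<close> nth_mem [OF that] by (intro measurable_sets [OF w]) auto
      moreover have "w k -` {xs ! k} \<inter> space M = {\<omega> \<in> space M. w k \<omega> = xs ! k}" by auto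
      ultimately show ?thesis by simp
    qed
    then have "{\<omega> \<in> space M. \<forall>k\<in>{..<length xs}. w k \<omega> = xs ! k} \<in> sets M"
      by (intro sets.sets_Collect_finite_All) auto
    moreover have "{\<omega> \<in> space M. \<forall>k\<in>{..<length xs}. w k \<omega> = xs ! k} = A xs"
      by (auto simp: A_def)
    ultimately show ?thesis by simp
  qed
  have step: "prob (A (xs @ [y])) = prob (A xs) * (\<Sum>e\<in>{e \<in> out_arcs X (last xs). head X e = y}. p e)"
    if xs: "xs \<in> ?W n" and y: "y \<in> verts X" for xs y n
  proof -
    \<comment> \<open>The transition law is stated for infinite sequences; the path is continued by
      the constant y, and only times up to \<open>Suc n\<close> are evaluated.\<close>
    let ?s = "\<lambda>k. if k < length xs then xs ! k else y"
    have len: "length xs = Suc n" "set xs \<subseteq> verts X" using W [OF xs] by auto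
    then have "range ?s \<subseteq> verts X" using y nth_mem by fastforce
    then have "measure M {\<omega> \<in> space M. \<forall>k\<le>Suc n. w k \<omega> = ?s k} =
        measure M {\<omega> \<in> space M. \<forall>k\<le>n. w k \<omega> = ?s k} *
          (\<Sum>e\<in>{e \<in> out_arcs X (?s n). head X e = ?s (Suc n)}. p e)"
      using rw unfolding random_walk_def by blast
    moreover have "{\<omega> \<in> space M. \<forall>k\<le>Suc n. w k \<omega> = ?s k} = A (xs @ [y])"
      using len by (auto simp: A_def nth_append less_Suc_eq_le)
    moreover have "{\<omega> \<in> space M. \<forall>k\<le>n. w k \<omega> = ?s k} = A xs"
      using len by (auto simp: A_def less_Suc_eq_le)
    moreover have "?s n = last xs" "?s (Suc n) = y"
      using len last_conv_nth [of xs] by force+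
    ultimately show ?thesis by simp
  qed
  define S where "S n f = (\<Sum>xs\<in>?W n. prob (A xs) *\<^sub>R f (last xs))" for n and f :: "'v \<Rightarrow> 'l"
  define S1 where "S1 n = (\<Sum>xs\<in>?W n. prob (A xs))" for n
  \<comment> \<open>A transition probability between vertices sums over parallel edges, whereas the
    drift hypothesis sums over edges.\<close>
  have regroup: "(\<Sum>y\<in>head X ` out_arcs X z. (\<Sum>e\<in>{e \<in> out_arcs X z. head X e = y}. p e) *\<^sub>R f y) =
      (\<Sum>e\<in>out_arcs X z. p e *\<^sub>R f (head X e))" if "z \<in> verts X" for z and f :: "'v \<Rightarrow> 'b::real_vector"
  proof -
    have "(\<Sum>e\<in>out_arcs X z. p e *\<^sub>R f (head X e)) =
        (\<Sum>y\<in>head X ` out_arcs X z. \<Sum>e\<in>{e \<in> out_arcs X z. head X e = y}. p e *\<^sub>R f (head X e))"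
      by (rule sum.image_gen [OF fo [OF that]])
    also have "\<dots> = (\<Sum>y\<in>head X ` out_arcs X z. (\<Sum>e\<in>{e \<in> out_arcs X z. head X e = y}. p e) *\<^sub>R f y)"
      unfolding scaleR_sum_left by (intro sum.cong) auto
    finally show ?thesis by simp
  qed
  have Suc_sum: "(\<Sum>xs\<in>?W (Suc n). prob (A xs) *\<^sub>R f (last xs)) =
      (\<Sum>xs\<in>?W n. prob (A xs) *\<^sub>R (\<Sum>e\<in>out_arcs X (last xs). p e *\<^sub>R f (head X e)))"
    for n and f :: "'v \<Rightarrow> 'b::real_vector"
  proof -
    have "(\<Sum>xs\<in>?W (Suc n). prob (A xs) *\<^sub>R f (last xs)) =
        (\<Sum>xs\<in>?W n. \<Sum>y\<in>head X ` out_arcs X (last xs). prob (A (xs @ [y])) *\<^sub>R f y)"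
      by (subst sum_walk_paths_Suc) (auto intro: finW fo last_in)
    also have "\<dots> = (\<Sum>xs\<in>?W n. prob (A xs) *\<^sub>R (\<Sum>e\<in>out_arcs X (last xs). p e *\<^sub>R f (head X e)))"
    proof (rule sum.cong [OF refl])
      fix xs assume xs: "xs \<in> ?W n"
      have "(\<Sum>y\<in>head X ` out_arcs X (last xs). prob (A (xs @ [y])) *\<^sub>R f y) =
          (\<Sum>y\<in>head X ` out_arcs X (last xs). prob (A xs) *\<^sub>R ((\<Sum>e\<in>{e \<in> out_arcs X (last xs). head X e = y}. p e) *\<^sub>R f y))"
        using wf by (intro sum.cong) (auto simp: step [OF xs])
      also have "\<dots> = prob (A xs) *\<^sub>R (\<Sum>e\<in>out_arcs X (last xs). p e *\<^sub>R f (head X e))"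
        by (simp only: scaleR_sum_right [symmetric] regroup [OF last_in [OF xs]])
      finally show "(\<Sum>y\<in>head X ` out_arcs X (last xs). prob (A (xs @ [y])) *\<^sub>R f y) =
          prob (A xs) *\<^sub>R (\<Sum>e\<in>out_arcs X (last xs). p e *\<^sub>R f (head X e))" .
    qed
    finally show ?thesis .
  qed
  have A0: "prob (A [x]) = 1"
  proof -
    have "AE \<omega> in M. \<omega> \<in> A [x]" using w0 AE_space by eventually_elim (simp add: A_def)
    then show ?thesis using x by (subst prob_eq_1) (auto intro: A_sets)
  qed
  have S1: "S1 n = 1" for n
  proof (induction n)
    case (Suc n)
    have "S1 (Suc n) = (\<Sum>xs\<in>?W n. prob (A xs) *\<^sub>R (\<Sum>e\<in>out_arcs X (last xs). p e *\<^sub>R 1))"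
      using Suc_sum [of "\<lambda>_. 1::real" n] by (simp add: S1_def)
    also have "\<dots> = S1 n"
      unfolding S1_def by (intro sum.cong) (auto simp: p1 last_in)
    finally show ?case using Suc by simp
  qed (simp add: S1_def A0)
  have S\<theta>: "S n \<theta> = \<theta> x + real n *\<^sub>R v" for n
  proof (induction n)
    case (Suc n)
    have "S (Suc n) \<theta> = (\<Sum>xs\<in>?W n. prob (A xs) *\<^sub>R (\<theta> (last xs) + v))"
      unfolding S_def Suc_sum by (intro sum.cong) (auto simp: drift last_in)
    also have "\<dots> = S n \<theta> + S1 n *\<^sub>R v"
      by (simp add: S_def S1_def scaleR_add_right sum.distrib scaleR_sum_left)
    finally show ?case using Suc by (simp add: S1 algebra_simps)
  qed (simp add: S_def A0)
  have disj: "disjoint_family_on A (?W n)" for n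
  proof (unfold disjoint_family_on_def, intro ballI impI)
    fix xs ys assume "xs \<in> ?W n" "ys \<in> ?W n" "xs \<noteq> ys"
    moreover from this have "\<exists>k<length xs. xs ! k \<noteq> ys ! k"
      using W nth_equalityI by metis
    ultimately show "A xs \<inter> A ys = {}" using W by (fastforce simp: A_def)
  qed
  have path: "AE \<omega> in M. \<exists>xs\<in>?W n. \<omega> \<in> A xs" for n
  proof -
    have "prob (\<Union>xs\<in>?W n. A xs) = S1 n"
      unfolding S1_def using W by (intro finite_measure_finite_Union finW disj) (auto intro: A_sets)
    then have "AE \<omega> in M. \<omega> \<in> (\<Union>xs\<in>?W n. A xs)"
      using W by (subst (asm) S1, subst (asm) prob_eq_1) (auto intro!: A_sets finW sets.finite_UN)
    then show ?thesis by simp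
  qed
  have wlast: "w n \<omega> = last xs" if "xs \<in> ?W n" "\<omega> \<in> A xs" for n \<omega> xs
    using W [OF that(1)] that(2) last_conv_nth [of xs] by (force simp: A_def)
  have bound: "norm (\<theta> (last xs)) \<le> norm (\<theta> x) + real n * K" if "xs \<in> ?W n" for xs n
    using that
  proof (induction n arbitrary: xs)
    case (Suc n)
    then obtain ys e where ys: "ys \<in> ?W n" "e \<in> out_arcs X (last ys)" "xs = ys @ [head X e]" by auto
    have "norm (\<theta> (head X e)) \<le> norm (\<theta> (last ys)) + K"
      using K [of e] ys(2) norm_triangle_sub [of "\<theta> (head X e)" "\<theta> (last ys)"] by auto
    then show ?case using Suc.IH [OF ys(1)] ys(3) by (simp add: algebra_simps)
  qed simp
  have E: "(\<integral>\<omega>. \<theta> (w n \<omega>) \<partial>M) = S n \<theta>" for n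
  proof -
    have "AE \<omega> in M. \<theta> (w n \<omega>) = (\<Sum>xs\<in>?W n. indicator (A xs) \<omega> *\<^sub>R \<theta> (last xs))"
      using path [of n]
    proof eventually_elim
      case (elim \<omega>)
      then obtain xs where xs: "xs \<in> ?W n" "\<omega> \<in> A xs" by blast
      have "indicator (A ys) \<omega> *\<^sub>R \<theta> (last ys) = (if ys = xs then \<theta> (last xs) else 0)" if "ys \<in> ?W n" for ys
        using disjoint_family_onD [OF disj that xs(1)] xs(2) by (auto simp: indicator_def)
      then have "(\<Sum>ys\<in>?W n. indicator (A ys) \<omega> *\<^sub>R \<theta> (last ys)) = (\<Sum>ys\<in>?W n. if ys = xs then \<theta> (last xs) else 0)"
        by (rule sum.cong [OF refl])
      then show ?case using finW xs wlast by simp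
    qed
    moreover have "(\<lambda>\<omega>. \<theta> (w n \<omega>)) \<in> borel_measurable M"
      by (rule measurable_compose [OF w]) simp
    moreover have meas: "(\<lambda>\<omega>. indicator (A xs) \<omega> *\<^sub>R \<theta> (last xs)) \<in> borel_measurable M" if "xs \<in> ?W n" for xs
      using A_sets W [OF that] by (intro borel_measurable_scaleR borel_measurable_indicator) auto
    ultimately have "(\<integral>\<omega>. \<theta> (w n \<omega>) \<partial>M) = (\<integral>\<omega>. (\<Sum>xs\<in>?W n. indicator (A xs) \<omega> *\<^sub>R \<theta> (last xs)) \<partial>M)"
      by (intro integral_cong_AE borel_measurable_sum) auto
    also have "\<dots> = (\<Sum>xs\<in>?W n. \<integral>\<omega>. indicator (A xs) \<omega> *\<^sub>R \<theta> (last xs) \<partial>M)"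
      using A_sets W by (intro Bochner_Integration.integral_sum integrable_scaleR_left integrable_real_indicator)
        (auto simp: emeasure_eq_measure)
    also have "\<dots> = S n \<theta>"
      unfolding S_def using A_sets W
      by (intro sum.cong) (auto simp: integral_scaleR_left sets.Int_space_eq2 emeasure_eq_measure)
    finally show ?thesis .
  qed
  \<comment> \<open>Nonnegativity of K is needed for the dominating function at n = 0, where
    \<open>1 / real n\<close> is 0. Arcs exist because the outgoing probabilities at x sum to
    1.\<close>
  have "0 \<le> K \<or> arcs X = {}" using K norm_ge_zero order_trans by (metis all_not_in_conv)
  moreover have "arcs X \<noteq> {}" using p1 [OF x] by (auto simp: out_arcs_def)
  ultimately have K0: "0 \<le> K" by simp
  have "(\<lambda>n. \<integral>\<omega>. (1 / real n) *\<^sub>R \<theta> (w n \<omega>) \<partial>M) \<longlonglongrightarrow> (\<integral>\<omega>. 0 \<partial>M)"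
  proof (rule integral_dominated_convergence [where w = "\<lambda>_. norm (\<theta> x) + K"])
    show "(\<lambda>\<omega>. (1 / real n) *\<^sub>R \<theta> (w n \<omega>)) \<in> borel_measurable M" for n
      by (intro borel_measurable_scaleR measurable_compose [OF w]) auto
    show "AE \<omega> in M. norm ((1 / real n) *\<^sub>R \<theta> (w n \<omega>)) \<le> norm (\<theta> x) + K" for n
      using path [of n]
    proof eventually_elim
      case (elim \<omega>)
      then obtain xs where xs: "xs \<in> ?W n" "\<omega> \<in> A xs" by blast
      show ?case
      proof (cases "n = 0")
        case False
        have "norm ((1 / real n) *\<^sub>R \<theta> (w n \<omega>)) \<le> (1 / real n) * (norm (\<theta> x) + real n * K)"
          using bound [OF xs(1)] wlast [OF xs] by (simp add: divide_right_mono)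
        also have "\<dots> = norm (\<theta> x) / real n + K" using False by (simp add: field_simps)
        also have "norm (\<theta> x) / real n \<le> norm (\<theta> x)"
          using False by (simp add: divide_le_eq mult_le_cancel_left1)
        finally show ?thesis by simp
      qed (simp add: K0)
    qed
  qed (use lim in auto)
  then have "(\<lambda>n. (1 / real n) *\<^sub>R (\<theta> x + real n *\<^sub>R v)) \<longlonglongrightarrow> 0"
    by (simp add: E S\<theta>)
  moreover have "(\<lambda>n. (1 / real n) *\<^sub>R \<theta> x + v) \<longlonglongrightarrow> 0 *\<^sub>R \<theta> x + v"
    by (intro tendsto_intros lim_1_over_n)
  then have "(\<lambda>n. (1 / real n) *\<^sub>R \<theta> x + v) \<longlonglongrightarrow> v"
    by simp
  then have "(\<lambda>n. (1 / real n) *\<^sub>R (\<theta> x + real n *\<^sub>R v)) \<longlonglongrightarrow> v"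
    by (rule Lim_transform_eventually)
      (rule eventually_mono [OF eventually_gt_at_top [of 0]], simp add: scaleR_add_right)
  ultimately show ?thesis using LIMSEQ_unique by blast
qed

section \<open>The quotient graph\<close>

lemma orbit_eq_image: "Group_Action.orbit G \<phi> x = (\<lambda>g. \<phi> g x) ` carrier G"
  by (auto simp: Group_Action.orbit_def)

lemma (in group_action) orbit_image_eq:
  assumes g: "g \<in> carrier G" and x: "x \<in> E"
  shows "Group_Action.orbit G \<phi> (\<phi> g x) = Group_Action.orbit G \<phi> x"
proof -
  interpret group G using group_hom group_hom.axioms(1) by auto
  show ?thesis
  proof
    show "Group_Action.orbit G \<phi> (\<phi> g x) \<subseteq> Group_Action.orbit G \<phi> x"
      unfolding Group_Action.orbit_def using composition_rule [OF x _ g] g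
      by clarsimp (metis m_closed)
    show "Group_Action.orbit G \<phi> x \<subseteq> Group_Action.orbit G \<phi> (\<phi> g x)"
    proof
      fix y assume "y \<in> Group_Action.orbit G \<phi> x"
      then obtain h where h: "h \<in> carrier G" "y = \<phi> h x" by (auto simp: Group_Action.orbit_def)
      have "\<phi> (h \<otimes> inv g) (\<phi> g x) = \<phi> (h \<otimes> inv g \<otimes> g) x"
        using composition_rule [OF x _ g, of "h \<otimes> inv g"] h g by simp
      also have "\<dots> = y" using h g by (simp add: m_assoc)
      finally show "y \<in> Group_Action.orbit G \<phi> (\<phi> g x)"
        unfolding Group_Action.orbit_def using h g by blast
    qed
  qed
qed

lemma (in group_action) orbit_eqD:
  assumes "Group_Action.orbit G \<phi> x = Group_Action.orbit G \<phi> y" "y \<in> E"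
  shows "\<exists>g\<in>carrier G. y = \<phi> g x"
proof -
  have "y \<in> Group_Action.orbit G \<phi> y" using assms(2) by (rule orbit_refl)
  then show ?thesis using assms(1) by (auto simp: Group_Action.orbit_def)
qed

context nilpotent_covering_graph
begin

abbreviation X0 where
  "X0 \<equiv> quotient_graph \<Gamma> X \<phi> \<psi>"

abbreviation vorbit where "vorbit \<equiv> Group_Action.orbit \<Gamma> \<phi>"
abbreviation eorbit where "eorbit \<equiv> Group_Action.orbit \<Gamma> \<psi>"

lemma verts_X0: "verts X0 = vorbit ` verts X"
  by (auto simp: quotient_graph_def orbits_def)

lemma arcs_X0: "arcs X0 = eorbit ` arcs X"
  by (auto simp: quotient_graph_def orbits_def)

lemma tail_X0: "e \<in> arcs X \<Longrightarrow> tail X0 (eorbit e) = vorbit (tail X e)"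
  using tail_equivariant by (simp add: quotient_graph_def orbit_eq_image image_image cong: image_cong_simp)

lemma head_X0: "e \<in> arcs X \<Longrightarrow> head X0 (eorbit e) = vorbit (head X e)"
  using head_equivariant by (simp add: quotient_graph_def orbit_eq_image image_image cong: image_cong_simp)

lemma rev_X0: "e \<in> arcs X \<Longrightarrow> quotient_rev arev (eorbit e) = eorbit (arev e)"
  using rev_equivariant by (simp add: quotient_rev_def orbit_eq_image image_image cong: image_cong_simp)

text \<open>The chosen representative is a translate of e, so invariant edge functions may be
  evaluated on it.\<close>

lemma lift_eorbit: "e \<in> arcs X \<Longrightarrow> \<exists>\<gamma>\<in>carrier \<Gamma>. lift (eorbit e) = \<psi> \<gamma> e"
proof -
  assume "e \<in> arcs X"
  then have "e \<in> eorbit e" by (rule edge_action.orbit_refl)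
  then have "lift (eorbit e) \<in> eorbit e" unfolding lift_def by (rule someI)
  then show ?thesis by (auto simp: Group_Action.orbit_def)
qed

text \<open>Two edges at x in one orbit differ by an element fixing x, which is trivial as the
  action is free; a representative of any quotient edge can be moved so as to start at x. Local sums
  and local finiteness thus pass between X and its quotient.\<close>

lemma bij_betw_out_arcs:
  assumes x: "x \<in> verts X"
  shows "bij_betw eorbit (out_arcs X x) (out_arcs X0 (vorbit x))"
  unfolding bij_betw_def
proof
  show "inj_on eorbit (out_arcs X x)"
  proof (rule inj_onI)
    fix e e' assume e: "e \<in> out_arcs X x" "e' \<in> out_arcs X x" "eorbit e = eorbit e'"
    then obtain \<gamma> where \<gamma>: "\<gamma> \<in> carrier \<Gamma>" "e' = \<psi> \<gamma> e"
      using edge_action.orbit_eqD [of e e'] by auto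
    then have "\<phi> \<gamma> x = x" using tail_equivariant [of \<gamma> e] e by auto
    then have "\<gamma> = \<one>" using free_action \<gamma> x by blast
    then show "e = e'"
      using \<gamma> e edge_action.id_eq_one by (metis in_out_arcs_conv restrict_apply')
  qed
  show "eorbit ` out_arcs X x = out_arcs X0 (vorbit x)"
  proof
    show "eorbit ` out_arcs X x \<subseteq> out_arcs X0 (vorbit x)"
      by (auto simp: arcs_X0 tail_X0)
    show "out_arcs X0 (vorbit x) \<subseteq> eorbit ` out_arcs X x"
    proof
      fix \<epsilon> assume "\<epsilon> \<in> out_arcs X0 (vorbit x)"
      then obtain e where e: "e \<in> arcs X" "\<epsilon> = eorbit e" "vorbit (tail X e) = vorbit x"
        by (auto simp: arcs_X0 tail_X0)
      then obtain \<gamma> where \<gamma>: "\<gamma> \<in> carrier \<Gamma>" "x = \<phi> \<gamma> (tail X e)"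
        using vertex_action.orbit_eqD [OF _ x] by blast
      have "\<psi> \<gamma> e \<in> arcs X" using edge_action.element_image \<gamma> e by blast
      then have "\<psi> \<gamma> e \<in> out_arcs X x" using \<gamma> e tail_equivariant by simp
      moreover have "eorbit (\<psi> \<gamma> e) = \<epsilon>" using edge_action.orbit_image_eq \<gamma> e by simp
      ultimately show "\<epsilon> \<in> eorbit ` out_arcs X x" by blast
    qed
  qed
qed

lemma sum_out_arcs_eorbit:
  assumes "x \<in> verts X"
  shows "(\<Sum>e\<in>out_arcs X x. f (eorbit e)) = (\<Sum>\<epsilon>\<in>out_arcs X0 (vorbit x). f \<epsilon>)"
  using sum.reindex_bij_betw [OF bij_betw_out_arcs [OF assms]] .

lemma finite_out_arcs:
  assumes "x \<in> verts X"
  shows "finite (out_arcs X x)"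
proof -
  have "finite (out_arcs X0 (vorbit x))"
    using finite_quotient_arcs by (simp add: out_arcs_def)
  then show ?thesis using bij_betw_finite [OF bij_betw_out_arcs [OF assms]] by blast
qed

lemma X0_wf: "\<epsilon> \<in> arcs X0 \<Longrightarrow> tail X0 \<epsilon> \<in> verts X0" "\<epsilon> \<in> arcs X0 \<Longrightarrow> head X0 \<epsilon> \<in> verts X0"
  by (auto simp: arcs_X0 verts_X0 tail_X0 head_X0)

lemma X0_rev:
  assumes "\<epsilon> \<in> arcs X0"
  shows "quotient_rev arev \<epsilon> \<in> arcs X0" "quotient_rev arev (quotient_rev arev \<epsilon>) = \<epsilon>"
    "tail X0 (quotient_rev arev \<epsilon>) = head X0 \<epsilon>" "head X0 (quotient_rev arev \<epsilon>) = tail X0 \<epsilon>"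
  using assms by (auto simp: arcs_X0 rev_X0 tail_X0 head_X0)

lemma sum_arcs_X0: "(\<Sum>\<epsilon>\<in>arcs X0. f \<epsilon>) = (\<Sum>x\<in>verts X0. \<Sum>\<epsilon>\<in>out_arcs X0 x. f \<epsilon>)"
  unfolding out_arcs_def
  by (rule sum.group [symmetric]) (use finite_quotient_arcs finite_quotient_verts X0_wf in auto)

text \<open>Invariance is given through reversed edges; reindexing all arcs by reversal exchanges
  tail and head and yields mP = m tested against h.\<close>

lemma invariant_measure_sum:
  assumes m: "invariant_measure X0 (quotient_rev arev) q m"
  shows "(\<Sum>x\<in>verts X0. m x * (\<Sum>\<epsilon>\<in>out_arcs X0 x. q \<epsilon> * h (head X0 \<epsilon>))) = (\<Sum>x\<in>verts X0. m x * h x)"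
proof -
  let ?r = "quotient_rev arev"
  have "(\<Sum>x\<in>verts X0. m x * (\<Sum>\<epsilon>\<in>out_arcs X0 x. q \<epsilon> * h (head X0 \<epsilon>))) =
      (\<Sum>\<epsilon>\<in>arcs X0. m (tail X0 \<epsilon>) * (q \<epsilon> * h (head X0 \<epsilon>)))"
    unfolding sum_arcs_X0 sum_distrib_left by (intro sum.cong) auto
  also have "\<dots> = (\<Sum>\<epsilon>\<in>arcs X0. m (head X0 \<epsilon>) * (q (?r \<epsilon>) * h (tail X0 \<epsilon>)))"
    by (rule sum.reindex_bij_witness [of _ ?r ?r]) (auto simp: X0_rev)
  also have "\<dots> = (\<Sum>x\<in>verts X0. (\<Sum>\<epsilon>\<in>out_arcs X0 x. q (?r \<epsilon>) * m (head X0 \<epsilon>)) * h x)"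
    unfolding sum_arcs_X0 sum_distrib_right by (intro sum.cong) (auto simp: mult_ac)
  also have "\<dots> = (\<Sum>x\<in>verts X0. m x * h x)"
    using m by (intro sum.cong) (auto simp: invariant_measure_def)
  finally show ?thesis .
qed

end

section \<open>The walk on the covering graph\<close>

text \<open>Expanding the layer parts in the basis produces the coefficients A and \<beta>, provided
  that the indices of weights 1 and 2 are the two initial intervals of the basis numbering.\<close>

lemma (in stratified_lie_group) generator_A_eq:
  assumes h: "decaying h" and x: "x \<in> carrier G"
  shows "generator_A G X Y mt \<Phi> h x = (\<Sum>e\<in>arcs Y. mt e * second_order (log_d G X \<Phi> (lift e)) h x)"
proof -
  let ?d1 = "layer_dim G 1" and ?d2 = "layer_dim G 2"
  have sm: "smooth_fun G h" using h by (rule decaying_smooth_fun)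
  \<comment> \<open>The basis vectors of weight k form a basis of layer k. Beyond the step both
    numbers are 0, which covers a vanishing second layer.\<close>
  have card: "card (layer_indices G k) = layer_dim G k" if "1 \<le> k" for k
  proof (cases "k \<in> {1..step G}")
    case True
    have sub: "layer_indices G k \<subseteq> {1..DIM('l)}" by (auto simp: layer_indices_def)
    have "dim (span (lie_basis G ` layer_indices G k)) = card (lie_basis G ` layer_indices G k)"
      unfolding dim_span
      by (rule dim_eq_card_independent, rule independent_mono [OF basis_independent]) (use sub in auto)
    also have "\<dots> = card (layer_indices G k)"
      by (rule card_image, rule inj_on_subset [OF basis_inj sub])
    finally show ?thesis using basis_layer [OF True] by (simp add: layer_dim_def)
  next
    case False
    then have "layer_indices G k = {}"
      using weight_in_steps by (auto simp: layer_indices_def)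
    then show ?thesis using layer_outside [OF False] by (simp add: layer_dim_def)
  qed
  have w1: "weight G i = 1" if "i \<in> {1..?d1}" for i
    unfolding weight_def
  proof (rule Least_equality)
    fix k assume "i \<le> (\<Sum>j = 1..k. layer_dim G j)"
    then show "1 \<le> k" using that by (cases k) auto
  qed (use that in simp)
  have w2: "weight G i = 2" if "i \<in> {?d1 + 1..?d1 + ?d2}" for i
    unfolding weight_def
  proof (rule Least_equality)
    show "i \<le> (\<Sum>j = 1..2. layer_dim G j)" using that by (simp add: numeral_2_eq_2 One_nat_def)
    fix k assume k: "i \<le> (\<Sum>j = 1..k. layer_dim G j)"
    show "2 \<le> k"
    proof (rule ccontr)
      assume "\<not> 2 \<le> k"
      then have "k = 0 \<or> k = 1" by auto
      then show False using k that by auto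
    qed
  qed
  have le: "?d1 + ?d2 \<le> DIM('l)"
  proof -
    have "card (layer_indices G 1 \<union> layer_indices G 2) = card (layer_indices G 1) + card (layer_indices G 2)"
      by (rule card_Un_disjoint) (auto simp: layer_indices_def)
    moreover have "card (layer_indices G 1 \<union> layer_indices G 2) \<le> card {1..DIM('l)}"
      by (rule card_mono) (auto simp: layer_indices_def)
    ultimately show ?thesis by (simp add: card)
  qed
  \<comment> \<open>The interval consists of indices of weight 1 and has as many elements as there
    are such indices.\<close>
  have I1: "layer_indices G 1 = {1..?d1}"
  proof -
    have "{1..?d1} \<subseteq> layer_indices G 1" using w1 le by (auto simp: layer_indices_def)
    moreover have "finite (layer_indices G 1)" by (simp add: layer_indices_def)
    ultimately show ?thesis using card_subset_eq card [of 1] by (metis card_atLeastAtMost diff_Suc_1 order_refl One_nat_def)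
  qed
  have I2: "layer_indices G 2 = {?d1 + 1..?d1 + ?d2}"
  proof -
    have "{?d1 + 1..?d1 + ?d2} \<subseteq> layer_indices G 2" using w2 le by (auto simp: layer_indices_def)
    moreover have "finite (layer_indices G 2)" by (simp add: layer_indices_def)
    moreover have "card {?d1 + 1..?d1 + ?d2} = card (layer_indices G 2)" by (simp add: card)
    ultimately show ?thesis by (metis card_subset_eq)
  qed
  have so: "second_order d h x = (\<Sum>i=?d1+1..?d1+?d2. lie_coord G i d * left_field G (lie_basis G i) h x) +
      1/2 * (\<Sum>i=1..?d1. \<Sum>j=1..?d1. lie_coord G i d * lie_coord G j d *
        left_field G (lie_basis G i) (left_field G (lie_basis G j) h) x)" for d
  proof -
    have "left_field G (layer_part G 2 d) h x = (\<Sum>i=?d1+1..?d1+?d2. lie_coord G i d * left_field G (lie_basis G i) h x)"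
      unfolding layer_part_def I2 by (rule left_field_sum_vector [OF sm x])
    moreover have "left_field G (layer_part G 1 d) (left_field G (layer_part G 1 d) h) x =
        (\<Sum>i=1..?d1. lie_coord G i d * left_field G (lie_basis G i) (left_field G (layer_part G 1 d) h) x)"
      unfolding layer_part_def I1 by (rule left_field_sum_vector [OF smooth_fun_left_field [OF sm] x])
    moreover have "left_field G (lie_basis G i) (left_field G (layer_part G 1 d) h) x =
        (\<Sum>j=1..?d1. lie_coord G j d * left_field G (lie_basis G i) (left_field G (lie_basis G j) h) x)" for i
      using iter_field_sum_vector [OF sm x, of "[lie_basis G i]" "\<lambda>j. lie_coord G j d" "lie_basis G" "{1..?d1}" "[]"]
      by (simp add: layer_part_def I1)
    ultimately show ?thesis
      by (simp add: second_order_def sum_distrib_left mult.assoc)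
  qed
  have "(\<Sum>e\<in>arcs Y. mt e * second_order (log_d G X \<Phi> (lift e)) h x) =
     (\<Sum>e\<in>arcs Y. \<Sum>i=?d1+1..?d1+?d2. mt e * lie_coord G i (log_d G X \<Phi> (lift e)) * left_field G (lie_basis G i) h x) +
     1/2 * (\<Sum>e\<in>arcs Y. \<Sum>i=1..?d1. \<Sum>j=1..?d1. mt e * lie_coord G i (log_d G X \<Phi> (lift e)) *
       lie_coord G j (log_d G X \<Phi> (lift e)) * left_field G (lie_basis G i) (left_field G (lie_basis G j) h) x)"
    by (simp add: so distrib_left sum.distrib sum_distrib_left mult_ac)
  also have "\<dots> = generator_A G X Y mt \<Phi> h x"
    unfolding generator_A_def Let_def coeff_A_def coeff_\<beta>_def sum_distrib_right
    by (simp add: sum.swap [of _ _ "arcs Y"])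
  finally show ?thesis by simp
qed

text \<open>The vector \<open>v\<close> stands for the image of the homological direction. It is
  kept arbitrary because only \<open>drift_eq_0\<close> shows that it vanishes.\<close>

locale equivariant_walk =
  nilpotent_covering_graph \<Gamma> X arev \<phi> \<psi> + stratified: stratified_lie_group G
  for \<Gamma> :: "('c, 'm) monoid_scheme" and X :: "('v, 'e) pre_digraph" and arev :: "'e \<Rightarrow> 'e"
    and \<phi> :: "'c \<Rightarrow> 'v \<Rightarrow> 'v" and \<psi> :: "'c \<Rightarrow> 'e \<Rightarrow> 'e"
    and G :: "('g, 'l::euclidean_space, 'n) stratified_group_scheme" +
  fixes \<iota> :: "'c \<Rightarrow> 'g" and p :: "'e \<Rightarrow> real" and m :: "'v set \<Rightarrow> real" and \<Phi> :: "'v \<Rightarrow> 'g" and v :: 'l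
  assumes lattice: "cocompact_lattice G \<Gamma> \<iota>"
    and transition: "transition_probability X arev p"
    and p_invariant: "\<forall>\<gamma>\<in>carrier \<Gamma>. \<forall>e\<in>arcs X. p (\<psi> \<gamma> e) = p e"
    and irreducible: "irreducible_walk X0 (quotient_prob p)"
    and invariant: "invariant_measure X0 (quotient_rev arev) (quotient_prob p) m"
    and realization: "equivariant_realization G \<Gamma> \<iota> X \<phi> \<Phi>"
    and harmonic: "modified_harmonic G X p v \<Phi>"
begin

abbreviation "p0 \<equiv> quotient_prob p"
abbreviation "increment \<epsilon> \<equiv> log_d G X \<Phi> (lift \<epsilon>)"
abbreviation "edge_weight \<equiv> edge_measure X0 p0 m"

section \<open>Transition probabilities, increments and drift on the quotient graph\<close>

lemma \<Phi>_closed: "x \<in> verts X \<Longrightarrow> \<Phi> x \<in> carrier G"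
  using realization by (simp add: equivariant_realization_def)

lemma log_d_translate:
  assumes "\<gamma> \<in> carrier \<Gamma>" "e \<in> arcs X"
  shows "log_d G X \<Phi> (\<psi> \<gamma> e) = log_d G X \<Phi> e"
proof -
  have \<iota>: "\<iota> \<gamma> \<in> carrier G"
    using lattice assms(1) by (auto simp: cocompact_lattice_def hom_def)
  have \<Phi>: "\<Phi> (tail X e) \<in> carrier G" "\<Phi> (head X e) \<in> carrier G"
    using assms(2) \<Phi>_closed by auto
  have "\<Phi> (tail X (\<psi> \<gamma> e)) = \<iota> \<gamma> \<otimes>\<^bsub>G\<^esub> \<Phi> (tail X e)" "\<Phi> (head X (\<psi> \<gamma> e)) = \<iota> \<gamma> \<otimes>\<^bsub>G\<^esub> \<Phi> (head X e)"
    using realization assms tail_equivariant head_equivariant by (auto simp: equivariant_realization_def)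
  moreover have "inv\<^bsub>G\<^esub> \<iota> \<gamma> \<otimes>\<^bsub>G\<^esub> (\<iota> \<gamma> \<otimes>\<^bsub>G\<^esub> \<Phi> (head X e)) = \<Phi> (head X e)"
    using \<iota> \<Phi> by (simp flip: stratified.m_assoc)
  ultimately show ?thesis
    using \<iota> \<Phi> by (simp add: log_d_def stratified.inv_mult_group stratified.m_assoc)
qed

lemma p0_eorbit: "e \<in> arcs X \<Longrightarrow> p0 (eorbit e) = p e"
  using lift_eorbit [of e] p_invariant by (auto simp: quotient_prob_def)

lemma increment_eorbit: "e \<in> arcs X \<Longrightarrow> increment (eorbit e) = log_d G X \<Phi> e"
  using lift_eorbit [of e] log_d_translate by auto

lemma \<Phi>_head: "e \<in> arcs X \<Longrightarrow> \<Phi> (head X e) = \<Phi> (tail X e) \<otimes>\<^bsub>G\<^esub> lexp G (log_d G X \<Phi> e)"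
  using \<Phi>_closed by (simp add: log_d_def flip: stratified.m_assoc)

lemma p_nonneg: "e \<in> arcs X \<Longrightarrow> 0 \<le> p e"
  and sum_p: "x \<in> verts X \<Longrightarrow> (\<Sum>e\<in>out_arcs X x. p e) = 1"
  using transition by (simp_all add: transition_probability_def)

lemma p0_nonneg: "\<epsilon> \<in> arcs X0 \<Longrightarrow> 0 \<le> p0 \<epsilon>"
  by (auto simp: arcs_X0 p0_eorbit p_nonneg)

lemma sum_out_arcs_p0:
  fixes f :: "'e set \<Rightarrow> 'b::real_vector"
  assumes "x \<in> verts X"
  shows "(\<Sum>\<epsilon>\<in>out_arcs X0 (vorbit x). p0 \<epsilon> *\<^sub>R f \<epsilon>) = (\<Sum>e\<in>out_arcs X x. p e *\<^sub>R f (eorbit e))"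
  unfolding sum_out_arcs_eorbit [OF assms, symmetric]
  by (rule sum.cong) (auto simp: p0_eorbit)

lemma sum_p0: "y \<in> verts X0 \<Longrightarrow> (\<Sum>\<epsilon>\<in>out_arcs X0 y. p0 \<epsilon>) = 1"
  using sum_out_arcs_p0 [where f = "\<lambda>_. 1::real"] sum_p by (auto simp: verts_X0)

lemma harmonic_X0: "y \<in> verts X0 \<Longrightarrow> (\<Sum>\<epsilon>\<in>out_arcs X0 y. p0 \<epsilon> *\<^sub>R layer_part G 1 (increment \<epsilon>)) = v"
proof -
  assume "y \<in> verts X0"
  then obtain x where x: "x \<in> verts X" "y = vorbit x" by (auto simp: verts_X0)
  have "(\<Sum>\<epsilon>\<in>out_arcs X0 y. p0 \<epsilon> *\<^sub>R layer_part G 1 (increment \<epsilon>)) =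
      (\<Sum>e\<in>out_arcs X x. p e *\<^sub>R layer_part G 1 (log_d G X \<Phi> e))"
    unfolding x(2) sum_out_arcs_p0 [OF x(1)] by (rule sum.cong) (auto simp: increment_eorbit)
  then show ?thesis using harmonic x(1) by (simp add: modified_harmonic_def)
qed

lemma m_props: "x \<in> verts X0 \<Longrightarrow> 0 < m x" "(\<Sum>x\<in>verts X0. m x) = 1"
  using invariant by (auto simp: invariant_measure_def)

text \<open>The horizontal part of the logarithm is additive along edges by
  \<open>layer_part_1_chart_mult\<close>. Harmonicity therefore gives it the constant drift v, and
  its increments are bounded because there are finitely many edge classes.\<close>

lemma drift_eq_0:
  assumes rw: "random_walk X p x M w"
    and lim: "AE \<omega> in M. (\<lambda>n. (1 / real n) *\<^sub>R layer_part G 1 (llog G (\<Phi> (w n \<omega>)))) \<longlonglongrightarrow> 0"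
  shows "v = 0"
proof -
  let ?\<theta> = "\<lambda>x. layer_part G 1 (llog G (\<Phi> x))"
  have step: "?\<theta> (head X e) = ?\<theta> (tail X e) + layer_part G 1 (log_d G X \<Phi> e)" if "e \<in> arcs X" for e
    using that \<Phi>_closed
    by (simp add: \<Phi>_head stratified.llog_mult stratified.layer_part_1_chart_mult)
  show ?thesis
  proof (rule random_walk_drift_eq_0 [OF rw finite_out_arcs _ sum_p _ _ lim])
    fix x assume x: "x \<in> verts X"
    have "(\<Sum>e\<in>out_arcs X x. p e *\<^sub>R ?\<theta> (head X e)) =
        (\<Sum>e\<in>out_arcs X x. p e *\<^sub>R ?\<theta> x + p e *\<^sub>R layer_part G 1 (log_d G X \<Phi> e))"
      by (rule sum.cong) (auto simp: step scaleR_add_right)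
    also have "\<dots> = ?\<theta> x + v"
      using harmonic x by (simp add: sum.distrib sum_p modified_harmonic_def flip: scaleR_sum_left)
    finally show "(\<Sum>e\<in>out_arcs X x. p e *\<^sub>R ?\<theta> (head X e)) = ?\<theta> x + v" .
  next
    fix e assume e: "e \<in> arcs X"
    have "norm (layer_part G 1 (increment (eorbit e))) \<le> (\<Sum>\<epsilon>\<in>arcs X0. norm (layer_part G 1 (increment \<epsilon>)))"
      by (rule member_le_sum) (use e finite_quotient_arcs in \<open>auto simp: arcs_X0\<close>)
    then show "norm (?\<theta> (head X e) - ?\<theta> (tail X e)) \<le> (\<Sum>\<epsilon>\<in>arcs X0. norm (layer_part G 1 (increment \<epsilon>)))"
      using step [OF e] by (simp add: increment_eorbit [OF e])
  qed auto
qed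

lemma centered_steps_X0:
  assumes "v = 0"
  shows "centered_steps G (arcs X0) edge_weight increment"
proof (unfold_locales)
  show "finite (arcs X0)" by (rule finite_quotient_arcs)
  show "0 \<le> edge_weight \<epsilon>" if "\<epsilon> \<in> arcs X0" for \<epsilon>
    using p0_nonneg [OF that] m_props(1) [OF X0_wf(1) [OF that]] by (simp add: edge_measure_def)
  show "(\<Sum>\<epsilon>\<in>arcs X0. edge_weight \<epsilon>) = 1"
  proof -
    have "(\<Sum>\<epsilon>\<in>arcs X0. edge_weight \<epsilon>) = (\<Sum>y\<in>verts X0. (\<Sum>\<epsilon>\<in>out_arcs X0 y. p0 \<epsilon>) * m y)"
      unfolding sum_arcs_X0 sum_distrib_right edge_measure_def by (intro sum.cong) auto
    then show ?thesis by (simp add: sum_p0 m_props)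
  qed
  have "(\<Sum>\<epsilon>\<in>arcs X0. edge_weight \<epsilon> *\<^sub>R layer_part G 1 (increment \<epsilon>)) =
      (\<Sum>y\<in>verts X0. m y *\<^sub>R (\<Sum>\<epsilon>\<in>out_arcs X0 y. p0 \<epsilon> *\<^sub>R layer_part G 1 (increment \<epsilon>)))"
    unfolding sum_arcs_X0 scaleR_sum_right edge_measure_def by (intro sum.cong) (auto simp: mult.commute)
  then show "(\<Sum>\<epsilon>\<in>arcs X0. edge_weight \<epsilon> *\<^sub>R layer_part G 1 (increment \<epsilon>)) = 0"
    by (simp add: harmonic_X0 assms)
qed

text \<open>The indicator of y minus m y has m-mean m y - m y = 0, so the Poisson equation is
  solvable for every vertex y of the quotient.\<close>

lemma corrector_exists:
  "\<exists>\<xi>. \<forall>y\<in>verts X0. \<forall>x\<in>verts X0.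
    (\<Sum>\<epsilon>\<in>out_arcs X0 x. p0 \<epsilon> * \<xi> y (head X0 \<epsilon>)) - \<xi> y x = (if x = y then 1 else 0) - m y"
proof -
  have "\<exists>\<xi>. \<forall>x\<in>verts X0. (\<Sum>\<epsilon>\<in>out_arcs X0 x. p0 \<epsilon> * \<xi> (head X0 \<epsilon>)) - \<xi> x = (if x = y then 1 else 0) - m y"
    if y: "y \<in> verts X0" for y
  proof (rule poisson_equation [OF finite_quotient_verts finite_quotient_arcs X0_wf(2) p0_nonneg sum_p0 irreducible m_props(2) invariant_measure_sum [OF invariant]])
    show "(\<Sum>x\<in>verts X0. m x * ((if x = y then 1 else 0) - m y)) = 0"
      unfolding right_diff_distrib sum_subtractf sum_distrib_right [symmetric]
      using y finite_quotient_verts by (simp add: if_distrib m_props(2) cong: if_cong)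
  qed
  then show ?thesis by (intro bchoice ballI) blast
qed

theorem walk_operator_rate:
  assumes v: "v = 0"
    and \<nu>: "convolution_semigroup G \<nu>"
    and gen: "has_generator G (convolution_operator G \<nu>) (generator_A G X X0 edge_weight \<Phi>)"
    and t: "0 < t" and f: "f \<in> C_inf_smooth G"
  shows "\<exists>C>0. \<forall>n::nat. 1 \<le> n \<longrightarrow> (\<forall>x\<in>verts X.
    \<bar>(walk_operator X p ^^ nat \<lfloor>real n * t\<rfloor>) (scaling_operator G \<Phi> (1 / sqrt (real n)) f) x
      - scaling_operator G \<Phi> (1 / sqrt (real n)) (convolution_operator G \<nu> t f) x\<bar> \<le> C / sqrt (real n))"
proof -
  interpret cs: centered_steps G "arcs X0" edge_weight increment
    by (rule centered_steps_X0 [OF v])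
  obtain \<xi> where \<xi>: "\<And>x y. y \<in> verts X0 \<Longrightarrow> x \<in> verts X0 \<Longrightarrow>
    (\<Sum>\<epsilon>\<in>out_arcs X0 x. p0 \<epsilon> * \<xi> y (head X0 \<epsilon>)) - \<xi> y x = (if x = y then 1 else 0) - m y"
    using corrector_exists by blast
  \<comment> \<open>Seen from x, class i has frequency \<open>p0 i\<close> if x lies over the tail
    of i and 0 otherwise, with mean \<open>p0 i\<close> times m of that tail. So the corrector of an
    edge class is \<open>p0 i\<close> times the corrector of its tail.\<close>
  interpret mw: modulated_walk G "arcs X0" edge_weight increment \<nu> "generator_A G X X0 edge_weight \<Phi>"
    "verts X" "out_arcs X" "head X" p eorbit \<Phi> "\<lambda>i x. p0 i * \<xi> (tail X0 i) (vorbit x)"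
  proof (unfold_locales)
    show "generator_A G X X0 edge_weight \<Phi> h x = cs.limit_generator h x"
      if "stratified.decaying h" "x \<in> carrier G" for h x
      using stratified.generator_A_eq [OF that] by (simp add: cs.limit_generator_def)
    show "\<Phi> (head X e) = \<Phi> x \<otimes>\<^bsub>G\<^esub> lexp G (increment (eorbit e))" if "e \<in> out_arcs X x" for x e
      using that \<Phi>_head by (auto simp: increment_eorbit)
    show "(\<Sum>e\<in>out_arcs X x. p e *\<^sub>R layer_part G 1 (increment (eorbit e))) = 0" if "x \<in> verts X" for x
      using harmonic_X0 [of "vorbit x"] that v
      by (simp add: sum_out_arcs_p0 [where f = "\<lambda>\<epsilon>. layer_part G 1 (increment \<epsilon>)"] verts_X0)
    fix x i assume x: "x \<in> verts X" and i: "i \<in> arcs X0"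
    have x0: "vorbit x \<in> verts X0" using x by (simp add: verts_X0)
    have "(\<Sum>e\<in>out_arcs X x. p e * (p0 i * \<xi> (tail X0 i) (vorbit (head X e)))) =
        p0 i * (\<Sum>\<epsilon>\<in>out_arcs X0 (vorbit x). p0 \<epsilon> * \<xi> (tail X0 i) (head X0 \<epsilon>))"
      using sum_out_arcs_p0 [OF x, where f = "\<lambda>\<epsilon>. \<xi> (tail X0 i) (head X0 \<epsilon>)"]
      by (simp add: sum_distrib_left head_X0 mult_ac)
    moreover have "(\<Sum>e\<in>out_arcs X x. p e * (if eorbit e = i then 1 else 0)) = p0 i * (if vorbit x = tail X0 i then 1 else 0)"
    proof -
      have fin: "finite (out_arcs X0 (vorbit x))"
        using finite_quotient_arcs by (simp add: out_arcs_def)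
      have "(\<Sum>e\<in>out_arcs X x. p e * (if eorbit e = i then 1 else 0)) =
          (\<Sum>\<epsilon>\<in>out_arcs X0 (vorbit x). p0 \<epsilon> * (if \<epsilon> = i then 1 else 0))"
        using sum_out_arcs_p0 [OF x, where f = "\<lambda>\<epsilon>. if \<epsilon> = i then 1 else (0::real)"] by simp
      also have "\<dots> = (\<Sum>\<epsilon>\<in>out_arcs X0 (vorbit x). if \<epsilon> = i then p0 i else 0)"
        by (rule sum.cong) auto
      also have "\<dots> = (if i \<in> out_arcs X0 (vorbit x) then p0 i else 0)"
        using fin by simp
      finally show ?thesis using i by (simp add: eq_commute)
    qed
    moreover have "edge_weight i = p0 i * m (tail X0 i)" by (simp add: edge_measure_def)
    ultimately show "(\<Sum>e\<in>out_arcs X x. p e * (p0 i * \<xi> (tail X0 i) (vorbit (head X e)))) - p0 i * \<xi> (tail X0 i) (vorbit x)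
        = (\<Sum>e\<in>out_arcs X x. p e * (if eorbit e = i then 1 else 0)) - edge_weight i"
      by (simp only: right_diff_distrib [symmetric] \<xi> [OF X0_wf(1) [OF i] x0])
  next
    have "finite ((\<lambda>(i, y). \<bar>p0 i * \<xi> (tail X0 i) y\<bar>) ` (arcs X0 \<times> verts X0))"
      using finite_quotient_arcs finite_quotient_verts by simp
    then have "\<bar>p0 i * \<xi> (tail X0 i) (vorbit x)\<bar> \<le> Max ((\<lambda>(i, y). \<bar>p0 i * \<xi> (tail X0 i) y\<bar>) ` (arcs X0 \<times> verts X0))"
      if "i \<in> arcs X0" "x \<in> verts X" for i x
      using that by (intro Max_ge) (auto simp: verts_X0 image_iff intro!: bexI)
    then show "\<exists>K. \<forall>i\<in>arcs X0. \<forall>x\<in>verts X. \<bar>p0 i * \<xi> (tail X0 i) (vorbit x)\<bar> \<le> K"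
      by blast
  qed (use \<nu> gen in \<open>auto simp: finite_out_arcs p_nonneg sum_p \<Phi>_closed arcs_X0\<close>)
  have L: "(mw.L ^^ k) H x = (walk_operator X p ^^ k) H x" for k H x
  proof -
    have "mw.L = walk_operator X p" by (simp add: mw.L_def walk_operator_def fun_eq_iff)
    then show ?thesis by simp
  qed
  show ?thesis
    using mw.L_power_rate [OF f [unfolded stratified.C_inf_smooth_iff] t]
    by (simp add: L mw.pos_def scaling_operator_def [abs_def])
qed

end

text \<open>The sup-norm is taken in \<open>ereal\<close>, where an unbounded set has supremum
  infinity; the inequality therefore implies the bound at every vertex.\<close>

theorem proposition7p4:
  fixes G :: "('g, 'l::euclidean_space) stratified_group"
    and \<Gamma> :: "'c monoid" and \<iota> :: "'c \<Rightarrow> 'g"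
    and X :: "('v, 'e) pre_digraph" and arev :: "'e \<Rightarrow> 'e"
    and \<phi> :: "'c \<Rightarrow> 'v \<Rightarrow> 'v" and \<psi> :: "'c \<Rightarrow> 'e \<Rightarrow> 'e"
    and X0 :: "('v set, 'e set) pre_digraph" and rev0 :: "'e set \<Rightarrow> 'e set"
    and p :: "'e \<Rightarrow> real" and p0 :: "'e set \<Rightarrow> real" and m :: "'v set \<Rightarrow> real"
    and \<rho> :: "('e set \<Rightarrow> real) \<Rightarrow> 'l" and \<Phi>0 :: "'v \<Rightarrow> 'g"
    and \<A> :: "('g \<Rightarrow> real) \<Rightarrow> 'g \<Rightarrow> real" and \<nu> :: "real \<Rightarrow> 'g measure"
    and x0 :: 'v and M :: "'o measure" and w :: "nat \<Rightarrow> 'o \<Rightarrow> 'v"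
    and t :: real and f :: "'g \<Rightarrow> real"
  defines "X0 \<equiv> quotient_graph \<Gamma> X \<phi> \<psi>"
    and "rev0 \<equiv> quotient_rev arev"
    and "p0 \<equiv> quotient_prob p"
    and "\<A> \<equiv> generator_A G X X0 (edge_measure X0 p0 m) \<Phi>0"
  assumes A1: "stratified_lie_group G"
    and lattice: "cocompact_lattice G \<Gamma> \<iota>"
    and covering: "nilpotent_covering_graph \<Gamma> X arev \<phi> \<psi>"
    and transition: "transition_probability X arev p"
    and p_invariant: "\<forall>\<gamma>\<in>carrier \<Gamma>. \<forall>e\<in>arcs X. p (\<psi> \<gamma> e) = p e"
    and irreducible: "irreducible_walk X0 p0"
    and invariant: "invariant_measure X0 rev0 p0 m"
    and rho: "induced_homology_map G \<Gamma> \<iota> X arev \<phi> \<psi> \<rho>"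
    and realization: "equivariant_realization G \<Gamma> \<iota> X \<phi> \<Phi>0"
    and harmonic: "modified_harmonic G X p (\<rho> (homological_direction X0 rev0 p0 m)) \<Phi>0"
    and walk: "random_walk X p x0 M w"
    and A2: "AE \<omega> in M. (\<lambda>n. (1 / real n) *\<^sub>R layer_part G 1 (llog G (\<Phi>0 (w n \<omega>)))) \<longlonglongrightarrow> 0"
    and convolution: "convolution_semigroup G \<nu>"
    and generator: "has_generator G (convolution_operator G \<nu>) \<A>"
    and t: "0 < t"
    and f: "f \<in> C_inf_smooth G"
  shows "\<exists>C>0. \<forall>n::nat. 1 \<le> n \<longrightarrow>
    (SUP x\<in>verts X. ereal \<bar>
        (walk_operator X p ^^ nat \<lfloor>real n * t\<rfloor>) (scaling_operator G \<Phi>0 (1 / sqrt (real n)) f) x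
      - scaling_operator G \<Phi>0 (1 / sqrt (real n)) (convolution_operator G \<nu> t f) x\<bar>)
    \<le> ereal (C / sqrt (real n))"
proof -
  have gen: "has_generator G (convolution_operator G \<nu>)
      (generator_A G X (quotient_graph \<Gamma> X \<phi> \<psi>)
        (edge_measure (quotient_graph \<Gamma> X \<phi> \<psi>) (quotient_prob p) m) \<Phi>0)"
    using generator unfolding \<A>_def X0_def p0_def .
  interpret ew: equivariant_walk \<Gamma> X arev \<phi> \<psi> G \<iota> p m \<Phi>0 "\<rho> (homological_direction X0 rev0 p0 m)"
    using A1 covering lattice transition p_invariant irreducible invariant realization harmonic
    unfolding X0_def rev0_def p0_def
    by (simp add: equivariant_walk_def equivariant_walk_axioms_def)
  have "\<rho> (homological_direction X0 rev0 p0 m) = 0"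
    by (rule ew.drift_eq_0 [OF walk A2])
  from ew.walk_operator_rate [OF this convolution gen t f]
  obtain C where C: "C > 0" "\<And>n x. 1 \<le> n \<Longrightarrow> x \<in> verts X \<Longrightarrow>
      \<bar>(walk_operator X p ^^ nat \<lfloor>real n * t\<rfloor>) (scaling_operator G \<Phi>0 (1 / sqrt (real n)) f) x
      - scaling_operator G \<Phi>0 (1 / sqrt (real n)) (convolution_operator G \<nu> t f) x\<bar> \<le> C / sqrt (real n)"
    by blast
  then show ?thesis
    by (intro exI [of _ C] conjI allI impI SUP_least) simp_all
qed

end
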